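(* Let $m,n,\delta$ be positive integers with $n\ge 2$ and $\delta\le m$. If $\delta\geq \max\{n, \frac{m+10}{4}\}$, then every $3$-connected graph $G \in \mathcal{G}(n,m,\delta)$ contains a cycle of length $2n$.
   Context: All graphs are finite and simple. For positive integers $n\ge 2$, $m$ and $\delta$ with $\delta\le m$, $\mathcal{G}(n,m,\delta)$ denotes the set of all bipartite graphs $G$ with a bipartition $(X,Y)$ such that $|X|=n$, $|Y|=m$, and $d(x)\ge\delta$ for every $x\in X$. (A cycle of length $2n$ in such a graph is precisely a cycle containing all vertices of $X$.) A graph is $3$-connected if it has more than $3$ vertices and remains connected after the deletion of any set of fewer than $3$ vertices. *)

theory Defs
  imports "Graph_Theory.Graph_Theory"
begin

text \<open>
  Finite simple graphs are represented by the locale \<^locale>\<open>graph\<close> of the Graph_Theory entry: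
  finite digraphs without loops and parallel arcs whose arc relation is symmetric, so that an
  undirected edge is a pair of opposite arcs.  Consequently the degree of a vertex is its
  \<^const>\<open>out_degree\<close>, and a directed cycle of length at least 3 is the same as a cycle of the
  undirected graph (directed cycles of length 2, which traverse one edge back and forth,
  are the only exception).
\<close>

definition bipartition :: "('a, 'b) pre_digraph \<Rightarrow> 'a set \<Rightarrow> 'a set \<Rightarrow> bool" where
  "bipartition G X Y \<longleftrightarrow> X \<union> Y = verts G \<and> X \<inter> Y = {} \<and>
     (\<forall>u v. u \<rightarrow>\<^bsub>G\<^esub> v \<longrightarrow> u \<in> X \<and> v \<in> Y \<or> u \<in> Y \<and> v \<in> X)"

definition bipartite_class :: "nat \<Rightarrow> nat \<Rightarrow> nat \<Rightarrow> ('a, 'b) pre_digraph set" where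
  "bipartite_class n m \<delta> = {G. graph G \<and>
     (\<exists>X Y. bipartition G X Y \<and> card X = n \<and> card Y = m \<and> (\<forall>x\<in>X. \<delta> \<le> out_degree G x))}"

definition k_connected :: "nat \<Rightarrow> ('a, 'b) pre_digraph \<Rightarrow> bool" where
  "k_connected k G \<longleftrightarrow> k < card (verts G) \<and>
     (\<forall>S. S \<subseteq> verts G \<and> card S < k \<longrightarrow> connected (G \<restriction> (verts G - S)))"

end

theory Submission
  imports Defs
begin

text \<open>
  Suppose that no cycle covers \<open>X\<close>, let \<open>Z\<close> be the vertex set of a cycle with the largest number \<open>c\<close> of
  vertices in \<open>X\<close>, and let \<open>x \<in> X\<close> lie off \<open>Z\<close>, in the component \<open>H\<close> of the graph without \<open>Z\<close>.  If a path
  between \<open>s, t \<in> X\<close> contains more than \<open>c\<close> vertices of \<open>X\<close>, then \<open>s\<close> and \<open>t\<close> have no common neighbour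
  outside the path.  So families of vertices that are pairwise joined by such paths have neighbourhoods
  that are disjoint off a small set; as the degrees are at least \<open>\<delta>\<close> and \<open>card Y \<le> 4\<delta> - 10\<close>, the sizes
  of such families are limited.

  Counting in this way shows first that \<open>x\<close> has at most three neighbours in \<open>Z\<close>.  By 3-connectivity
  there are then three vertices of \<open>Z\<close> with neighbours in \<open>H\<close>, among them all neighbours of \<open>x\<close>
  in \<open>Z\<close>, such that any two are linked by a path through \<open>H\<close> that meets \<open>X\<close>.  They cut the cycle
  into three segments, whose first \<open>X\<close>-vertices \<open>a', b', c'\<close> are pairwise joined by long paths.  A vertex of \<open>Z\<close>
  adjacent to two of \<open>a', b', c'\<close> has a predecessor that can be added to such a family, and as a family of
  five containing \<open>x\<close> is impossible, there is little overlap: the neighbourhoods of \<open>x, a', b', c'\<close> give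
  \<open>card Y \<ge> 4\<delta> - 9\<close>, a contradiction.
\<close>

section \<open>Paths and cycles in bipartite graphs\<close>

text \<open>The engine is a degree sum on a path from \<open>s\<close> to \<open>t\<close>: if
  \<open>t\<close> is adjacent to a \<open>Y\<close>-vertex and \<open>s\<close> to the next
  \<open>Y\<close>-vertex, the \<open>X\<close>-vertex between them is a crosser, so without
  crossers the two degrees on the path add up to at most the number of its \<open>Y\<close>-vertices
  plus 1. If the path has \<open>c + 1\<close> vertices of \<open>X\<close>, the cycle that a
  crosser produces is again longest and misses the crosser. Hence a bound \<open>K\<close> on the
  neighbours that outside vertices have on longest cycles limits the number of crossers, and this in
  turn bounds \<open>K\<close>. The later difficulty is that attachments may lie in \<open>X\<close>
  or in \<open>Y\<close>. One in \<open>Y\<close> may be a neighbour of \<open>x\<close>, but then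
  the \<open>X\<close>-vertex starting the next segment has no neighbour in \<open>H\<close>; after
  one in \<open>X\<close>, that vertex may have a single neighbour in \<open>H\<close>. Either way
  the loss is at most 1 per segment, 3 in all. Overlaps of the three neighbourhoods on
  \<open>Z\<close> cost at most 2 for each of three rotations of the picture, 6 in all. This is the
  9 in 4\<delta> - 9.\<close>

locale bigraph =
  fixes E :: "'a \<Rightarrow> 'a \<Rightarrow> bool" and X Y :: "'a set"
  assumes E_sym: "E u v \<Longrightarrow> E v u"
    and E_bip: "E u v \<Longrightarrow> u \<in> X \<and> v \<in> Y \<or> u \<in> Y \<and> v \<in> X"
    and XY_disj: "X \<inter> Y = {}"
    and fin_X: "finite X" and fin_Y: "finite Y"
begin

definition N :: "'a \<Rightarrow> 'a set" where "N v = {w. E v w}"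

definition walk :: "'a \<Rightarrow> 'a list \<Rightarrow> 'a \<Rightarrow> bool" where
  "walk a xs b \<longleftrightarrow> xs \<noteq> [] \<and> hd xs = a \<and> last xs = b \<and> successively E xs"

definition cyc :: "'a list \<Rightarrow> bool" where
  "cyc xs \<longleftrightarrow> distinct xs \<and> 3 \<le> length xs \<and> (\<exists>a b. walk a xs b \<and> E b a)"

definition nX :: "'a list \<Rightarrow> nat" where "nX xs = card (X \<inter> set xs)"
definition nY :: "'a list \<Rightarrow> nat" where "nY xs = card (Y \<inter> set xs)"

lemma E_commute: "E u v \<longleftrightarrow> E v u"
  using E_sym by blast

lemma E_X: "u \<in> X \<Longrightarrow> E u v \<Longrightarrow> v \<in> Y" "u \<in> X \<Longrightarrow> E v u \<Longrightarrow> v \<in> Y"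
  and E_Y: "u \<in> Y \<Longrightarrow> E u v \<Longrightarrow> v \<in> X" "u \<in> Y \<Longrightarrow> E v u \<Longrightarrow> v \<in> X"
  using E_bip XY_disj by blast+

lemma X_not_Y: "u \<in> X \<Longrightarrow> u \<notin> Y" "u \<in> Y \<Longrightarrow> u \<notin> X"
  using XY_disj by blast+

lemma not_E_refl [simp]: "\<not> E u u"
  using E_bip X_not_Y by blast

lemma N_subset_Y: "u \<in> X \<Longrightarrow> N u \<subseteq> Y"
  unfolding N_def using E_X by blast

lemma fin_N: "u \<in> X \<Longrightarrow> finite (N u)"
  using N_subset_Y fin_Y finite_subset by blast

lemma walk_single [simp]: "walk a [v] b \<longleftrightarrow> v = a \<and> v = b"
  by (auto simp: walk_def)

lemma walk_Cons: "walk a (v # w # xs) b \<longleftrightarrow> v = a \<and> E v w \<and> walk w (w # xs) b"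
  by (auto simp: walk_def)

lemma walk_append: "walk a xs b \<Longrightarrow> walk d ys e \<Longrightarrow> E b d \<Longrightarrow> walk a (xs @ ys) e"
  by (auto simp: walk_def successively_append_iff)

lemma walk_rev: "walk a xs b \<Longrightarrow> walk b (rev xs) a"
  by (auto simp: walk_def hd_rev last_rev E_commute cong: successively_cong)

lemma walk_append_iff: "xs \<noteq> [] \<Longrightarrow> ys \<noteq> [] \<Longrightarrow>
    walk a (xs @ ys) b \<longleftrightarrow> walk a xs (last xs) \<and> walk (hd ys) ys b \<and> E (last xs) (hd ys)"
  by (auto simp: walk_def successively_append_iff)

lemma walk_ends: "walk a xs b \<Longrightarrow> a \<in> set xs" "walk a xs b \<Longrightarrow> b \<in> set xs"
  by (auto simp: walk_def)

lemma walk_verts: "walk a xs b \<Longrightarrow> a \<in> X \<union> Y \<Longrightarrow> set xs \<subseteq> X \<union> Y"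
proof (induction xs arbitrary: a)
  case (Cons v xs)
  show ?case
  proof (cases xs)
    case (Cons w r)
    have "v = a" "E v w" "walk w xs b"
      using Cons.prems Cons walk_Cons by blast+
    moreover have "w \<in> X \<union> Y" using \<open>E v w\<close> E_bip by blast
    ultimately show ?thesis using Cons.IH[of w] Cons.prems by auto
  qed (use Cons.prems in auto)
qed (simp add: walk_def)

lemma nX_le: "nX xs \<le> card X"
  unfolding nX_def by (rule card_mono) (auto simp: fin_X)

lemma nX_Cons: "distinct (v # xs) \<Longrightarrow> nX (v # xs) = (if v \<in> X then 1 else 0) + nX xs"
  and nY_Cons: "distinct (v # xs) \<Longrightarrow> nY (v # xs) = (if v \<in> Y then 1 else 0) + nY xs"
  by (auto simp: nX_def nY_def)

lemma nX_append: "distinct (xs @ ys) \<Longrightarrow> nX (xs @ ys) = nX xs + nX ys"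
  unfolding nX_def by (subst card_Un_disjoint[symmetric]) (auto intro: arg_cong[of _ _ card])

text \<open>The two sides alternate along a walk, so the counts differ only through the ends;
  placing one indicator on each side avoids subtraction.\<close>

lemma nX_nY_walk:
  "walk a xs b \<Longrightarrow> distinct xs \<Longrightarrow> a \<in> X \<union> Y \<Longrightarrow>
   nX xs + (if a \<in> Y then 1 else 0) = nY xs + (if b \<in> X then 1 else 0)"
proof (induction xs arbitrary: a)
  case (Cons v xs)
  show ?case
  proof (cases xs)
    case Nil
    then show ?thesis using Cons.prems X_not_Y by (auto simp: nX_def nY_def)
  next
    case (Cons w r)
    have *: "v = a" "E v w" "walk w xs b"
      using Cons.prems Cons walk_Cons by blast+
    have w: "w \<in> X \<union> Y" using \<open>E v w\<close> E_bip by blast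
    have "nX xs + (if w \<in> Y then 1 else 0) = nY xs + (if b \<in> X then 1 else 0)"
      using Cons.IH[of w] * w Cons.prems by simp
    moreover have "nX (v # xs) = (if v \<in> X then 1 else 0) + nX xs"
      "nY (v # xs) = (if v \<in> Y then 1 else 0) + nY xs"
      using Cons.prems by (blast intro: nX_Cons nY_Cons)+
    ultimately show ?thesis using E_bip[OF *(2)] *(1) X_not_Y by auto
  qed
qed (simp add: walk_def)

lemma nX_path: "walk a xs b \<Longrightarrow> distinct xs \<Longrightarrow> a \<in> X \<Longrightarrow> b \<in> X \<Longrightarrow> nX xs = nY xs + 1"
  using nX_nY_walk[of a xs b] X_not_Y by simp

lemma cycI: "walk a xs b \<Longrightarrow> E b a \<Longrightarrow> distinct xs \<Longrightarrow> 3 \<le> length xs \<Longrightarrow> cyc xs"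
  unfolding cyc_def by blast

lemma cyc_verts: "cyc xs \<Longrightarrow> set xs \<subseteq> X \<union> Y"
  unfolding cyc_def using walk_verts E_bip by blast

lemma cyc_nX_nY: "cyc xs \<Longrightarrow> nX xs = nY xs"
proof -
  assume "cyc xs"
  then obtain a b where *: "walk a xs b" "E b a" "distinct xs" by (auto simp: cyc_def)
  then have "a \<in> X \<union> Y" using E_bip by blast
  from nX_nY_walk[OF *(1,3) this] show ?thesis using E_bip[OF *(2)] X_not_Y by auto
qed

lemma cyc_length: "cyc xs \<Longrightarrow> length xs = 2 * nX xs"
proof -
  assume c: "cyc xs"
  then have d: "distinct xs" by (simp add: cyc_def)
  have "card (set xs) = nX xs + nY xs"
    unfolding nX_def nY_def
    by (subst card_Un_disjoint[symmetric]) (use XY_disj cyc_verts[OF c] in \<open>auto intro: arg_cong[of _ _ card]\<close>)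
  then show ?thesis using d cyc_nX_nY[OF c] by (simp add: distinct_card)
qed

lemma cyc_rotate: "cyc (xs @ ys) \<Longrightarrow> cyc (ys @ xs)"
proof (cases "xs = [] \<or> ys = []")
  case False
  assume "cyc (xs @ ys)"
  then obtain a b where w: "walk a (xs @ ys) b" "E b a" and d: "distinct (xs @ ys)" "3 \<le> length (xs @ ys)"
    by (auto simp: cyc_def)
  from w have "walk a xs (last xs)" "walk (hd ys) ys b" "E (last xs) (hd ys)"
    using False by (simp_all add: walk_append_iff)
  then have "walk (hd ys) (ys @ xs) (last xs)" using w(2) walk_append by blast
  with d \<open>E (last xs) (hd ys)\<close> show ?thesis by (intro cycI) auto
qed auto

text \<open>
  If the third argument is a path from \<open>s\<close> to \<open>t\<close>, deleting such a vertex \<open>v\<close> and joining \<open>t\<close> to its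
  predecessor and \<open>s\<close> to its successor gives a cycle that misses only \<open>v\<close>.
\<close>

fun crossers :: "'a \<Rightarrow> 'a \<Rightarrow> 'a list \<Rightarrow> 'a list" where
  "crossers s t (u # v # w # r) = (if E t u \<and> E s w then [v] else []) @ crossers s t (v # w # r)"
| "crossers s t _ = []"

lemma crossers_iff: "x \<in> set (crossers s t p) \<longleftrightarrow> (\<exists>q1 u w q2. p = q1 @ u # x # w # q2 \<and> E t u \<and> E s w)"
proof (induction s t p rule: crossers.induct)
  case (1 s t u v w r)
  show ?case (is "_ = (\<exists>q1 u' w' q2. ?P q1 u' w' q2)")
  proof
    assume "x \<in> set (crossers s t (u # v # w # r))"
    then consider "x = v" "E t u" "E s w" | "x \<in> set (crossers s t (v # w # r))" by (auto split: if_splits)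
    then show "\<exists>q1 u' w' q2. ?P q1 u' w' q2"
    proof cases
      case 1 then show ?thesis by (intro exI[of _ "[]"]) auto
    next
      case 2
      then obtain q1 u' w' q2 where "v # w # r = q1 @ u' # x # w' # q2" "E t u'" "E s w'"
        using 1 by blast
      then show ?thesis by (intro exI[of _ "u # q1"]) auto
    qed
  next
    assume "\<exists>q1 u' w' q2. ?P q1 u' w' q2"
    then obtain q1 u' w' q2 where P: "?P q1 u' w' q2" by blast
    show "x \<in> set (crossers s t (u # v # w # r))"
    proof (cases q1)
      case (Cons a q)
      then have "v # w # r = q @ u' # x # w' # q2" using P by simp
      then have "x \<in> set (crossers s t (v # w # r))" using 1 P by blast
      then show ?thesis by simp
    qed (use P in auto)
  qed
qed (auto simp: Cons_eq_append_conv append_eq_Cons_conv)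

lemma crossers_subset: "set (crossers s t p) \<subseteq> set p"
  using crossers_iff by fastforce

lemma crossers_subset_tl: "set (crossers s t (a # p)) \<subseteq> set p"
  by (auto simp: crossers_iff Cons_eq_append_conv)

lemma distinct_crossers: "distinct p \<Longrightarrow> distinct (crossers s t p)"
proof (induction s t p rule: crossers.induct)
  case (1 s t u v w r)
  then show ?case using crossers_subset_tl[of s t v "w # r"] by auto
qed auto

text \<open>Being a crosser is a condition on three consecutive vertices, so it survives in a longer
  list, where \<open>M\<close> and the seams can only add more. Needed for paths of which only the
  outer pieces lie on the cycle.\<close>

lemma crossers_append_length:
  assumes "distinct (p @ M @ q)"
  shows "length (crossers s t p) + length (crossers s t q) \<le> length (crossers s t (p @ M @ q))"
proof -
  have d: "distinct (crossers s t p)" "distinct (crossers s t q)" "distinct (crossers s t (p @ M @ q))"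
    using assms distinct_crossers by auto
  have "set (crossers s t p) \<union> set (crossers s t q) \<subseteq> set (crossers s t (p @ M @ q))"
  proof (intro Un_least subsetI)
    fix x assume "x \<in> set (crossers s t p)"
    then obtain q1 u w q2 where "p = q1 @ u # x # w # q2" "E t u" "E s w" by (auto simp: crossers_iff)
    then show "x \<in> set (crossers s t (p @ M @ q))"
      unfolding crossers_iff by (intro exI[of _ q1] exI[of _ u] exI[of _ w] exI[of _ "q2 @ M @ q"]) simp
  next
    fix x assume "x \<in> set (crossers s t q)"
    then obtain q1 u w q2 where "q = q1 @ u # x # w # q2" "E t u" "E s w" by (auto simp: crossers_iff)
    then show "x \<in> set (crossers s t (p @ M @ q))"
      unfolding crossers_iff by (intro exI[of _ "p @ M @ q1"] exI[of _ u] exI[of _ w] exI[of _ q2]) simp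
  qed
  then have "card (set (crossers s t p) \<union> set (crossers s t q)) \<le> card (set (crossers s t (p @ M @ q)))"
    by (rule card_mono[rotated]) simp
  moreover have "set (crossers s t p) \<inter> set (crossers s t q) = {}"
    using crossers_subset[of s t p] crossers_subset[of s t q] assms by auto
  ultimately show ?thesis using d by (simp add: card_Un_disjoint distinct_card)
qed

lemma crossers_Cons_X: "t \<in> X \<Longrightarrow> v \<in> X \<Longrightarrow> crossers s t (v # p) = crossers s t p"
proof (cases p)
  case (Cons w r)
  assume "t \<in> X" "v \<in> X"
  then have "\<not> E t v" using E_bip X_not_Y by blast
  then show ?thesis using Cons by (cases r) auto
qed auto

text \<open>An adjacency of \<open>t\<close> to a \<open>Y\<close>-vertex is paired with one of
  \<open>s\<close> to the next \<open>Y\<close>-vertex; both hold only around a crosser. The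
  adjacency of \<open>s\<close> to the first \<open>Y\<close>-vertex has no partner, whence the last
  summand.\<close>

lemma deg_sum_crossers_aux:
  assumes "s \<in> X" "t \<in> X" "successively E p" "p \<noteq> []" "hd p \<in> Y"
  shows "length (filter (E s) p) + length (filter (E t) p)
    \<le> length (filter (\<lambda>v. v \<in> Y) p) + length (crossers s t p) + (if E s (hd p) then 1 else 0)"
  using assms(3-)
proof (induction "length p" arbitrary: p rule: less_induct)
  case less
  obtain y r where p: "p = y # r" and y: "y \<in> Y" using less.prems by (cases p) auto
  show ?case
  proof (cases r)
    case Nil
    then show ?thesis using p y by auto
  next
    case (Cons x r')
    have x: "x \<in> X" using less.prems p Cons y E_Y by auto
    then have nx: "\<not> E s x" "\<not> E t x" "x \<notin> Y" using assms(1,2) E_bip X_not_Y by blast+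
    show ?thesis
    proof (cases r')
      case Nil
      then show ?thesis using p Cons y nx by auto
    next
      case (Cons y' r'')
      have "y' \<in> Y" using less.prems p \<open>r = x # r'\<close> Cons x E_X by auto
      moreover have "successively E (y' # r'')" using less.prems p \<open>r = x # r'\<close> Cons by simp
      ultimately have IH: "length (filter (E s) (y' # r'')) + length (filter (E t) (y' # r''))
          \<le> length (filter (\<lambda>v. v \<in> Y) (y' # r'')) + length (crossers s t (y' # r''))
            + (if E s y' then 1 else 0)"
        using less.hyps[of "y' # r''"] p \<open>r = x # r'\<close> Cons by simp
      have "crossers s t (x # y' # r'') = crossers s t (y' # r'')" using crossers_Cons_X assms(2) x by blast
      then show ?thesis using IH p \<open>r = x # r'\<close> Cons nx y
        by (cases "E s y"; cases "E t y"; cases "E s y'"; cases "E t y'"; simp)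
    qed
  qed
qed

lemma deg_sum_crossers:
  assumes "s \<in> X" "t \<in> X" "successively E p" "distinct p" "set p \<subseteq> X \<union> Y"
  shows "card (N s \<inter> set p) + card (N t \<inter> set p) \<le> nY p + 1 + length (crossers s t p)"
proof -
  have cardf: "card (N v \<inter> set p) = length (filter (E v) p)" for v
  proof -
    have "N v \<inter> set p = set (filter (E v) p)" by (auto simp: N_def)
    then show ?thesis using assms(4) by (simp only: distinct_card distinct_filter)
  qed
  have cardY: "nY p = length (filter (\<lambda>v. v \<in> Y) p)"
  proof -
    have "Y \<inter> set p = set (filter (\<lambda>v. v \<in> Y) p)" by auto
    then show ?thesis using assms(4) unfolding nY_def by (simp only: distinct_card distinct_filter)
  qed
  have "length (filter (E s) p) + length (filter (E t) p)
      \<le> length (filter (\<lambda>v. v \<in> Y) p) + 1 + length (crossers s t p)"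
  proof (cases p)
    case (Cons v r)
    show ?thesis
    proof (cases "v \<in> Y")
      case True
      have "p \<noteq> []" "hd p \<in> Y" using True Cons by auto
      from deg_sum_crossers_aux[OF assms(1-3) this] show ?thesis by (simp split: if_splits)
    next
      case False
      then have v: "v \<in> X" using assms(5) Cons by auto
      then have nv: "\<not> E s v" "\<not> E t v" using assms(1,2) E_bip X_not_Y by blast+
      show ?thesis
      proof (cases r)
        case (Cons y r')
        have "y \<in> Y" "successively E r" using assms(3) \<open>p = v # r\<close> Cons v E_X by auto
        then have "length (filter (E s) r) + length (filter (E t) r)
          \<le> length (filter (\<lambda>v. v \<in> Y) r) + length (crossers s t r) + (if E s (hd r) then 1 else 0)"
          using deg_sum_crossers_aux[OF assms(1,2), of r] Cons by simp
        then show ?thesis using \<open>p = v # r\<close> nv False crossers_Cons_X[OF assms(2) v] by (simp split: if_splits)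
      qed (use \<open>p = v # r\<close> nv in simp)
    qed
  qed simp
  then show ?thesis by (simp add: cardf cardY)
qed

lemma crossing_cyc:
  assumes "walk s (q1 @ u # v # w # q2) t" "distinct (q1 @ u # v # w # q2)" "s \<in> X" "t \<in> X" "E t u" "E s w"
  shows "cyc (q1 @ u # rev q2 @ [w])"
proof -
  have uw: "u \<in> Y" "w \<in> Y" using assms E_X by blast+
  have q1: "q1 \<noteq> []" "q2 \<noteq> []" using assms uw X_not_Y by (auto simp: walk_def)
  have 1: "walk s (q1 @ [u]) u" "walk w (w # q2) t"
    using assms(1) q1 by (auto simp: walk_def successively_append_iff)
  have "walk s ((q1 @ [u]) @ rev (w # q2)) w"
    using walk_append[OF 1(1) walk_rev[OF 1(2)]] assms(5) E_sym by blast
  then show ?thesis using assms q1 E_sym by (intro cycI[of s _ w]) (auto simp: Suc_le_eq)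
qed

lemma union_count:
  assumes "finite Q" "Q \<subseteq> X" "W \<subseteq> Y"
    and "\<And>q. q \<in> Q \<Longrightarrow> F q \<subseteq> Y"
    and "\<And>q q'. q \<in> Q \<Longrightarrow> q' \<in> Q \<Longrightarrow> q \<noteq> q' \<Longrightarrow> F q \<inter> F q' \<subseteq> W"
  shows "card W + (\<Sum>q\<in>Q. card (F q)) \<le> card Y + (\<Sum>q\<in>Q. card (F q \<inter> W))"
proof -
  have fF: "finite (F q)" if "q \<in> Q" for q using assms(4) that fin_Y finite_subset by blast
  have fW: "finite W" using assms(3) fin_Y finite_subset by blast
  have "card (W \<union> (\<Union>q\<in>Q. F q - W)) = card W + card (\<Union>q\<in>Q. F q - W)"
    by (rule card_Un_disjoint) (use fW fF assms(1) in auto)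
  also have "card (\<Union>q\<in>Q. F q - W) = (\<Sum>q\<in>Q. card (F q - W))"
    by (rule card_UN_disjoint) (use assms(1,5) fF in blast)+
  finally have "card W + (\<Sum>q\<in>Q. card (F q - W)) = card (W \<union> (\<Union>q\<in>Q. F q - W))" by simp
  also have "\<dots> \<le> card Y" by (rule card_mono) (use fin_Y assms in auto)
  finally have 1: "card W + (\<Sum>q\<in>Q. card (F q - W)) \<le> card Y" .
  have "(\<Sum>q\<in>Q. card (F q)) = (\<Sum>q\<in>Q. card (F q - W) + card (F q \<inter> W))"
  proof (rule sum.cong[OF refl])
    fix q assume "q \<in> Q"
    then have "card (F q) = card ((F q - W) \<union> (F q \<inter> W))" by (intro arg_cong[of _ _ card]) auto
    also have "\<dots> = card (F q - W) + card (F q \<inter> W)"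
      by (rule card_Un_disjoint) (use fF[OF \<open>q \<in> Q\<close>] in auto)
    finally show "card (F q) = card (F q - W) + card (F q \<inter> W)" .
  qed
  then show ?thesis using 1 by (simp add: sum.distrib)
qed

lemma walk_distinct:
  "walk a p b \<Longrightarrow> \<exists>p'. walk a p' b \<and> distinct p' \<and> set p' \<subseteq> set p"
proof (induction "length p" arbitrary: p rule: less_induct)
  case less
  show ?case
  proof (cases "distinct p")
    case False
    then obtain xs v ys zs where p: "p = xs @ [v] @ ys @ [v] @ zs"
      using not_distinct_decomp by blast
    have "walk a (xs @ v # zs) b"
    proof (cases "xs = []")
      case True
      then have "walk a ((v # ys) @ v # zs) b" using less.prems p by simp
      then have "walk v (v # zs) b" "walk a (v # ys) (last (v # ys))"
        using walk_append_iff[of "v # ys" "v # zs" a b] by (simp_all only: list.simps list.sel not_False_eq_True)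
      moreover from this(2) have "a = v" by (simp add: walk_def)
      ultimately show ?thesis using True by simp
    next
      case False
      then have 1: "walk a xs (last xs)" "walk v (v # ys @ v # zs) b" "E (last xs) v"
        using less.prems p walk_append_iff[of xs "v # ys @ v # zs" a b] by simp_all
      have "walk v (v # zs) b" using 1(2) walk_append_iff[of "v # ys" "v # zs" v b] by simp
      then show ?thesis using walk_append 1 by blast
    qed
    moreover have "length (xs @ v # zs) < length p" using p by simp
    moreover have "set (xs @ v # zs) \<subseteq> set p" using p by auto
    ultimately show ?thesis using less.hyps[of "xs @ v # zs"] by (meson order_trans)
  qed (use less.prems in blast)
qed

lemma crossers_split:
  assumes "distinct P" "P = a @ v # r" "v \<in> set (crossers s t P)"
  shows "a \<noteq> [] \<and> E t (last a) \<and> r \<noteq> [] \<and> E s (hd r)"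
proof -
  obtain q1 u w q2 where P: "P = (q1 @ [u]) @ v # (w # q2)" "E t u" "E s w"
    using assms(3) by (auto simp: crossers_iff)
  have "v \<notin> set (q1 @ [u]) \<and> v \<notin> set (w # q2)" using assms(1) P(1) by auto
  then have "a = q1 @ [u] \<and> r = w # q2"
    using append_Cons_eq_iff[of v "q1 @ [u]" "w # q2" a r] P(1) assms(2) by simp
  then show ?thesis using P by simp
qed

lemma closed_path_cyc:
  assumes "walk s P t" "distinct P" "s \<in> X" "t \<in> X" "s \<noteq> t" "y \<notin> set P" "E s y" "E t y"
  shows "cyc (P @ [y])" "nX (P @ [y]) = nX P"
proof -
  have "walk s (P @ [y]) y" using assms walk_append[of s P t y "[y]" y] by simp
  moreover have "3 \<le> length (P @ [y])" using assms(1,5)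
    by (cases P; cases "tl P") (auto simp: walk_def)
  moreover have "E y s" using assms(7) E_sym by blast
  ultimately show "cyc (P @ [y])" using assms(2,6) by (intro cycI[of s _ y]) auto
  have "y \<notin> X" using assms E_X X_not_Y by blast
  then show "nX (P @ [y]) = nX P" by (simp add: nX_def)
qed

end

section \<open>Longest cycles\<close>

text \<open>\<open>cyc_max\<close> only bounds the cycles; that some cycle attains \<open>c\<close>
  enters separately, through \<open>longest\<close>. \<open>card_Y\<close> is the condition \<delta>
  \<ge> (m + 10) / 4 without fractions.\<close>

locale no_spanning_cycle = bigraph +
  fixes c \<delta> :: nat
  assumes cyc_max: "cyc xs \<Longrightarrow> nX xs \<le> c"
    and min_deg: "v \<in> X \<Longrightarrow> \<delta> \<le> card (N v)"
    and card_Y: "card Y + 10 \<le> 4 * \<delta>"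
    and card_X: "card X \<le> \<delta>"
    and c_less: "c < card X"
    and conn: "finite S \<Longrightarrow> card S < 3 \<Longrightarrow> u \<in> (X \<union> Y) - S \<Longrightarrow> v \<in> (X \<union> Y) - S \<Longrightarrow>
       \<exists>p. walk u p v \<and> set p \<inter> S = {}"
begin

definition longest :: "'a list \<Rightarrow> bool" where "longest C \<longleftrightarrow> cyc C \<and> nX C = c"

text \<open>All longest cycles are quantified over, not a fixed one, because each crosser lies off a
  longest cycle of its own.\<close>

definition nbr_bound :: "nat \<Rightarrow> bool" where
  "nbr_bound K \<longleftrightarrow> (\<forall>C x. longest C \<longrightarrow> x \<in> X \<longrightarrow> x \<notin> set C \<longrightarrow> card (N x \<inter> set C) \<le> K)"

lemma no_common_nbr_off_path:
  assumes "walk s P t" "distinct P" "s \<in> X" "t \<in> X" "s \<noteq> t" "c < nX P"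
  shows "N s \<inter> N t \<subseteq> set P"
proof
  fix y assume "y \<in> N s \<inter> N t"
  then have "E s y" "E t y" by (auto simp: N_def)
  then show "y \<in> set P"
    using closed_path_cyc[OF assms(1-5), of y] cyc_max[of "P @ [y]"] assms(6) by linarith
qed

text \<open>The neighbourhood of a vertex of \<open>X\<close> fits into \<open>Y\<close>, so
  \<delta> \<le> 4\<delta> - 10.\<close>

lemma delta_ge_4: "4 \<le> \<delta>"
proof -
  obtain v where "v \<in> X" using c_less by fastforce
  then have "\<delta> \<le> card Y"
    using min_deg[of v] card_mono[OF fin_Y N_subset_Y[of v]] by simp
  then show ?thesis using card_Y by simp
qed

text \<open>
  The vertices \<open>s\<close>, \<open>t\<close> and all crossers are pairwise joined by paths with the same vertices as \<open>P\<close>, so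
  their neighbourhoods are disjoint off \<open>P\<close>.
\<close>

lemma few_crossings:
  assumes K: "nbr_bound K" and P: "walk s P t" "distinct P" "s \<in> X" "t \<in> X" "s \<noteq> t" "nX P = c + 1"
  shows "length (crossers s t P) * \<delta> + 9 \<le> 2 * \<delta> + length (crossers s t P) * (K + 1)"
proof -
  define L where "L = set (crossers s t P)"
  define Q where "Q = insert s (insert t L)"
  have LP: "L \<subseteq> set P" unfolding L_def by (rule crossers_subset)
  have LX: "L \<subseteq> X"
  proof
    fix v assume v: "v \<in> L"
    then obtain q1 u w q2 where q: "P = q1 @ u # v # w # q2" "E t u"
      by (auto simp: L_def crossers_iff)
    then have "E u v" using P(1) by (auto simp: walk_def successively_append_iff)
    then show "v \<in> X" using q P(4) E_X E_Y by blast
  qed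
  have stL: "s \<notin> L" "t \<notin> L"
  proof -
    show "s \<notin> L"
    proof
      assume "s \<in> L"
      moreover have "P = [] @ s # tl P" using P(1) by (auto simp: walk_def)
      ultimately show False using crossers_split[OF P(2), of "[]" s "tl P" s t] unfolding L_def by simp
    qed
    show "t \<notin> L"
    proof
      assume "t \<in> L"
      moreover have "P = butlast P @ t # []" using P(1) by (auto simp: walk_def)
      ultimately show False using crossers_split[OF P(2), of "butlast P" t "[]" s t] unfolding L_def by simp
    qed
  qed
  have split1: "\<exists>a r. P = a @ v # r \<and> a \<noteq> [] \<and> E t (last a) \<and> r \<noteq> [] \<and> E s (hd r)" if v: "v \<in> L" for v
  proof -
    obtain a r where "P = a @ v # r" using v LP split_list by fastforce
    then show ?thesis using crossers_split[OF P(2), of a v r s t] v by (auto simp: L_def)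
  qed
  \<comment> \<open>Follow \<open>P\<close> to the vertex before \<open>v\<close>, cross to
    \<open>t\<close> and return to \<open>v\<close>.\<close>
  have sv: "\<exists>P'. walk s P' v \<and> distinct P' \<and> set P' = set P" if v: "v \<in> L" for v
  proof -
    obtain a r where q: "P = a @ v # r" "a \<noteq> []" "E t (last a)" using split1[OF v] by blast
    then have "walk s a (last a)" "walk v (v # r) t" using P(1) by (auto simp: walk_append_iff)
    then have "walk s (a @ rev (v # r)) v" using walk_append walk_rev q(3) E_sym by blast
    then show ?thesis using q P(2) by (intro exI[of _ "a @ rev (v # r)"]) auto
  qed
  \<comment> \<open>Return from \<open>v\<close> to \<open>s\<close>, cross to the vertex after
    \<open>v\<close> and go on to \<open>t\<close>.\<close>
  have vt: "\<exists>P'. walk v P' t \<and> distinct P' \<and> set P' = set P" if v: "v \<in> L" for v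
  proof -
    obtain a r where "P = a @ v # r" and r: "r \<noteq> []" "E s (hd r)" using split1[OF v] by blast
    then have q: "P = (a @ [v]) @ r" "r \<noteq> []" "E s (hd r)" by simp_all
    then have "walk s (a @ [v]) (last (a @ [v]))" "walk (hd r) r t"
      using P(1) walk_append_iff[of "a @ [v]" r s t] by blast+
    then have "walk v (rev (a @ [v]) @ r) t" using walk_append walk_rev q(3) by fastforce
    then show ?thesis using q P(2) by (intro exI[of _ "rev (a @ [v]) @ r"]) auto
  qed
  \<comment> \<open>With \<open>v\<close> before \<open>v'\<close>: return from \<open>v\<close> to
    \<open>s\<close>, cross to the vertex after \<open>v\<close>, go on to the vertex before
    \<open>v'\<close>, cross to \<open>t\<close> and return to \<open>v'\<close>.\<close>
  have vv1: "\<exists>P'. walk v P' v' \<and> distinct P' \<and> set P' = set P"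
    if v: "v \<in> L" "v' \<in> L" and q: "P = a @ v # b @ v' # d" for v v' a b d
  proof -
    have 1: "b @ v' # d \<noteq> []" "E s (hd (b @ v' # d))"
      using crossers_split[OF P(2) q] v by (auto simp: L_def)
    have "P = (a @ v # b) @ v' # d" using q by simp
    from crossers_split[OF P(2) this] have 2: "E t (last (a @ v # b))" using v by (auto simp: L_def)
    have "\<not> E s v'" using LX v P(3) E_X X_not_Y by blast
    then have b: "b \<noteq> []" using 1 by auto
    then have 3: "E s (hd b)" "E t (last b)" using 1 2 by auto
    have w: "walk s ((a @ [v]) @ b @ v' # d) t" using P(1) q by simp
    then have w1: "walk s (a @ [v]) v" "walk (hd b) (b @ v' # d) t"
      using walk_append_iff[of "a @ [v]" "b @ v' # d" s t] b by simp_all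
    then have w2: "walk (hd b) b (last b)" "walk v' (v' # d) t"
      using walk_append_iff[of b "v' # d" "hd b" t] b by simp_all
    have "walk v (rev (a @ [v]) @ b @ rev (v' # d)) v'"
      by (rule walk_append[OF walk_rev[OF w1(1)] walk_append[OF w2(1) walk_rev[OF w2(2)]]])
        (use 3 E_sym in blast)+
    then show ?thesis using q P(2) by (intro exI[of _ "rev (a @ [v]) @ b @ rev (v' # d)"]) auto
  qed
  have revP: "\<exists>P'. walk w P' v \<and> distinct P' \<and> set P' = set P"
    if "\<exists>P'. walk v P' w \<and> distinct P' \<and> set P' = set P" for v w
    using that walk_rev by (metis distinct_rev set_rev)
  have vv: "\<exists>P'. walk v P' v' \<and> distinct P' \<and> set P' = set P" if v: "v \<in> L" "v' \<in> L" "v \<noteq> v'" for v v'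
  proof -
    obtain a r where q: "P = a @ v # r" using v LP split_list by fastforce
    have "v' \<in> set a \<or> v' \<in> set r" using q v LP by auto
    then show ?thesis
    proof
      assume "v' \<in> set r"
      then obtain b d where "r = b @ v' # d" using split_list by fastforce
      then show ?thesis using vv1 v q by blast
    next
      assume "v' \<in> set a"
      then obtain b d where "a = b @ v' # d" using split_list by fastforce
      then have "P = b @ v' # d @ v # r" using q by simp
      then show ?thesis using vv1[of v' v b d r] v revP by blast
    qed
  qed
  have pair: "\<exists>P'. walk q P' q' \<and> distinct P' \<and> set P' = set P" if qq: "q \<in> Q" "q' \<in> Q" "q \<noteq> q'" for q q'
  proof -
    consider "q \<in> L" "q' \<in> L" | "q = s" "q' \<in> L" | "q \<in> L" "q' = s" | "q = t" "q' \<in> L" | "q \<in> L" "q' = t"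
      | "q = s" "q' = t" | "q = t" "q' = s"
      using qq unfolding Q_def by blast
    then show ?thesis
    proof cases
      case 1 then show ?thesis using vv qq by simp
    next
      case 2 then show ?thesis using sv by simp
    next
      case 3 then show ?thesis using revP[OF sv] by simp
    next
      case 4 then show ?thesis using revP[OF vt] by simp
    next
      case 5 then show ?thesis using vt by simp
    next
      case 6 then show ?thesis using P by blast
    next
      case 7 then show ?thesis using revP[of s t] P by blast
    qed
  qed
  have QX: "Q \<subseteq> X" using P LX by (auto simp: Q_def)
  have PXY: "set P \<subseteq> X \<union> Y" using walk_verts P by blast
  have common: "N q \<inter> N q' \<subseteq> Y \<inter> set P" if q: "q \<in> Q" "q' \<in> Q" "q \<noteq> q'" for q q'
  proof -
    obtain P' where P': "walk q P' q'" "distinct P'" "set P' = set P" using pair q by blast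
    then have "nX P' = c + 1" using P by (simp add: nX_def)
    then have "N q \<inter> N q' \<subseteq> set P'" using no_common_nbr_off_path[OF P'(1,2)] QX q by auto
    then show ?thesis using N_subset_Y QX q P' by blast
  qed
  \<comment> \<open>The cycle produced by the crosser \<open>v\<close> misses only \<open>v\<close>,
    so it is longest and contains every neighbour of \<open>v\<close> on \<open>P\<close>.\<close>
  have vK: "card (N v \<inter> (Y \<inter> set P)) \<le> K" if v: "v \<in> L" for v
  proof -
    obtain q1 u w q2 where q: "P = q1 @ u # v # w # q2" "E t u" "E s w"
      using v by (auto simp: L_def crossers_iff)
    let ?C = "q1 @ u # rev q2 @ [w]"
    have C: "cyc ?C" using crossing_cyc P q by blast
    have "nX P = Suc (nX ?C)"
    proof -
      have "X \<inter> set P = insert v (X \<inter> set ?C)" using q v LX by auto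
      moreover have "v \<notin> set ?C" using q P(2) by auto
      ultimately show ?thesis by (simp add: nX_def)
    qed
    then have "longest ?C" unfolding longest_def using C P(6) by linarith
    moreover have "v \<notin> set ?C" using q P(2) by auto
    ultimately have "card (N v \<inter> set ?C) \<le> K" using K v LX unfolding nbr_bound_def by blast
    moreover have "N v \<inter> (Y \<inter> set P) \<subseteq> N v \<inter> set ?C" using q by (auto simp: N_def)
    ultimately show ?thesis using card_mono[of "N v \<inter> set ?C" "N v \<inter> (Y \<inter> set P)"] by auto
  qed
  have finL: "finite L" by (simp add: L_def)
  have cardL: "card L = length (crossers s t P)"
    using distinct_crossers[OF P(2)] by (simp add: L_def distinct_card)
  have cardQ: "card Q = length (crossers s t P) + 2"
    using stL P(5) finL cardL by (simp add: Q_def)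
  have "card (Y \<inter> set P) + (\<Sum>q\<in>Q. card (N q)) \<le> card Y + (\<Sum>q\<in>Q. card (N q \<inter> (Y \<inter> set P)))"
    by (rule union_count) (use QX N_subset_Y common finL in \<open>auto simp: Q_def\<close>)
  moreover have "card Q * \<delta> \<le> (\<Sum>q\<in>Q. card (N q))"
    using sum_bounded_below[of Q \<delta> "\<lambda>q. card (N q)"] QX min_deg by auto
  moreover have "(\<Sum>q\<in>Q. card (N q \<inter> (Y \<inter> set P)))
      = card (N s \<inter> (Y \<inter> set P)) + card (N t \<inter> (Y \<inter> set P)) + (\<Sum>q\<in>L. card (N q \<inter> (Y \<inter> set P)))"
    using stL P(5) finL by (simp add: Q_def)
  moreover have "(\<Sum>q\<in>L. card (N q \<inter> (Y \<inter> set P))) \<le> card L * K"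
    using sum_bounded_above[of L "\<lambda>q. card (N q \<inter> (Y \<inter> set P))" K] vK by simp
  moreover have "card (N s \<inter> (Y \<inter> set P)) + card (N t \<inter> (Y \<inter> set P)) \<le> nY P + 1 + length (crossers s t P)"
  proof -
    have "N v \<inter> (Y \<inter> set P) = N v \<inter> set P" if "v \<in> X" for v using N_subset_Y that by blast
    then show ?thesis using deg_sum_crossers[OF P(3,4) _ P(2) PXY] P by (simp add: walk_def)
  qed
  moreover have "nY P = c" using nX_path[OF P(1,2,3,4)] P(6) by simp
  moreover have "card (Y \<inter> set P) = nY P" by (simp add: nY_def)
  \<comment> \<open>On \<open>P\<close>, which has \<open>c\<close> vertices of \<open>Y\<close>,
    the ends \<open>s\<close> and \<open>t\<close> together have at most \<open>c + 1\<close>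
    neighbours plus one per crosser, and each crosser has at most \<open>K\<close>.\<close>
  ultimately have "c + (length (crossers s t P) + 2) * \<delta> + 10
     \<le> 4 * \<delta> + (c + 1 + length (crossers s t P) + length (crossers s t P) * K)"
    using card_Y unfolding cardQ cardL by linarith
  then show ?thesis by (simp add: algebra_simps)
qed

end

text \<open>Double counting over ordered pairs: each value occurs \<open>2 * (card S - 1)\<close>
  times.\<close>

lemma pair_sum_bound:
  fixes f :: "'b \<Rightarrow> nat"
  assumes "finite S" "2 \<le> card S" and "\<And>s t. s \<in> S \<Longrightarrow> t \<in> S \<Longrightarrow> s \<noteq> t \<Longrightarrow> f s + f t \<le> B"
  shows "2 * sum f S \<le> card S * B"
proof -
  let ?n = "card S"
  have "(\<Sum>t\<in>S - {s}. f s + f t) \<le> (?n - 1) * B" if "s \<in> S" for s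
    using sum_bounded_above[of "S - {s}" "\<lambda>t. f s + f t" B] assms that by auto
  then have "(\<Sum>s\<in>S. \<Sum>t\<in>S - {s}. f s + f t) \<le> ?n * ((?n - 1) * B)"
    using sum_bounded_above[of S "\<lambda>s. \<Sum>t\<in>S - {s}. f s + f t" "(?n - 1) * B"] by simp
  moreover have "(\<Sum>s\<in>S. \<Sum>t\<in>S - {s}. f s + f t) = (?n - 1) * (2 * sum f S)"
  proof -
    have "(\<Sum>t\<in>S - {s}. f s + f t) + 2 * f s = ?n * f s + sum f S" if "s \<in> S" for s
    proof -
      have "sum f S = f s + sum f (S - {s})" using assms(1) that by (simp add: sum.remove)
      moreover have "?n * f s = f s + (?n - 1) * f s" using assms(2) by (cases ?n) auto
      ultimately show ?thesis using assms(1) that by (simp add: sum.distrib)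
    qed
    then have "(\<Sum>s\<in>S. (\<Sum>t\<in>S - {s}. f s + f t) + 2 * f s) = (\<Sum>s\<in>S. ?n * f s + sum f S)"
      by (rule sum.cong[OF refl])
    then have "(\<Sum>s\<in>S. \<Sum>t\<in>S - {s}. f s + f t) + 2 * sum f S = ?n * sum f S + ?n * sum f S"
      by (simp add: sum.distrib sum_distrib_left)
    moreover have "?n * sum f S = sum f S + (?n - 1) * sum f S" using assms(2) by (cases ?n) auto
    ultimately show ?thesis by simp
  qed
  ultimately have "(?n - 1) * (2 * sum f S) \<le> (?n - 1) * (?n * B)" by (simp add: mult.left_commute)
  then show ?thesis using assms(2) by simp
qed

context no_spanning_cycle begin

section \<open>Longest cycles and detours from an outside vertex\<close>

lemma longestD: "longest C \<Longrightarrow> cyc C" "longest C \<Longrightarrow> nX C = c" "longest C \<Longrightarrow> distinct C"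
  "longest C \<Longrightarrow> set C \<subseteq> X \<union> Y" "longest C \<Longrightarrow> length C = 2 * c" "longest C \<Longrightarrow> card (Y \<inter> set C) = c"
  unfolding longest_def
  using cyc_verts[of C] cyc_length[of C] cyc_nX_nY[of C] by (auto simp: nY_def) (simp add: cyc_def)

lemma longest_rotate: "longest (xs @ ys) \<Longrightarrow> longest (ys @ xs)"
  using cyc_rotate[of xs ys] by (simp add: longest_def nX_def Un_commute)

lemma longest_start:
  assumes "longest C" "v \<in> set C"
  obtains r where "longest (v # r)" "set (v # r) = set C"
proof -
  obtain p q where "C = p @ v # q" using assms(2) split_list by metis
  then have "longest (v # q @ p)" "set (v # q @ p) = set C"
    using assms(1) longest_rotate[of p "v # q"] by auto
  then show ?thesis using that[of "q @ p"] by simp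
qed

lemma longest_Cons_walk:
  assumes "longest (e # r)"
  shows "r \<noteq> []" "walk (hd r) r (last r)" "E e (hd r)" "E (last r) e"
proof -
  obtain a b where *: "walk a (e # r) b" "E b a" "3 \<le> length (e # r)"
    using longestD(1)[OF assms] by (auto simp: cyc_def)
  then show r: "r \<noteq> []" by auto
  have "walk a ([e] @ r) b" using * by simp
  then have "walk a [e] e" "walk (hd r) r b" "E e (hd r)" using walk_append_iff[of "[e]" r a b] r by auto
  then show "walk (hd r) r (last r)" "E e (hd r)" "E (last r) e" using *(2) by (auto simp: walk_def)
qed

text \<open>Otherwise \<open>M\<close> could be inserted between \<open>e\<close> and its neighbour
  on the cycle, and \<open>M\<close> contains \<open>x\<close>, so the new cycle would have more
  than \<open>c\<close> vertices of \<open>X\<close>.\<close>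

lemma detour_end:
  assumes C: "longest (e # r)" and M: "walk x M h" "distinct M" "set M \<inter> set (e # r) = {}"
    and h: "E h e" and x: "x \<in> X"
  shows "\<not> E x (hd r)" "\<not> E x (last r)"
proof -
  note w = longest_Cons_walk[OF C]
  have nM: "0 < nX M" using walk_ends(1)[OF M(1)] x by (auto simp: nX_def card_gt_0_iff)
  have d: "distinct (r @ [e] @ rev M)" "distinct ((e # r) @ M)" using longestD(3)[OF C] M by auto
  have l: "3 \<le> length (e # r)" using longestD(1)[OF C] by (simp add: cyc_def)
  have n: "nX (r @ [e] @ rev M) = c + nX M" "nX ((e # r) @ M) = c + nX M"
  proof -
    show "nX ((e # r) @ M) = c + nX M" using nX_append[OF d(2)] longestD(2)[OF C] by simp
    have "set (r @ [e] @ rev M) = set ((e # r) @ M)" by auto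
    then show "nX (r @ [e] @ rev M) = c + nX M" using \<open>nX ((e # r) @ M) = c + nX M\<close> by (simp only: nX_def)
  qed
  show "\<not> E x (hd r)"
  proof
    assume a: "E x (hd r)"
    have "walk (hd r) (r @ [e] @ rev M) x"
      by (rule walk_append[OF w(2) walk_append[OF _ walk_rev[OF M(1)]]]) (use w h E_sym in auto)
    then have "cyc (r @ [e] @ rev M)" using a d l by (intro cycI) auto
    then show False using cyc_max n nM by fastforce
  qed
  show "\<not> E x (last r)"
  proof
    assume a: "E x (last r)"
    have "walk e (e # r) (last r)" using walk_append[of e "[e]" e "hd r" r "last r"] w by simp
    then have "walk e ((e # r) @ M) h" using walk_append M(1) a E_sym by blast
    then have "cyc ((e # r) @ M)" using h d l by (intro cycI) auto
    then show False using cyc_max n nM by fastforce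
  qed
qed

text \<open>Inserting \<open>M\<close> now bypasses \<open>u\<close>, which costs at most one vertex
  of \<open>X\<close>, but \<open>M\<close> contains both \<open>x\<close> and \<open>h\<close>.
  This serves for \<open>e \<in> Y\<close>, where the nearest other \<open>Y\<close>-vertices of the
  cycle are two steps away.\<close>

lemma detour_end2:
  assumes C: "longest (e # r)" and M: "walk x M h" "distinct M" "set M \<inter> set (e # r) = {}"
    and h: "E h e" "h \<in> X" "h \<noteq> x" and x: "x \<in> X"
  shows "r = u # v # q \<Longrightarrow> \<not> E x v" "r = q @ [v, u] \<Longrightarrow> \<not> E x v"
proof -
  note w = longest_Cons_walk[OF C]
  have nM: "2 \<le> nX M"
  proof -
    have "{x, h} \<subseteq> X \<inter> set M" using walk_ends[OF M(1)] x h by auto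
    then have "card {x, h} \<le> nX M" unfolding nX_def by (rule card_mono[rotated]) simp
    then show ?thesis using h by simp
  qed
  have c: "nX (e # r) = c" using longestD(2)[OF C] .
  have dC: "distinct (e # r)" using longestD(3)[OF C] .
  have m: "3 \<le> length M + length (e # r) - 1"
  proof -
    have "nX M \<le> length M"
      using card_mono[of "set M" "X \<inter> set M"] card_length[of M] unfolding nX_def by simp
    then have "2 \<le> length M" using nM by simp
    moreover have "3 \<le> length (e # r)" using longestD(1)[OF C] by (simp add: cyc_def)
    ultimately show ?thesis by simp
  qed
  show "\<not> E x v" if r: "r = u # v # q"
  proof
    assume a: "E x v"
    have "walk v (v # q) (last r)" using w(2) r walk_Cons[of "hd r" u v q "last r"] by simp
    moreover have "walk e ([e] @ rev M) x" using walk_append[OF _ walk_rev[OF M(1)], of e "[e]" e] h E_sym by simp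
    ultimately have "walk v ((v # q) @ [e] @ rev M) x" using walk_append w(4) by blast
    then have cy: "cyc ((v # q) @ [e] @ rev M)" using a M dC r m by (intro cycI) auto
    have "X \<inter> set (e # r) \<union> X \<inter> set M \<subseteq> insert u (X \<inter> set ((v # q) @ [e] @ rev M))" using r by auto
    then have "card (X \<inter> set (e # r) \<union> X \<inter> set M) \<le> card (insert u (X \<inter> set ((v # q) @ [e] @ rev M)))"
      by (rule card_mono[rotated]) simp
    also have "\<dots> \<le> Suc (nX ((v # q) @ [e] @ rev M))" unfolding nX_def by (simp add: card_insert_if)
    finally have "card (X \<inter> set (e # r) \<union> X \<inter> set M) \<le> Suc (nX ((v # q) @ [e] @ rev M))" .
    moreover have "card (X \<inter> set (e # r) \<union> X \<inter> set M) = c + nX M"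
      using c M(3) unfolding nX_def by (subst card_Un_disjoint) auto
    ultimately show False using cyc_max[OF cy] nM by simp
  qed
  show "\<not> E x v" if r: "r = q @ [v, u]"
  proof
    assume a: "E x v"
    have "walk e ([e] @ r) (last r)" using walk_append[OF _ w(2), of e "[e]" e] w(3) by simp
    then have "walk e ((e # q @ [v]) @ [u]) (last r)" using r by simp
    then have "walk e (e # q @ [v]) v" using walk_append_iff[of "e # q @ [v]" "[u]" e] by simp
    then have "walk e ((e # q @ [v]) @ M) h" using walk_append M(1) a E_sym by blast
    then have cy: "cyc ((e # q @ [v]) @ M)" using h M dC r m by (intro cycI) auto
    have "X \<inter> set (e # r) \<union> X \<inter> set M \<subseteq> insert u (X \<inter> set ((e # q @ [v]) @ M))" using r by auto
    then have "card (X \<inter> set (e # r) \<union> X \<inter> set M) \<le> card (insert u (X \<inter> set ((e # q @ [v]) @ M)))"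
      by (rule card_mono[rotated]) simp
    also have "\<dots> \<le> Suc (nX ((e # q @ [v]) @ M))" unfolding nX_def by (simp add: card_insert_if)
    finally have "card (X \<inter> set (e # r) \<union> X \<inter> set M) \<le> Suc (nX ((e # q @ [v]) @ M))" .
    moreover have "card (X \<inter> set (e # r) \<union> X \<inter> set M) = c + nX M"
      using c M(3) unfolding nX_def by (subst card_Un_disjoint) auto
    ultimately show False using cyc_max[OF cy] nM by simp
  qed
qed

text \<open>A path that avoids \<open>S\<close> is cut at its first vertex on
  \<open>C\<close>.\<close>

lemma reach_cycle:
  assumes "z \<in> X \<union> Y" "z \<notin> set C" "finite S" "card S < 3" "z \<notin> S" "v \<in> set C" "v \<notin> S" "set C \<subseteq> X \<union> Y"
  obtains M h e where "walk z M h" "distinct M" "set M \<inter> set C = {}" "set M \<inter> S = {}"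
    "E h e" "e \<in> set C" "e \<notin> S"
proof -
  obtain p0 where "walk z p0 v" "set p0 \<inter> S = {}" using conn[of S z v] assms by blast
  then obtain p where p: "walk z p v" "set p \<inter> S = {}" "distinct p" using walk_distinct by blast
  have "\<exists>e\<in>set p. e \<in> set C" using walk_ends(2)[OF p(1)] assms(6) by blast
  then obtain M e r where q: "p = M @ e # r" "e \<in> set C" "\<forall>m\<in>set M. m \<notin> set C"
    using split_list_first_prop[of p "\<lambda>e. e \<in> set C"] by blast
  have "M \<noteq> []" using q p(1) assms(2) by (auto simp: walk_def)
  then have "walk z M (last M)" "E (last M) e" using p(1) q(1) walk_append_iff[of M "e # r" z v] by auto
  then show ?thesis using that[of M "last M" e] q p by auto
qed

lemma non_nbrs_bound:
  assumes "longest C" "D \<subseteq> Y \<inter> set C" "D \<inter> N x = {}" "x \<in> X"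
  shows "card (N x \<inter> set C) + card D \<le> c"
proof -
  have "card ((N x \<inter> set C) \<union> D) = card (N x \<inter> set C) + card D"
    by (rule card_Un_disjoint) (use assms(2,3) finite_subset[OF assms(2)] in auto)
  moreover have "(N x \<inter> set C) \<union> D \<subseteq> Y \<inter> set C" using assms N_subset_Y by blast
  then have "card ((N x \<inter> set C) \<union> D) \<le> card (Y \<inter> set C)" by (rule card_mono[rotated]) simp
  ultimately show ?thesis using longestD(6)[OF assms(1)] by simp
qed

text \<open>As \<open>c < \<delta>\<close>, the vertex \<open>x\<close> has a neighbour off
  \<open>C\<close>, and detours through it to \<open>C\<close> exhibit \<open>Y\<close>-vertices of
  \<open>C\<close> that are not adjacent to \<open>x\<close>. Two of them suffice if a second vertex
  of \<open>X\<close> is off \<open>C\<close>, since then \<open>c + 2 \<le> \<delta>\<close>;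
  otherwise three are found. The assumption \<open>k\<close> makes the cycle long enough for them to
  be distinct.\<close>

lemma few_nbrs:
  assumes C: "longest C" and x: "x \<in> X" "x \<notin> set C" and k: "4 \<le> card (N x \<inter> set C)"
  shows "card (N x \<inter> set C) + 4 \<le> \<delta>"
proof -
  have "card (N x \<inter> set C) \<le> c" using non_nbrs_bound[OF C, of "{}" x] x by simp
  then have c4: "4 \<le> c" using k by simp
  have len: "8 \<le> length C" using longestD(5)[OF C] c4 by simp
  have cd: "c < \<delta>" using c_less card_X by simp
  have "\<exists>z. z \<in> N x \<and> z \<notin> set C"
  proof (rule ccontr)
    assume "\<not> ?thesis"
    then have "N x \<inter> set C = N x" by blast
    then show False using min_deg[OF x(1)] \<open>card (N x \<inter> set C) \<le> c\<close> cd by simp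
  qed
  then obtain z where z: "E x z" "z \<notin> set C" by (auto simp: N_def)
  have zY: "z \<in> Y" using z E_X x by blast
  \<comment> \<open>Starting from the outside neighbour \<open>z\<close> of \<open>x\<close> ensures
    \<open>h \<noteq> x\<close>. The set \<open>S\<close> is kept free so that a second detour can
    be forced to end elsewhere.\<close>
  have M_ex: "\<exists>M h e. walk x M h \<and> distinct M \<and> set M \<inter> set C = {} \<and> set (tl M) \<inter> {x} = {} \<and> tl M \<noteq> [] \<and>
      E h e \<and> e \<in> set C \<and> e \<notin> S \<and> h \<noteq> x" if S: "finite S" "card S < 3" "x \<in> S" "S \<subseteq> insert x (set C)" for S
  proof -
    have "\<not> set C \<subseteq> S"
    proof
      assume "set C \<subseteq> S"
      then have "card (set C) \<le> card S" using card_mono S by blast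
      then show False using S len distinct_card[OF longestD(3)[OF C]] by simp
    qed
    then obtain v where v: "v \<in> set C" "v \<notin> S" by blast
    have "z \<notin> S" using z S X_not_Y zY x by blast
    obtain M h e where M: "walk z M h" "distinct M" "set M \<inter> set C = {}" "set M \<inter> S = {}"
      "E h e" "e \<in> set C" "e \<notin> S"
      by (rule reach_cycle[of z C S v]) (use zY z S v longestD(4)[OF C] \<open>z \<notin> S\<close> in auto)
    have "walk x (x # M) h" using walk_append[of x "[x]" x z M h] M(1) z by simp
    moreover have "M \<noteq> []" "h \<noteq> x" using M walk_ends(2)[OF M(1)] S by (auto simp: walk_def)
    ultimately show ?thesis using M S x by (intro exI[of _ "x # M"] exI[of _ h] exI[of _ e]) auto
  qed
  obtain M h e where M: "walk x M h" "distinct M" "set M \<inter> set C = {}" and h: "E h e" "h \<noteq> x"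
    and e: "e \<in> set C" using M_ex[of "{x}"] by auto
  obtain r where r: "longest (e # r)" "set (e # r) = set C" using longest_start[OF C e] .
  have Mr: "set M \<inter> set (e # r) = {}" using M(3) r(2) by simp
  note w = longest_Cons_walk[OF r(1)]
  have lr: "8 \<le> length (e # r)" using len longestD(5)[OF C] longestD(5)[OF r(1)] by simp
  have hC: "h \<notin> set C" using walk_ends(2)[OF M(1)] M(3) by blast
  have two: "card (N x \<inter> set C) + 2 \<le> c"
  proof (cases "e \<in> X")
    case True
    let ?D = "{hd r, last r}"
    have "hd r \<noteq> last r" using lr longestD(3)[OF r(1)]
      by (cases r rule: rev_cases; cases "butlast r") auto
    moreover have "?D \<subseteq> Y \<inter> set C" using w r True E_X by auto
    moreover have "?D \<inter> N x = {}" using detour_end[OF r(1) M(1,2) Mr h(1) x(1)] by (auto simp: N_def)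
    ultimately show ?thesis using non_nbrs_bound[OF C, of ?D x] x by simp
  next
    case False
    then have eY: "e \<in> Y" using e longestD(4)[OF C] by blast
    \<comment> \<open>For \<open>e \<in> Y\<close> the detour ends in a second vertex
      \<open>h\<close> of \<open>X\<close>, which is what \<open>detour_end2\<close> needs.\<close>
    have hX: "h \<in> X" using h eY E_Y by blast
    obtain u v q where q: "r = u # v # q" using lr by (cases r; cases "tl r") auto
    obtain u' v' q' where q': "r = q' @ [v', u']"
    proof -
      obtain r1 u' where "r = r1 @ [u']" using w(1) by (cases r rule: rev_cases) auto
      moreover then have "r1 \<noteq> []" using lr by auto
      then obtain r2 v' where "r1 = r2 @ [v']" by (cases r1 rule: rev_cases) auto
      ultimately show ?thesis using that by simp
    qed
    have "v \<in> Y"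
    proof -
      have "E e u" "E u v" using w q by (auto simp: walk_def)
      then show ?thesis using eY E_Y E_X by blast
    qed
    moreover have "v' \<in> Y"
    proof -
      have "walk (hd r) ((q' @ [v']) @ [u']) (last r)" using w q' by simp
      then have "E (last (q' @ [v'])) (hd [u'])" using walk_append_iff[of "q' @ [v']" "[u']" "hd r" "last r"] by blast
      then have "E v' u'" by simp
      moreover have "E u' e" using w(4) q' by simp
      ultimately show ?thesis using eY E_Y E_X by blast
    qed
    moreover have "v \<noteq> v'"
    proof
      assume vv: "v = v'"
      have "distinct r" using longestD(3)[OF r(1)] by simp
      have "r = [u] @ v # q" "r = q' @ v # [u']" using q q' vv by simp_all
      then have "[u] @ v # q = q' @ v # [u']" by simp
      moreover have "v \<notin> set [u]" "v \<notin> set q" using \<open>distinct r\<close> q by auto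
      ultimately have "q = [u']" using append_Cons_eq_iff[of v "[u]" q q' "[u']"] by blast
      then show False using lr q by simp
    qed
    moreover have "{v, v'} \<inter> N x = {}"
      using detour_end2(1)[OF r(1) M(1,2) Mr h(1) hX h(2) x(1) q]
        detour_end2(2)[OF r(1) M(1,2) Mr h(1) hX h(2) x(1) q'] by (auto simp: N_def)
    moreover have "{v, v'} \<subseteq> set C" using q q' r(2) by (metis Un_insert_right insert_subset list.set(2) set_append subset_insertI bot.extremum insertCI in_set_conv_decomp)
    ultimately show ?thesis using non_nbrs_bound[OF C, of "{v, v'}" x] x by simp
  qed
  show ?thesis
  proof (cases "X \<subseteq> insert x (set C)")
    case False
    then obtain x' where x': "x' \<in> X" "x' \<noteq> x" "x' \<notin> set C" by blast
    have "card (insert x (insert x' (X \<inter> set C))) \<le> card X" by (rule card_mono) (use x x' fin_X in auto)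
    then have "c + 2 \<le> card X" using x x' longestD(2)[OF C] by (simp add: nX_def)
    then show ?thesis using two card_X by simp
  next
    case True
    \<comment> \<open>All of \<open>X\<close> except \<open>x\<close> lies on \<open>C\<close>, so
      the end \<open>h\<close> of the detour is in \<open>Y\<close>.\<close>
    have eX: "e \<in> X"
    proof (rule ccontr)
      assume "e \<notin> X"
      then have "e \<in> Y" using e longestD(4)[OF C] by blast
      then have "h \<in> X" using h E_Y by blast
      then show False using True h hC by blast
    qed
    obtain M2 h2 e2 where M2: "walk x M2 h2" "distinct M2" "set M2 \<inter> set C = {}" and h2: "E h2 e2" "h2 \<noteq> x"
      and e2: "e2 \<in> set C" "e2 \<notin> {x, e}"
    proof -
      have "card {x, e} < 3" using card_length[of "[x, e]"] by simp
      then show ?thesis using M_ex[of "{x, e}"] e that by auto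
    qed
    have h2C: "h2 \<notin> set C" using walk_ends(2)[OF M2(1)] M2(3) by blast
    have e2X: "e2 \<in> X"
    proof (rule ccontr)
      assume "e2 \<notin> X"
      then have "e2 \<in> Y" using e2 longestD(4)[OF C] by blast
      then have "h2 \<in> X" using h2 E_Y by blast
      then show False using True h2 h2C by blast
    qed
    have "e2 \<in> set r" using e2 r by auto
    then obtain A B where AB: "r = A @ e2 # B" using split_list by fastforce
    have r2: "longest (e2 # B @ e # A)" using longest_rotate[of "e # A" "e2 # B"] r(1) AB by simp
    have s2: "set (e2 # B @ e # A) = set C" using r(2) AB by auto
    note w2 = longest_Cons_walk[OF r2]
    have ne: "A \<noteq> []" "B \<noteq> []"
    proof -
      show "A \<noteq> []"
      proof
        assume "A = []"
        then have "E e e2" using w(3) AB by simp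
        then show False using eX e2X E_X X_not_Y by blast
      qed
      show "B \<noteq> []"
      proof
        assume "B = []"
        then have "E e2 e" using w2(3) by simp
        then show False using eX e2X E_X X_not_Y by blast
      qed
    qed
    have n1: "hd A \<notin> N x" "last B \<notin> N x"
      using detour_end[OF r(1) M(1,2) Mr h(1) x(1)] AB ne by (auto simp: N_def)
    have n2: "hd B \<notin> N x" "last A \<notin> N x"
      using detour_end[OF r2 M2(1,2) _ h2(1) x(1)] M2(3) s2 ne by (auto simp: N_def)
    have y: "hd A \<in> Y" "last B \<in> Y" using w(3,4) AB ne E_X[OF eX] by auto
    have y2: "hd B \<in> Y" "last A \<in> Y" using w2(3,4) ne E_X[OF e2X] by auto
    have dAB: "distinct (A @ e2 # B)" using longestD(3)[OF r(1)] AB by simp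
    have inC: "set A \<subseteq> set C" "set B \<subseteq> set C" using r(2) AB by auto
    have hl: "hd A \<in> set A" "last A \<in> set A" "hd B \<in> set B" "last B \<in> set B" "set A \<inter> set B = {}"
      using ne dAB by auto
    \<comment> \<open>The cycle has at least eight vertices, so one of the arcs \<open>A\<close> and
      \<open>B\<close> has two different ends; an end of the other arc is the third vertex.\<close>
    have "\<exists>D. D \<subseteq> Y \<inter> set C \<and> D \<inter> N x = {} \<and> card D = 3"
    proof (cases "length A \<ge> 2")
      case True
      then have "hd A \<noteq> last A" using dAB by (cases A) auto
      moreover have "hd B \<noteq> hd A" "hd B \<noteq> last A" using hl by (metis disjoint_iff)+
      ultimately show ?thesis
        using n1 n2 y y2 inC ne by (intro exI[of _ "{hd A, last A, hd B}"]) auto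
    next
      case False
      then have "length B \<ge> 2" using lr AB by simp
      then have "hd B \<noteq> last B" using dAB by (cases B) auto
      moreover have "hd A \<noteq> hd B" "hd A \<noteq> last B" using hl by (metis disjoint_iff)+
      ultimately show ?thesis
        using n1 n2 y y2 inC ne by (intro exI[of _ "{hd B, last B, hd A}"]) auto
    qed
    then obtain D where "D \<subseteq> Y \<inter> set C" "D \<inter> N x = {}" "card D = 3" by blast
    then show ?thesis using non_nbrs_bound[OF C, of D x] x cd by simp
  qed
qed

end

text \<open>The appended \<open>C\<close> closes the list up: the first vertex follows the
  last.\<close>

definition cnext :: "'a list \<Rightarrow> 'a \<Rightarrow> 'a" where
  "cnext C y = hd (tl (dropWhile (\<lambda>v. v \<noteq> y) C) @ C)"

lemma cnext_eq: "distinct (p @ y # q) \<Longrightarrow> q @ p \<noteq> [] \<Longrightarrow> cnext (p @ y # q) y = hd (q @ p)"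
proof -
  assume "distinct (p @ y # q)" "q @ p \<noteq> []"
  then have "dropWhile (\<lambda>v. v \<noteq> y) (p @ y # q) = y # q"
    by (subst dropWhile_append2) auto
  then show ?thesis using \<open>q @ p \<noteq> []\<close> by (cases q; cases p) (auto simp: cnext_def)
qed

context no_spanning_cycle begin

section \<open>At most three neighbours on a longest cycle\<close>

lemma longest_single:
  assumes C: "longest C" and y: "y \<in> set C"
  obtains r where "longest (y # r)" "set (y # r) = set C" "cnext C y = hd r"
proof -
  obtain p q where q: "C = p @ y # q" using y split_list by metis
  have l: "longest (y # q @ p)" using C q longest_rotate[of p "y # q"] by simp
  have "q @ p \<noteq> []" using longest_Cons_walk(1)[OF l] .
  then have "cnext C y = hd (q @ p)" using cnext_eq[of p y q] longestD(3)[OF C] q by blast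
  then show ?thesis using that[of "q @ p"] l q by auto
qed

lemma longest_pair:
  assumes C: "longest C" and y: "y \<in> set C" "y' \<in> set C" "y \<noteq> y'" "\<not> E y y'"
  obtains A B where "longest (y # A @ y' # B)" "set (y # A @ y' # B) = set C"
    "A \<noteq> []" "B \<noteq> []" "cnext C y = hd A" "cnext C y' = hd B"
proof -
  obtain p q where q: "C = p @ y # q" using y split_list by metis
  note d = longestD(3)[OF C]
  have y': "y' \<in> set q \<or> y' \<in> set p" using y q by auto
  then have qp: "q @ p \<noteq> []" by auto
  have n1: "cnext C y = hd (q @ p)" using cnext_eq[of p y q] d q qp by blast
  have l: "longest (y # q @ p)" using C q longest_rotate[of p "y # q"] by simp
  have "\<exists>A B. q @ p = A @ y' # B \<and> cnext C y' = hd (B @ [y])"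
    using y'
  proof
    assume "y' \<in> set q"
    then obtain A q2 where A: "q = A @ y' # q2" using split_list by metis
    have "cnext C y' = hd (q2 @ (p @ y # A))" using cnext_eq[of "p @ y # A" y' q2] d q A by simp
    also have "\<dots> = hd ((q2 @ p) @ [y])" by (cases q2; cases p) auto
    finally show ?thesis using A by (intro exI[of _ A] exI[of _ "q2 @ p"]) simp
  next
    assume "y' \<in> set p"
    then obtain p1 p2 where A: "p = p1 @ y' # p2" using split_list by metis
    have "cnext C y' = hd ((p2 @ y # q) @ p1)" using cnext_eq[of p1 y' "p2 @ y # q"] d q A by simp
    also have "\<dots> = hd (p2 @ [y])" by (cases p2) auto
    finally show ?thesis using A by (intro exI[of _ "q @ p1"] exI[of _ p2]) simp
  qed
  then obtain A B where AB: "q @ p = A @ y' # B" "cnext C y' = hd (B @ [y])" by blast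
  have l2: "longest (y # A @ y' # B)" using l AB by simp
  then have l3: "longest (y' # B @ y # A)" using longest_rotate[of "y # A" "y' # B"] by simp
  have A: "A \<noteq> []" using longest_Cons_walk(3)[OF l2] y(4) by (cases A) auto
  have B: "B \<noteq> []" using longest_Cons_walk(3)[OF l3] y(4) E_commute[of y y'] by (cases B) auto
  have "set (y # A @ y' # B) = set C" using q AB by (metis Un_commute insert_is_Un list.set(2) set_append sup_left_commute)
  then show ?thesis using that[of A B] l2 A B n1 AB by simp
qed

lemma longest_pair_walks:
  assumes l: "longest (y # A @ y' # B)" and "A \<noteq> []" "B \<noteq> []"
  shows "walk (hd A) A (last A)" "walk (hd B) B (last B)" "E y (hd A)" "E (last A) y'" "E y' (hd B)" "E (last B) y"
proof -
  note w = longest_Cons_walk[OF l]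
  have 1: "walk (hd A) (A @ y' # B) (last B)" using w(2) assms by simp
  then have 2: "walk (hd A) A (last A)" "walk y' ([y'] @ B) (last B)" "E (last A) y'"
    using walk_append_iff[of A "y' # B" "hd A" "last B"] assms by auto
  then show "walk (hd A) A (last A)" "E (last A) y'" by auto
  show "walk (hd B) B (last B)" "E y' (hd B)" using walk_append_iff[of "[y']" B y' "last B"] 2 assms by auto
  show "E y (hd A)" "E (last B) y" using w(3,4) assms by auto
qed

text \<open>
  Take \<open>x\<close> off a longest cycle \<open>C\<close> with the largest possible number \<open>K\<close> of neighbours on \<open>C\<close>, and count the
  neighbours of \<open>x\<close> and of the \<open>K\<close> vertices that follow these neighbours on \<open>C\<close>.  The paths joining
  the latter through \<open>x\<close> have few crossers, since a crosser, too, has at most \<open>K\<close> neighbours on the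
  longest cycle that misses it.
\<close>

lemma max_nbrs_le_3: "nbr_bound 3"
proof (rule ccontr)
  assume neg: "\<not> nbr_bound 3"
  let ?P = "\<lambda>(C, x). longest C \<and> x \<in> X \<and> x \<notin> set C"
  let ?f = "\<lambda>(C, x). card (N x \<inter> set C)"
  obtain C0 x0 where "longest C0" "x0 \<in> X" "x0 \<notin> set C0" and big: "\<not> card (N x0 \<inter> set C0) \<le> 3"
    using neg unfolding nbr_bound_def by blast
  then have P0: "?P (C0, x0)" by simp
  have bY: "\<forall>z. ?P z \<longrightarrow> ?f z < Suc (card Y)"
  proof (intro allI impI)
    fix z assume "?P z"
    then obtain C x where z: "z = (C, x)" "x \<in> X" by (cases z) auto
    have "card (N x \<inter> set C) \<le> card Y" by (rule card_mono) (use fin_Y N_subset_Y z in auto)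
    then show "?f z < Suc (card Y)" using z by simp
  qed
  obtain z where z: "?P z" "\<forall>w. ?P w \<longrightarrow> ?f w \<le> ?f z"
    using ex_has_greatest_nat[OF P0 bY] by (elim exE conjE)
  obtain C x where zCx: "z = (C, x)" by (cases z)
  define K where "K = card (N x \<inter> set C)"
  have C: "longest C" and x: "x \<in> X" "x \<notin> set C" using z(1) zCx by auto
  have bK: "nbr_bound K" unfolding nbr_bound_def
  proof (intro allI impI)
    fix C' x' assume "longest C'" "x' \<in> X" "x' \<notin> set C'"
    then have "?P (C', x')" by simp
    then have "?f (C', x') \<le> ?f z" using z(2) by blast
    then show "card (N x' \<inter> set C') \<le> K" using zCx by (simp add: K_def)
  qed
  have K4: "4 \<le> K"
  proof -
    have "?f (C0, x0) \<le> ?f z" using z(2) P0 by blast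
    then show ?thesis using big zCx by (simp add: K_def)
  qed
  then have Kd: "K + 4 \<le> \<delta>" using few_nbrs[OF C x] by (simp add: K_def)
  \<comment> \<open>For \<open>l\<close> crossers, \<open>few_crossings\<close> says
    \<open>l * D + 9 \<le> 2 * \<delta>\<close>; thus \<open>l0\<close> below is the largest number
    of crossers it allows.\<close>
  define D where "D = \<delta> - K - 1"
  have D3: "3 \<le> D" and dK: "\<delta> = K + D + 1" using Kd by (auto simp: D_def)
  define l0 where "l0 = (2 * \<delta> - 9) div D"
  have l0: "l0 * D + 9 \<le> 2 * \<delta>"
  proof -
    have "l0 * D \<le> 2 * \<delta> - 9" unfolding l0_def by simp
    then show ?thesis using Kd K4 by simp
  qed
  have few: "length (crossers s t P) \<le> l0"
    if "walk s P t" "distinct P" "s \<in> X" "t \<in> X" "s \<noteq> t" "nX P = c + 1" for s P t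
  proof -
    let ?l = "length (crossers s t P)"
    have "?l * \<delta> + 9 \<le> 2 * \<delta> + ?l * (K + 1)" using few_crossings[OF bK that] .
    then have "?l * D + 9 \<le> 2 * \<delta>" unfolding dK by (simp add: algebra_simps)
    then have "?l * D \<le> 2 * \<delta> - 9" by simp
    then show ?thesis unfolding l0_def using D3 by (simp add: less_eq_div_iff_mult_less_eq)
  qed
  define Dx where "Dx = N x \<inter> set C"
  define S where "S = cnext C ` Dx"
  have Dx: "Dx \<subseteq> Y" "Dx \<subseteq> set C" "finite Dx" "card Dx = K"
    using N_subset_Y x by (auto simp: Dx_def K_def)
  have xDx: "E x y" if "y \<in> Dx" for y using that by (simp add: Dx_def N_def)
  \<comment> \<open>The path runs once round the cycle from the successor of \<open>y\<close> to
    \<open>y\<close> and ends in \<open>x\<close>.\<close>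
  have single: "cnext C y \<in> X \<inter> set C \<and> N (cnext C y) \<inter> N x \<subseteq> Y \<inter> set C" if y: "y \<in> Dx" for y
  proof -
    have "y \<in> set C" using y Dx(2) by (rule rev_subsetD)
    obtain r where r: "longest (y # r)" "set (y # r) = set C" "cnext C y = hd r"
      by (rule longest_single[OF C \<open>y \<in> set C\<close>])
    note w = longest_Cons_walk[OF r(1)]
    have "y \<in> Y" using y Dx(1) by (rule rev_subsetD)
    then have hX: "hd r \<in> X" using w(3) E_Y(1) by blast
    have hC: "hd r \<in> set C" using w(1) unfolding r(2)[symmetric] by simp
    have wP: "walk (hd r) (r @ [y, x]) x"
      using walk_append[OF w(2), of y "[y, x]" x] w(4) E_sym[OF xDx[OF y]] by (simp add: walk_Cons)
    moreover have "distinct (r @ [y, x])" using longestD(3)[OF r(1)] x r(2) by auto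
    moreover have nX: "nX (r @ [y, x]) = c + 1"
    proof -
      have "X \<inter> set (r @ [y, x]) = insert x (X \<inter> set (y # r))" using x by auto
      then show ?thesis using longestD(2)[OF r(1)] x r(2) by (simp add: nX_def)
    qed
    ultimately have "N (hd r) \<inter> N x \<subseteq> set (r @ [y, x])"
      by (intro no_common_nbr_off_path) (use hX x hC in auto)
    moreover have "set (r @ [y, x]) = insert x (set C)" unfolding r(2)[symmetric] by auto
    ultimately have "N (hd r) \<inter> N x \<subseteq> insert x (set C)" by (simp only:)
    moreover have "N x \<subseteq> Y" using N_subset_Y x by blast
    moreover have "x \<notin> Y" using x X_not_Y by blast
    ultimately show ?thesis unfolding r(3) using hX hC by blast
  qed
  have pair: "cnext C y \<noteq> cnext C y' \<and> N (cnext C y) \<inter> N (cnext C y') \<subseteq> Y \<inter> set C \<and>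
      card (N (cnext C y) \<inter> (Y \<inter> set C)) + card (N (cnext C y') \<inter> (Y \<inter> set C)) \<le> c + 1 + l0"
    if y: "y \<in> Dx" "y' \<in> Dx" "y \<noteq> y'" for y y'
  proof -
    have yY: "y \<in> Y" "y' \<in> Y" using y Dx by auto
    then have nE: "\<not> E y y'" using E_Y X_not_Y by blast
    obtain A B where l: "longest (y # A @ y' # B)" and sC: "set (y # A @ y' # B) = set C"
      and ne: "A \<noteq> []" "B \<noteq> []" and n: "cnext C y = hd A" "cnext C y' = hd B"
      by (rule longest_pair[OF C _ _ y(3) nE]) (use y Dx in auto)
    note w = longest_pair_walks[OF l ne]
    \<comment> \<open>From the successor of \<open>y\<close> forward to \<open>y'\<close>, through
      \<open>x\<close> to \<open>y\<close>, and backward to the successor of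
      \<open>y'\<close>.\<close>
    let ?P = "A @ [y', x, y] @ rev B"
    have d: "distinct (y # A @ y' # B)" using longestD(3)[OF l] .
    have hX: "hd A \<in> X" "hd B \<in> X" using w(3,5) yY E_Y by blast+
    have "walk y' [y', x, y] y" using xDx[OF y(1)] E_sym[OF xDx[OF y(2)]] by (simp add: walk_Cons)
    then have wP: "walk (hd A) ?P (hd B)"
      using walk_append[OF w(1) walk_append[OF _ walk_rev[OF w(2)]]] w(4,6) E_sym by blast
    have dP: "distinct ?P" using d x sC by auto
    have sP: "set ?P = insert x (set C)" unfolding sC[symmetric] by auto
    have nP: "nX ?P = c + 1"
    proof -
      have "X \<inter> set ?P = insert x (X \<inter> set C)" using x unfolding sP by auto
      then show ?thesis using longestD(2)[OF C] x by (simp add: nX_def)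
    qed
    have "hd A \<in> set A" "hd B \<in> set B" "set A \<inter> set B = {}" using ne d by auto
    then have neq: "hd A \<noteq> hd B" by (metis disjoint_iff)
    have common: "N (hd A) \<inter> N (hd B) \<subseteq> set ?P" using no_common_nbr_off_path[OF wP dP hX neq] nP by simp
    have Yx: "Y \<inter> insert x (set C) = Y \<inter> set C" using x X_not_Y by auto
    have com2: "N (hd A) \<inter> N (hd B) \<subseteq> Y \<inter> set C"
      using common N_subset_Y[OF hX(1)] sP Yx by blast
    have "card (N (hd A) \<inter> set ?P) + card (N (hd B) \<inter> set ?P) \<le> nY ?P + 1 + length (crossers (hd A) (hd B) ?P)"
      by (rule deg_sum_crossers) (use hX wP dP walk_verts[OF wP] in \<open>auto simp: walk_def\<close>)
    moreover have "nY ?P = c" using nX_path[OF wP dP hX] nP by simp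
    moreover have "length (crossers (hd A) (hd B) ?P) \<le> l0" using few[OF wP dP hX neq nP] .
    moreover have "N v \<inter> set ?P = N v \<inter> (Y \<inter> set C)" if "v \<in> X" for v
      using N_subset_Y[OF that] Yx unfolding sP by blast
    ultimately show ?thesis using n neq com2 hX by simp
  qed
  have inj: "inj_on (cnext C) Dx" using pair by (meson inj_onI)
  then have cardS: "card S = K" using Dx by (simp add: S_def card_image)
  have finS: "finite S" using Dx by (simp add: S_def)
  have SX: "S \<subseteq> X" "x \<notin> S" using single x by (auto simp: S_def)
  let ?W = "Y \<inter> set C"
  let ?k = "\<lambda>s. card (N s \<inter> ?W)"
  have "2 * sum ?k S \<le> card S * (c + 1 + l0)"
  proof (rule pair_sum_bound[OF finS])
    fix s t assume "s \<in> S" "t \<in> S" "s \<noteq> t"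
    then show "?k s + ?k t \<le> c + 1 + l0" using pair unfolding S_def by blast
  qed (use cardS K4 in simp)
  then have sumS: "2 * sum ?k S \<le> K * (c + 1 + l0)" using cardS by simp
  have "card ?W + (\<Sum>q\<in>insert x S. card (N q)) \<le> card Y + (\<Sum>q\<in>insert x S. ?k q)"
  proof (rule union_count)
    fix q q' assume q: "q \<in> insert x S" "q' \<in> insert x S" "q \<noteq> q'"
    consider "q = x" "q' \<in> S" | "q \<in> S" "q' = x" | "q \<in> S" "q' \<in> S" using q by blast
    then show "N q \<inter> N q' \<subseteq> ?W"
    proof cases
      case 1 then show ?thesis using single unfolding S_def by blast
    next
      case 2 then show ?thesis using single unfolding S_def by blast
    next
      case 3 then show ?thesis using pair q unfolding S_def by blast
    qed
  qed (use finS SX x N_subset_Y in auto)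
  moreover have "card (insert x S) * \<delta> \<le> (\<Sum>q\<in>insert x S. card (N q))"
    using sum_bounded_below[of "insert x S" \<delta> "\<lambda>q. card (N q)"] SX x min_deg by auto
  moreover have "card (insert x S) = K + 1" using cardS finS SX by simp
  moreover have "(\<Sum>q\<in>insert x S. ?k q) = K + sum ?k S"
  proof -
    have "N x \<inter> ?W = Dx" using Dx by (auto simp: Dx_def)
    then show ?thesis using finS SX Dx by simp
  qed
  moreover have "card ?W = c" using longestD(6)[OF C] .
  ultimately have main: "c + (K + 1) * \<delta> + 10 \<le> 4 * \<delta> + K + sum ?k S" using card_Y by simp
  have cd: "c + 1 \<le> \<delta>" using c_less card_X by simp
  \<comment> \<open>\<open>j\<close> and \<open>i\<close> are the excesses of \<open>K\<close> and
    \<open>D\<close> over their least values. Once \<open>c\<close> and \<open>l0\<close> are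
    eliminated, a polynomial in \<open>i\<close> and \<open>j\<close> with nonnegative coefficients
    and constant term 2 would have to be at most 0.\<close>
  obtain j i where ji: "K = 4 + j" "D = 3 + i" using K4 D3 le_Suc_ex by metis
  have dd: "\<delta> = 8 + j + i" using dK ji by simp
  have "2 * (c + (4 + j + 1) * \<delta> + 10) \<le> 2 * (4 * \<delta> + (4 + j)) + (4 + j) * (c + 1 + l0)"
  proof -
    have "2 * (c + (K + 1) * \<delta> + 10) \<le> 2 * (4 * \<delta> + K) + 2 * sum ?k S"
      using mult_le_mono2[OF main, of 2] by (simp only: add_mult_distrib2)
    also have "\<dots> \<le> 2 * (4 * \<delta> + K) + K * (c + 1 + l0)"
      using sumS by (rule add_left_mono)
    finally show ?thesis unfolding ji .
  qed
  then have "int (2 * (c + (4 + j + 1) * \<delta> + 10)) \<le> int (2 * (4 * \<delta> + (4 + j)) + (4 + j) * (c + 1 + l0))"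
    by (simp only: of_nat_le_iff)
  then have 1: "2 * int \<delta> + 2 * int j * int \<delta> + 20 \<le> 2 * (4 + int j) + (2 + int j) * int c + (4 + int j) * (1 + int l0)"
    by (simp add: algebra_simps)
  have "(2 + int j) * int c \<le> (2 + int j) * (int \<delta> - 1)" using cd by (intro mult_left_mono) auto
  then have "int j * int \<delta> + 10 - 2 * int j \<le> (4 + int j) * int l0" using 1 by (simp add: algebra_simps)
  then have "(3 + int i) * (int j * int \<delta> + 10 - 2 * int j) \<le> (3 + int i) * ((4 + int j) * int l0)"
    by (intro mult_left_mono) auto
  also have "\<dots> = (4 + int j) * (int l0 * (3 + int i))" by (simp add: algebra_simps)
  also have "\<dots> \<le> (4 + int j) * (2 * int \<delta> - 9)"
  proof (intro mult_left_mono)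
    have "int (l0 * (3 + i) + 9) \<le> int (2 * \<delta>)" using l0 unfolding ji by (simp only: of_nat_le_iff)
    then show "int l0 * (3 + int i) \<le> 2 * int \<delta> - 9" by simp
  qed auto
  finally have "(3 + int i) * (int j * int \<delta> + 10 - 2 * int j) \<le> (4 + int j) * (2 * int \<delta> - 9)" .
  then have "2 + 2 * int i + int j * (int i * int i + 7 * int i + 3) + int j * int j * (1 + int i) \<le> 0"
    unfolding dd by (simp add: algebra_simps)
  moreover have "0 \<le> int j * (int i * int i + 7 * int i + 3)" "0 \<le> int j * int j * (1 + int i)" by auto
  ultimately show False by linarith
qed

text \<open>If \<open>P\<close> has exactly \<open>c + 1\<close> vertices of \<open>X\<close>,
  \<open>few_crossings\<close> with \<open>K = 3\<close> leaves at most one crosser because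
  \<open>4 \<le> \<delta>\<close>. If it has more, any crosser would yield a cycle with more than
  \<open>c\<close> of them.\<close>

lemma crossers_le_1:
  assumes P: "walk s P t" "distinct P" "s \<in> X" "t \<in> X" "s \<noteq> t" "c < nX P"
  shows "length (crossers s t P) \<le> 1"
proof (cases "nX P = c + 1")
  case True
  show ?thesis
  proof (rule ccontr)
    assume "\<not> length (crossers s t P) \<le> 1"
    then obtain k where k: "length (crossers s t P) = 2 + k" using le_Suc_ex[of 2 "length (crossers s t P)"] by auto
    obtain d where d: "\<delta> = 4 + d" using le_Suc_ex[OF delta_ge_4] by blast
    have "(2 + k) * \<delta> + 9 \<le> 2 * \<delta> + (2 + k) * (3 + 1)"
      using few_crossings[OF max_nbrs_le_3 P(1-5) True] unfolding k .
    then show False unfolding d by (simp add: algebra_simps)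
  qed
next
  case False
  then have big: "c + 1 < nX P" using P(6) by simp
  have "set (crossers s t P) = {}"
  proof (rule ccontr)
    assume "set (crossers s t P) \<noteq> {}"
    then obtain v where "v \<in> set (crossers s t P)" by (meson ex_in_conv)
    then obtain q1 u w q2 where q: "P = q1 @ u # v # w # q2" "E t u" "E s w" by (auto simp: crossers_iff)
    let ?C = "q1 @ u # rev q2 @ [w]"
    have "cyc ?C" using crossing_cyc P(1-4) q by blast
    moreover have "nX P \<le> Suc (nX ?C)"
    proof -
      have "X \<inter> set P \<subseteq> insert v (X \<inter> set ?C)" using q(1) by auto
      then have "card (X \<inter> set P) \<le> card (insert v (X \<inter> set ?C))" by (rule card_mono[rotated]) simp
      also have "\<dots> \<le> Suc (nX ?C)" unfolding nX_def by (simp add: card_insert_if)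
      finally show ?thesis by (simp add: nX_def)
    qed
    ultimately show False using cyc_max[of ?C] big by simp
  qed
  then show ?thesis by simp
qed

end

section \<open>A component off a longest cycle\<close>

text \<open>Only the vertex set \<open>Z\<close> of the cycle is fixed, so that its list may be
  rotated freely.\<close>

locale outside_component = no_spanning_cycle +
  fixes Z :: "'a set" and x :: 'a and H :: "'a set"
  assumes Z_longest: "\<exists>L. longest L \<and> set L = Z"
    and x: "x \<in> X" "x \<notin> Z"
    and H_def: "H = {v. \<exists>p. walk x p v \<and> set p \<inter> Z = {}}"
begin

lemma Z_props: "Z \<subseteq> X \<union> Y" "card (X \<inter> Z) = c" "card (Y \<inter> Z) = c" "finite Z" "2 < card Z"
proof -
  obtain L where L: "longest L" "set L = Z" using Z_longest by blast
  show "Z \<subseteq> X \<union> Y" "card (X \<inter> Z) = c" "card (Y \<inter> Z) = c" "finite Z"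
    using longestD[OF L(1)] L(2) by (auto simp: nX_def)
  have "3 \<le> length L" using longestD(1)[OF L(1)] by (simp add: cyc_def)
  then show "2 < card Z" using distinct_card[OF longestD(3)[OF L(1)]] L(2) by simp
qed

lemma x_H: "x \<in> H"
  unfolding H_def using x by (auto intro!: exI[of _ "[x]"])

lemma H_Z: "H \<inter> Z = {}"
  unfolding H_def using walk_ends(2) by fastforce

lemma H_closed: "v \<in> H \<Longrightarrow> E v w \<Longrightarrow> w \<in> H \<union> Z"
proof -
  assume v: "v \<in> H" "E v w"
  then obtain p where p: "walk x p v" "set p \<inter> Z = {}" by (auto simp: H_def)
  have "walk x (p @ [w]) w" using walk_append[OF p(1), of w "[w]" w] v(2) by simp
  then have "w \<notin> Z \<Longrightarrow> w \<in> H" unfolding H_def using p(2) by (intro CollectI exI[of _ "p @ [w]"]) auto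
  then show ?thesis by blast
qed

lemma walk_in_H: "walk x p v \<Longrightarrow> set p \<inter> Z = {} \<Longrightarrow> set p \<subseteq> H"
proof
  fix w assume p: "walk x p v" "set p \<inter> Z = {}" and "w \<in> set p"
  then obtain a b where ab: "p = (a @ [w]) @ b" using split_list by fastforce
  have "walk x (a @ [w]) w"
  proof (cases "b = []")
    case True
    then have pw: "p = a @ [w]" using ab by simp
    then have "v = w" using p(1) by (simp add: walk_def)
    then show ?thesis using p(1) unfolding pw by blast
  next
    case False then show ?thesis using p(1) ab walk_append_iff[of "a @ [w]" b x v] by simp
  qed
  then show "w \<in> H" unfolding H_def using p(2) ab by (intro CollectI exI[of _ "a @ [w]"]) auto
qed

lemma H_conn:
  assumes "u \<in> H" "v \<in> H"
  obtains M where "walk u M v" "distinct M" "set M \<subseteq> H"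
proof -
  obtain p q where p: "walk x p u" "set p \<inter> Z = {}" and q: "walk x q v" "set q \<inter> Z = {}"
    using assms by (auto simp: H_def)
  have "\<exists>r. walk u r v \<and> set r \<subseteq> H"
  proof (cases "tl q")
    case Nil
    then have "q = [x]" "v = x" using q(1) by (cases q; auto simp: walk_def)+
    then show ?thesis using walk_rev[OF p(1)] walk_in_H[OF p] by (intro exI[of _ "rev p"]) auto
  next
    case (Cons w r)
    then have qq: "q = [x] @ (w # r)" using q(1) by (cases q) (auto simp: walk_def)
    then have "walk w (w # r) v" "E x w" using q(1) walk_append_iff[of "[x]" "w # r" x v] by auto
    then have "walk u (rev p @ w # r) v" using walk_append[OF walk_rev[OF p(1)]] by blast
    moreover have "set (rev p @ w # r) \<subseteq> H" using walk_in_H[OF p] walk_in_H[OF q] qq by auto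
    ultimately show ?thesis by blast
  qed
  then obtain r where r: "walk u r v" "set r \<subseteq> H" by blast
  obtain M where "walk u M v" "distinct M" "set M \<subseteq> set r" using walk_distinct[OF r(1)] by blast
  then show ?thesis using that r(2) by blast
qed

text \<open>
  A \<open>link\<close> is a path through \<open>H\<close> that can be inserted between two vertices of \<open>Z\<close>; two vertices are
  \<open>joined\<close> if a path between them contains all of \<open>X \<inter> Z\<close> and a vertex of \<open>X \<inter> H\<close>.
\<close>

definition link :: "'a \<Rightarrow> 'a \<Rightarrow> bool" where
  "link u v \<longleftrightarrow> (\<exists>M h h'. walk h M h' \<and> distinct M \<and> set M \<subseteq> H \<and> set M \<inter> X \<noteq> {} \<and> E u h \<and> E h' v)"

definition joined :: "'a \<Rightarrow> 'a \<Rightarrow> bool" where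
  "joined q q' \<longleftrightarrow> (\<exists>p1 M p2. walk q (p1 @ M @ p2) q' \<and> distinct (p1 @ M @ p2) \<and> set p1 \<union> set p2 \<subseteq> Z \<and>
     X \<inter> Z \<subseteq> set p1 \<union> set p2 \<and> set M \<subseteq> H \<and> set M \<inter> X \<noteq> {})"

lemma link_sym: "link u v \<Longrightarrow> link v u"
proof -
  assume "link u v"
  then obtain M h h' where M: "walk h M h'" "distinct M" "set M \<subseteq> H" "set M \<inter> X \<noteq> {}" "E u h" "E h' v"
    by (auto simp: link_def)
  then show ?thesis unfolding link_def
    using walk_rev[OF M(1)] E_sym[OF M(5)] E_sym[OF M(6)] by (intro exI[of _ "rev M"] exI) auto
qed

lemma joined_sym: "joined q q' \<Longrightarrow> joined q' q"
proof -
  assume "joined q q'"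
  then obtain p1 M p2 where *: "walk q (p1 @ M @ p2) q'" "distinct (p1 @ M @ p2)" "set p1 \<union> set p2 \<subseteq> Z"
     "X \<inter> Z \<subseteq> set p1 \<union> set p2" "set M \<subseteq> H" "set M \<inter> X \<noteq> {}"
    by (auto simp: joined_def)
  show ?thesis unfolding joined_def
    by (rule exI[of _ "rev p2"], rule exI[of _ "rev M"], rule exI[of _ "rev p1"])
      (use walk_rev[OF *(1)] * in auto)
qed

lemma nX_big:
  assumes "distinct (p1 @ M @ p2)" "X \<inter> Z \<subseteq> set p1 \<union> set p2" "set M \<subseteq> H" "set M \<inter> X \<noteq> {}"
  shows "c < nX (p1 @ M @ p2)"
proof -
  obtain m where m: "m \<in> set M" "m \<in> X" using assms(4) by blast
  have "m \<notin> Z" using m assms(3) H_Z by blast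
  then have "card (insert m (X \<inter> Z)) = Suc c" using Z_props by simp
  moreover have "insert m (X \<inter> Z) \<subseteq> X \<inter> set (p1 @ M @ p2)" using assms(2) m by auto
  then have "card (insert m (X \<inter> Z)) \<le> nX (p1 @ M @ p2)" unfolding nX_def by (rule card_mono[rotated]) simp
  ultimately show ?thesis by simp
qed

text \<open>The link is spliced between \<open>p1\<close> and \<open>p2\<close>. The second claim
  serves for vertices of \<open>Z\<close> that the resulting path skips: they cannot be common
  neighbours of its ends.\<close>

lemma joined_avoid:
  assumes "walk q p1 b" "walk b' p2 q'" "link b b'" "distinct (p1 @ p2)" "set p1 \<union> set p2 \<subseteq> Z"
     "X \<inter> Z \<subseteq> set p1 \<union> set p2"
  shows "joined q q'"
    and "\<lbrakk>q \<in> X; q' \<in> X; q \<noteq> q'; E q y; E q' y\<rbrakk> \<Longrightarrow> y \<in> set p1 \<union> set p2 \<union> H"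
proof -
  obtain M h h' where M: "walk h M h'" "distinct M" "set M \<subseteq> H" "set M \<inter> X \<noteq> {}" "E b h" "E h' b'"
    using assms(3) by (auto simp: link_def)
  have w: "walk q (p1 @ M @ p2) q'"
    using walk_append[OF assms(1) walk_append[OF M(1) assms(2) M(6)] M(5)] .
  have d: "distinct (p1 @ M @ p2)" using assms(4,5) M(2,3) H_Z by auto
  show "joined q q'" unfolding joined_def using w d assms(5,6) M by blast
  assume q: "q \<in> X" "q' \<in> X" "q \<noteq> q'" "E q y" "E q' y"
  have "N q \<inter> N q' \<subseteq> set (p1 @ M @ p2)"
    using no_common_nbr_off_path[OF w d q(1-3)] nX_big[OF d assms(6) M(3,4)] by simp
  then show "y \<in> set p1 \<union> set p2 \<union> H" using q M(3) by (auto simp: N_def)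
qed

lemma joined_common:
  assumes "joined q q'" "q \<in> X" "q' \<in> X" "q \<noteq> q'"
  shows "N q \<inter> N q' \<subseteq> Z \<union> H"
proof -
  obtain p1 M p2 where *: "walk q (p1 @ M @ p2) q'" "distinct (p1 @ M @ p2)" "set p1 \<union> set p2 \<subseteq> Z"
     "X \<inter> Z \<subseteq> set p1 \<union> set p2" "set M \<subseteq> H" "set M \<inter> X \<noteq> {}"
    using assms(1) by (auto simp: joined_def)
  have "N q \<inter> N q' \<subseteq> set (p1 @ M @ p2)"
    using no_common_nbr_off_path[OF *(1,2) assms(2-4)] nX_big[OF *(2,4,5,6)] by simp
  then show ?thesis using * by auto
qed

text \<open>Each of \<open>p1\<close> and \<open>p2\<close> contributes 1 beyond its number of
  \<open>Y\<close>-vertices, and together they have at most one crosser; this gives the 3. A vertex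
  of \<open>R\<close> is skipped by the path, so at most one end is adjacent to it.\<close>

lemma joined_sum:
  assumes "joined q q'" "q \<in> X" "q' \<in> X" "q \<noteq> q'"
  shows "card (N q \<inter> Z) + card (N q' \<inter> Z) \<le> c + 3"
proof -
  obtain p1 M p2 where *: "walk q (p1 @ M @ p2) q'" "distinct (p1 @ M @ p2)" "set p1 \<union> set p2 \<subseteq> Z"
     "X \<inter> Z \<subseteq> set p1 \<union> set p2" "set M \<subseteq> H" "set M \<inter> X \<noteq> {}"
    using assms(1) by (auto simp: joined_def)
  have big: "c < nX (p1 @ M @ p2)" using nX_big[OF *(2,4,5,6)] .
  have common: "N q \<inter> N q' \<subseteq> set (p1 @ M @ p2)" using no_common_nbr_off_path[OF *(1,2) assms(2-4) big] .
  define R where "R = Y \<inter> Z - (set p1 \<union> set p2)"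
  have fR: "finite R" using Z_props by (simp add: R_def)
  have split: "card (N v \<inter> Z) = card (N v \<inter> set p1) + card (N v \<inter> set p2) + card (N v \<inter> R)"
    if v: "v \<in> X" for v
  proof -
    have e: "N v \<inter> Z = (N v \<inter> set p1) \<union> (N v \<inter> set p2) \<union> (N v \<inter> R)"
      using *(3) N_subset_Y[OF v] unfolding R_def by blast
    have "card ((N v \<inter> set p1) \<union> (N v \<inter> set p2) \<union> (N v \<inter> R))
        = card ((N v \<inter> set p1) \<union> (N v \<inter> set p2)) + card (N v \<inter> R)"
      by (rule card_Un_disjoint) (use fR in \<open>auto simp: R_def\<close>)
    moreover have "card ((N v \<inter> set p1) \<union> (N v \<inter> set p2)) = card (N v \<inter> set p1) + card (N v \<inter> set p2)"
      by (rule card_Un_disjoint) (use *(2) in auto)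
    ultimately show ?thesis using e by simp
  qed
  have "card (N q \<inter> R) + card (N q' \<inter> R) = card ((N q \<inter> R) \<union> (N q' \<inter> R))"
  proof (rule card_Un_disjoint[symmetric])
    have "R \<inter> set (p1 @ M @ p2) = {}" using *(5) H_Z by (auto simp: R_def)
    then show "N q \<inter> R \<inter> (N q' \<inter> R) = {}" using common by blast
  qed (use fR in auto)
  also have "\<dots> \<le> card R" by (rule card_mono[OF fR]) auto
  finally have cR: "card (N q \<inter> R) + card (N q' \<inter> R) \<le> card R" .
  have cY: "nY p1 + nY p2 + card R = c"
  proof -
    have "Y \<inter> Z = (Y \<inter> set p1 \<union> Y \<inter> set p2) \<union> R" using *(3) by (auto simp: R_def)
    then have "card (Y \<inter> Z) = card (Y \<inter> set p1 \<union> Y \<inter> set p2) + card R"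
      using card_Un_disjoint[of "Y \<inter> set p1 \<union> Y \<inter> set p2" R] fR by (auto simp: R_def)
    moreover have "card (Y \<inter> set p1 \<union> Y \<inter> set p2) = nY p1 + nY p2"
      unfolding nY_def by (rule card_Un_disjoint) (use *(2) in auto)
    ultimately show ?thesis using Z_props by simp
  qed
  have "successively E (p1 @ M @ p2)" using *(1) by (simp add: walk_def)
  then have s: "successively E p1" "successively E p2" by (auto simp: successively_append_iff)
  have "set p1 \<subseteq> X \<union> Y" "set p2 \<subseteq> X \<union> Y" using *(3) Z_props(1) by blast+
  then have "card (N q \<inter> set p1) + card (N q' \<inter> set p1) \<le> nY p1 + 1 + length (crossers q q' p1)"
    "card (N q \<inter> set p2) + card (N q' \<inter> set p2) \<le> nY p2 + 1 + length (crossers q q' p2)"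
    using deg_sum_crossers[OF assms(2,3)] s *(2) by auto
  moreover have "length (crossers q q' p1) + length (crossers q q' p2) \<le> 1"
    using crossers_append_length[OF *(2), of q q'] crossers_le_1[OF *(1,2) assms(2-4) big] by simp
  ultimately show ?thesis using split[OF assms(2)] split[OF assms(3)] cR cY by linarith
qed

text \<open>A link would close the path to a cycle with an additional vertex of \<open>X\<close>.
  Combined with \<open>not_link\<close>, this restricts the neighbours of \<open>q\<close> in
  \<open>H\<close>.\<close>

lemma not_link_exit:
  assumes "walk q p b" "distinct p" "set p \<subseteq> Z" "X \<inter> Z \<subseteq> set p"
  shows "\<not> link q b"
proof
  assume "link q b"
  then have "link b q" by (rule link_sym)
  then obtain M h h' where M: "walk h M h'" "distinct M" "set M \<subseteq> H" "set M \<inter> X \<noteq> {}" "E b h" "E h' q"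
    by (auto simp: link_def)
  have d: "distinct (p @ M @ [])" using assms M H_Z by auto
  have "walk q (p @ M) h'" using walk_append[OF assms(1) M(1) M(5)] .
  moreover have "3 \<le> length (p @ M)"
  proof -
    have "card Z \<le> 2 * c" using Z_props card_Un_disjoint[of "X \<inter> Z" "Y \<inter> Z"] XY_disj
      by (metis Int_Un_distrib2 Int_absorb1 card_Un_le mult_2)
    then have "2 \<le> c" using Z_props(5) by simp
    moreover have "card (X \<inter> Z) \<le> card (set p)" by (rule card_mono) (use assms(4) in auto)
    then have "c \<le> length p" using Z_props card_length[of p] by simp
    moreover have "M \<noteq> []" using M(1) by (simp add: walk_def)
    ultimately show ?thesis by (cases M) auto
  qed
  ultimately have "cyc (p @ M)" using M(6) d by (intro cycI) auto
  then show False using cyc_max[of "p @ M"] nX_big[OF d _ M(3,4)] assms(4) by simp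
qed

text \<open>A path in \<open>H\<close> from a neighbour of \<open>u\<close> to a neighbour of
  \<open>v\<close> must miss \<open>X\<close>, so it is a single vertex of \<open>Y\<close>; hence
  all these neighbours coincide.\<close>

lemma not_link:
  assumes nl: "\<not> link u v" and ne: "N u \<inter> H \<noteq> {}" "N v \<inter> H \<noteq> {}"
  obtains w where "w \<in> Y" "N u \<inter> H = {w}" "N v \<inter> H = {w}"
proof -
  have *: "h = h' \<and> h \<in> Y" if h: "h \<in> N u \<inter> H" "h' \<in> N v \<inter> H" for h h'
  proof -
    obtain M where M: "walk h M h'" "distinct M" "set M \<subseteq> H" using H_conn h by blast
    have E: "E u h" "E h' v" using h E_commute[of h' v] by (auto simp: N_def)
    have MX: "set M \<inter> X = {}" using nl M E unfolding link_def by blast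
    have hY: "h \<in> Y" using walk_ends(1)[OF M(1)] MX E(1) E_bip by blast
    have "tl M = []"
    proof (rule ccontr)
      assume "tl M \<noteq> []"
      then obtain m r where "M = h # m # r" using M(1) by (cases M; cases "tl M") (auto simp: walk_def)
      then have "E h m" "m \<in> set M" using M(1) by (auto simp: walk_def)
      then show False using MX hY E_Y by blast
    qed
    then have "h = h'" using M(1) by (cases M) (auto simp: walk_def)
    then show ?thesis using hY by blast
  qed
  obtain w w' where "w \<in> N u \<inter> H" "w' \<in> N v \<inter> H" using ne by blast
  then have "w \<in> Y" "N u \<inter> H = {w}" "N v \<inter> H = {w}" using * by blast+
  then show ?thesis using that by blast
qed

text \<open>The link would begin and end at \<open>w\<close>, so consist of \<open>w\<close> alone,
  yet it has to meet \<open>X\<close>.\<close>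

lemma link_two_exits:
  assumes "link b b'" "N b \<inter> H = {w}" "N b' \<inter> H = {w}" "w \<in> Y"
  shows False
proof -
  obtain M h h' where M: "walk h M h'" "distinct M" "set M \<subseteq> H" "set M \<inter> X \<noteq> {}" "E b h" "E h' b'"
    using assms(1) by (auto simp: link_def)
  have "h = w" "h' = w" using walk_ends[OF M(1)] M assms E_commute[of h' b'] by (auto simp: N_def)
  then have "M = [w]" using M(1,2) by (cases M) (auto simp: walk_def split: if_splits)
  then show False using M(4) assms(4) X_not_Y by auto
qed

text \<open>The degrees supply \<open>5 * \<delta> - 1\<close>. On \<open>Z\<close>,
  \<open>x\<close> has at most 3 neighbours and the pairs \<open>q1\<close>, \<open>q2\<close> and
  \<open>q3\<close>, \<open>q4\<close> at most \<open>c + 3\<close> each. So \<open>card Y\<close>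
  is at least \<open>5 * \<delta> - c - 10\<close>, and this is at least
  \<open>4 * \<delta> - 9\<close>.\<close>

lemma five_vertices:
  assumes q: "{q1, q2, q3, q4} \<subseteq> X \<inter> Z" "distinct [q1, q2, q3, q4]"
    and joined: "joined q1 q2" "joined q1 q3" "joined q1 q4" "joined q2 q3" "joined q2 q4" "joined q3 q4"
    and e: "card (N q1 \<inter> H) \<le> 1" "N q2 \<inter> H = {}" "N q3 \<inter> H = {}" "N q4 \<inter> H = {}"
  shows False
proof -
  \<comment> \<open>Vertices of \<open>H\<close> are credited to \<open>x\<close> alone, so that the
    sets overlap only on \<open>Z\<close>.\<close>
  define F where "F v = (if v = x then N x else N v - H)" for v
  let ?Q = "{x, q1, q2, q3, q4}" and ?W = "Y \<inter> Z"
  have qX: "q1 \<in> X" "q2 \<in> X" "q3 \<in> X" "q4 \<in> X" and nx: "q1 \<noteq> x" "q2 \<noteq> x" "q3 \<noteq> x" "q4 \<noteq> x"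
    using q(1) x by auto
  have common: "N a \<inter> N b \<subseteq> Z \<union> H" if "a \<in> ?Q" "b \<in> ?Q" "a \<noteq> b" for a b
  proof -
    have xc: "N x \<subseteq> Z \<union> H" using H_closed[OF x_H] by (auto simp: N_def)
    show ?thesis
    proof (cases "a = x \<or> b = x")
      case False
      then have "joined a b" using that joined joined_sym by blast
      then show ?thesis using joined_common that False qX by blast
    qed (use xc in blast)
  qed
  have "card ?W + (\<Sum>v\<in>?Q. card (F v)) \<le> card Y + (\<Sum>v\<in>?Q. card (F v \<inter> ?W))"
  proof (rule union_count)
    fix a b assume ab: "a \<in> ?Q" "b \<in> ?Q" "a \<noteq> b"
    have "F a \<inter> F b \<subseteq> (N a \<inter> N b) - H" using ab(3) by (auto simp: F_def)
    then have "F a \<inter> F b \<subseteq> Z" using common[OF ab] by blast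
    moreover have "F a \<subseteq> Y" using N_subset_Y ab qX x by (auto simp: F_def)
    ultimately show "F a \<inter> F b \<subseteq> ?W" by blast
  next
    fix v assume "v \<in> ?Q"
    then show "F v \<subseteq> Y" using N_subset_Y qX x by (auto simp: F_def)
  qed (use qX x in auto)
  moreover have "(\<Sum>v\<in>?Q. card (F v)) = card (F x) + card (F q1) + card (F q2) + card (F q3) + card (F q4)"
    using q(2) nx by simp
  moreover have "(\<Sum>v\<in>?Q. card (F v \<inter> ?W)) = card (F x \<inter> ?W) + card (F q1 \<inter> ?W) + card (F q2 \<inter> ?W)
      + card (F q3 \<inter> ?W) + card (F q4 \<inter> ?W)"
    using q(2) nx by simp
  moreover have FW: "F v \<inter> ?W = N v \<inter> Z" if "v \<in> ?Q" for v
    using N_subset_Y that qX x H_Z by (auto simp: F_def)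
  moreover have "\<delta> \<le> card (F x)" using min_deg[OF x(1)] by (simp add: F_def)
  moreover have "\<delta> \<le> card (F q1) + 1"
  proof -
    have "card (N q1) = card (N q1 - H) + card (N q1 \<inter> H)"
      using card_Diff_subset_Int[of "N q1" H] fin_N[OF qX(1)] card_mono[of "N q1" "N q1 \<inter> H"] by simp
    then show ?thesis using min_deg[OF qX(1)] e(1) nx by (simp add: F_def)
  qed
  moreover have "\<delta> \<le> card (F v)" if "v \<in> {q2, q3, q4}" for v
  proof -
    have "F v = N v" using that e nx unfolding F_def by auto
    then show ?thesis using min_deg[of v] that qX by auto
  qed
  then have "\<delta> \<le> card (F q2)" "\<delta> \<le> card (F q3)" "\<delta> \<le> card (F q4)" by simp_all
  moreover have "card (N x \<inter> Z) \<le> 3"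
    using max_nbrs_le_3 Z_longest x unfolding nbr_bound_def by blast
  moreover have "card (N q1 \<inter> Z) + card (N q2 \<inter> Z) \<le> c + 3" using joined_sum[OF joined(1)] qX q(2) by simp
  moreover have "card (N q3 \<inter> Z) + card (N q4 \<inter> Z) \<le> c + 3" using joined_sum[OF joined(6)] qX q(2) by simp
  moreover have "c + 1 \<le> \<delta>" using c_less card_X by simp
  ultimately show False using Z_props(3) card_Y by simp
qed

lemma linked_attachments:
  "\<exists>B. card B = 3 \<and> B \<subseteq> Z \<and> N x \<inter> Z \<subseteq> B \<and> (\<forall>u\<in>B. N u \<inter> H \<noteq> {}) \<and>
     (\<forall>u\<in>B. \<forall>v\<in>B. u \<noteq> v \<longrightarrow> link u v)"
proof -
  define A where "A = {u \<in> Z. N u \<inter> H \<noteq> {}}"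
  define good where "good B \<longleftrightarrow> N x \<inter> Z \<subseteq> B \<and> B \<subseteq> A \<and> card B \<le> 3 \<and>
     (\<forall>u\<in>B. \<forall>v\<in>B. u \<noteq> v \<longrightarrow> link u v)" for B
  have fA: "finite A" using Z_props by (simp add: A_def)
  \<comment> \<open>The single vertex \<open>x\<close> links any two of its neighbours, so good sets
    exist.\<close>
  have g0: "good (N x \<inter> Z)" unfolding good_def
  proof (intro conjI ballI impI)
    show "N x \<inter> Z \<subseteq> A"
      using x_H E_sym by (auto simp: A_def N_def)
    show "card (N x \<inter> Z) \<le> 3"
      using max_nbrs_le_3 Z_longest x unfolding nbr_bound_def by blast
    fix u v assume "u \<in> N x \<inter> Z" "v \<in> N x \<inter> Z"
    then have "E u x" "E x v" using E_commute[of u x] by (auto simp: N_def)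
    then show "link u v" unfolding link_def
      by (intro exI[of _ "[x]"] exI[of _ x]) (use x_H x in auto)
  qed simp
  have bnd: "\<forall>B. good B \<longrightarrow> card B < 4" by (auto simp: good_def)
  obtain B where B: "good B" and Bmax: "\<forall>B'. good B' \<longrightarrow> card B' \<le> card B"
    using ex_has_greatest_nat[OF g0 bnd] by (elim exE conjE)
  have fB: "finite B" using B fA finite_subset by (auto simp: good_def)
  have BX: "B \<subseteq> X \<union> Y" using B Z_props(1) by (auto simp: good_def A_def)
  have "card B = 3"
  proof (rule ccontr)
    assume "card B \<noteq> 3"
    then have cB: "card B < 3" using B by (simp add: good_def)
    \<comment> \<open>Two attachments whose only neighbour in \<open>H\<close> is the same \<open>w \<in> Y\<close> are not linked; so \<open>w\<close> is deleted
      instead of the attachment.\<close>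
    define cut where "cut u = (if \<exists>w\<in>Y. N u \<inter> H = {w} then the_elem (N u \<inter> H) else u)" for u
    let ?S = "cut ` B"
    have cS: "card ?S < 3" "finite ?S" using card_image_le[OF fB, of cut] cB fB by auto
    have "\<not> Z \<subseteq> ?S"
    proof
      assume "Z \<subseteq> ?S"
      then have "card Z \<le> card ?S" using card_mono cS by blast
      then show False using Z_props(5) cS by simp
    qed
    then obtain v where v: "v \<in> Z" "v \<notin> ?S" by blast
    have xS: "x \<notin> ?S"
    proof
      assume "x \<in> ?S"
      then obtain u where u: "u \<in> B" "x = cut u" by blast
      have "u \<in> Z" using u B by (auto simp: good_def A_def)
      show False
      proof (cases "\<exists>w\<in>Y. N u \<inter> H = {w}")
        case True
        then have "x \<in> Y" using u by (auto simp: cut_def)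
        then show False using x X_not_Y by blast
      qed (use u \<open>u \<in> Z\<close> x in \<open>simp add: cut_def\<close>)
    qed
    obtain L where L: "longest L" "set L = Z" using Z_longest by blast
    \<comment> \<open>Fewer than 3 vertices are deleted, so \<open>x\<close> still reaches
      \<open>Z\<close>. If the end \<open>e\<close> were in \<open>B\<close>, then \<open>e\<close>
      or its only neighbour \<open>h\<close> would have been deleted; if not, \<open>e\<close>
      enlarges \<open>B\<close> unless it shares its only neighbour, a deleted \<open>w\<close>,
      with some \<open>u \<in> B\<close>.\<close>
    obtain M h e where M: "walk x M h" "distinct M" "set M \<inter> set L = {}" "set M \<inter> ?S = {}"
      "E h e" "e \<in> set L" "e \<notin> ?S"
      by (rule reach_cycle[of x L ?S v]) (use x xS cS v L Z_props(1) in auto)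
    have hH: "h \<in> H" using walk_in_H[OF M(1)] M(3) L(2) walk_ends(2)[OF M(1)] by auto
    have hS: "h \<notin> ?S" using M(4) walk_ends(2)[OF M(1)] by auto
    have hN: "h \<in> N e \<inter> H" using hH E_sym[OF M(5)] by (simp add: N_def)
    have eA: "e \<in> A" using hN M(6) L(2) by (auto simp: A_def)
    show False
    proof (cases "e \<in> B")
      case True
      show False
      proof (cases "\<exists>w\<in>Y. N e \<inter> H = {w}")
        case T: True
        then have "h = cut e" using hN by (auto simp: cut_def)
        then show False using hS True by blast
      next
        case False
        then have "cut e = e" by (auto simp: cut_def)
        then show False using M(7) True by (metis imageI)
      qed
    next
      case False
      have "\<not> good (insert e B)"
      proof
        assume "good (insert e B)"
        then have "card (insert e B) \<le> card B" using Bmax by blast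
        then show False using False fB by simp
      qed
      then have "\<exists>u\<in>B. \<not> link u e"
        using B eA cB False fB link_sym unfolding good_def by (auto simp: card_insert_if)
      then obtain u where u: "u \<in> B" "\<not> link u e" by blast
      have "N u \<inter> H \<noteq> {}" using u B by (auto simp: good_def A_def)
      then obtain w where w: "w \<in> Y" "N u \<inter> H = {w}" "N e \<inter> H = {w}"
        using not_link[OF u(2)] hN by blast
      then have "cut u = w" "h = w" using hN by (auto simp: cut_def)
      then show False using hS u(1) by blast
    qed
  qed
  then show ?thesis using B by (intro exI[of _ B]) (auto simp: good_def A_def)
qed

end

section \<open>Three linked attachments\<close>

text \<open>
  The three attachments are the last vertices of \<open>S1 @ eb\<close>, \<open>S2 @ ec\<close> and \<open>S3 @ ea\<close>.  An attachment
  in \<open>Y\<close> is itself the separator \<open>tb\<close> (and then \<open>eb = [tb]\<close>); for an attachment in \<open>X\<close> the separator is the next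
  vertex on the cycle (and then \<open>eb = []\<close>).
\<close>

locale tripod = outside_component +
  fixes S1 S2 S3 :: "'a list" and tb tc ta :: 'a and eb ec ea :: "'a list"
  assumes cycle: "longest (S1 @ [tb] @ S2 @ [tc] @ S3 @ [ta])" "set (S1 @ [tb] @ S2 @ [tc] @ S3 @ [ta]) = Z"
    and tY: "tb \<in> Y" "tc \<in> Y" "ta \<in> Y"
    and S_ne: "S1 \<noteq> []" "S2 \<noteq> []" "S3 \<noteq> []"
    and eb: "eb = [] \<or> eb = [tb]" and ec: "ec = [] \<or> ec = [tc]" and ea: "ea = [] \<or> ea = [ta]"
    and links: "link (last (S1 @ eb)) (last (S2 @ ec))" "link (last (S2 @ ec)) (last (S3 @ ea))"
      "link (last (S3 @ ea)) (last (S1 @ eb))"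
    and exits: "N (last (S1 @ eb)) \<inter> H \<noteq> {}" "N (last (S2 @ ec)) \<inter> H \<noteq> {}" "N (last (S3 @ ea)) \<inter> H \<noteq> {}"
    and x_nbrs: "N x \<inter> Z \<subseteq> {last (S1 @ eb), last (S2 @ ec), last (S3 @ ea)}"
begin

text \<open>Cyclic symmetry: interpreting the locale with rotated data carries every statement about
  one segment over to the other two.\<close>

lemma rotate: "tripod E X Y c \<delta> Z x H S2 S3 S1 tc ta tb ec ea eb"
proof -
  have "longest ((S2 @ [tc] @ S3 @ [ta]) @ (S1 @ [tb]))"
    using longest_rotate[of "S1 @ [tb]" "S2 @ [tc] @ S3 @ [ta]"] cycle(1) by simp
  then have l: "longest (S2 @ [tc] @ S3 @ [ta] @ S1 @ [tb])" by simp
  show ?thesis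
    by unfold_locales (use l cycle(2) tY S_ne eb ec ea links exits x_nbrs in auto)
qed

abbreviation "a' \<equiv> hd S1"
abbreviation "b' \<equiv> hd S2"
abbreviation "c' \<equiv> hd S3"
abbreviation "ba \<equiv> last (S3 @ ea)"
abbreviation "bb \<equiv> last (S1 @ eb)"
abbreviation "bc \<equiv> last (S2 @ ec)"

lemma seg_dist: "distinct (S1 @ [tb] @ S2 @ [tc] @ S3 @ [ta])"
  using longestD(3)[OF cycle(1)] .

lemma seg_walks:
  "walk a' (S1 @ [tb]) tb" "walk b' (S2 @ [tc]) tc" "walk c' (S3 @ [ta]) ta"
  "walk a' S1 (last S1)" "walk b' S2 (last S2)" "walk c' S3 (last S3)"
  "E tb b'" "E tc c'" "E ta a'" "E (last S1) tb" "E (last S2) tc" "E (last S3) ta"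
proof -
  obtain u v where w: "walk u (S1 @ [tb] @ S2 @ [tc] @ S3 @ [ta]) v" "E v u"
    using longestD(1)[OF cycle(1)] by (auto simp: cyc_def)
  then have uv: "u = a'" "v = ta" using S_ne by (auto simp: walk_def)
  have 1: "walk a' S1 (last S1)" "walk tb ([tb] @ S2 @ [tc] @ S3 @ [ta]) ta" "E (last S1) tb"
    using walk_append_iff[of S1 "[tb] @ S2 @ [tc] @ S3 @ [ta]" a' ta] w(1) S_ne uv by simp_all
  then have 2: "walk b' (S2 @ [tc] @ S3 @ [ta]) ta" "E tb b'"
    using walk_append_iff[of "[tb]" "S2 @ [tc] @ S3 @ [ta]" tb ta] S_ne by simp_all
  then have 3: "walk b' S2 (last S2)" "walk tc ([tc] @ S3 @ [ta]) ta" "E (last S2) tc"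
    using walk_append_iff[of S2 "[tc] @ S3 @ [ta]" b' ta] S_ne by simp_all
  then have 4: "walk c' (S3 @ [ta]) ta" "E tc c'"
    using walk_append_iff[of "[tc]" "S3 @ [ta]" tc ta] S_ne by simp_all
  then have 5: "walk c' S3 (last S3)" "E (last S3) ta"
    using walk_append_iff[of S3 "[ta]" c' ta] S_ne by simp_all
  show "walk a' (S1 @ [tb]) tb" "walk b' (S2 @ [tc]) tc" "walk c' (S3 @ [ta]) ta"
    using walk_append[OF 1(1), of tb "[tb]" tb] walk_append[OF 3(1), of tc "[tc]" tc] 1 3 4 by simp_all
  show "walk a' S1 (last S1)" "walk b' S2 (last S2)" "walk c' S3 (last S3)"
    "E tb b'" "E tc c'" "E ta a'" "E (last S1) tb" "E (last S2) tc" "E (last S3) ta"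
    using 1 2 3 4 5 w(2) uv by simp_all
qed

lemma exit_walks: "walk a' (S1 @ eb) bb" "walk b' (S2 @ ec) bc" "walk c' (S3 @ ea) ba"
  using eb ec ea seg_walks S_ne by auto

lemma segs_Z: "set S1 \<union> set S2 \<union> set S3 \<union> {ta, tb, tc} = Z" "X \<inter> Z \<subseteq> set S1 \<union> set S2 \<union> set S3"
proof -
  show Z: "set S1 \<union> set S2 \<union> set S3 \<union> {ta, tb, tc} = Z" unfolding cycle(2)[symmetric] by auto
  have "ta \<notin> X" "tb \<notin> X" "tc \<notin> X" using tY X_not_Y by blast+
  then show "X \<inter> Z \<subseteq> set S1 \<union> set S2 \<union> set S3" unfolding Z[symmetric] by blast
qed

lemma exit_sets: "set eb \<subseteq> {tb}" "set ec \<subseteq> {tc}" "set ea \<subseteq> {ta}" "distinct eb" "distinct ec" "distinct ea"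
  using eb ec ea by auto

lemma heads: "a' \<in> X" "b' \<in> X" "c' \<in> X" "a' \<noteq> b'" "b' \<noteq> c'" "a' \<noteq> c'" "a' \<in> Z" "b' \<in> Z" "c' \<in> Z"
proof -
  show "a' \<in> X" "b' \<in> X" "c' \<in> X" using seg_walks tY E_Y by blast+
  have "a' \<in> set S1" "b' \<in> set S2" "c' \<in> set S3" using S_ne by auto
  then show "a' \<noteq> b'" "b' \<noteq> c'" "a' \<noteq> c'" "a' \<in> Z" "b' \<in> Z" "c' \<in> Z"
    using seg_dist segs_Z(1) by auto
qed

text \<open>The path follows the first segment to \<open>bb\<close>, passes through \<open>H\<close>
  to \<open>ba\<close> and runs backward over the third and second segments to \<open>b'\<close>. If
  \<open>eb = []\<close> it skips \<open>tb\<close>, which is a neighbour of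
  \<open>b'\<close>.\<close>

lemma joined_ab: "joined a' b'" and tb_private: "eb = [] \<Longrightarrow> \<not> E a' tb"
proof -
  let ?p = "S1 @ eb" and ?q = "rev (S2 @ [tc] @ S3 @ ea)"
  have "walk b' (S2 @ [tc] @ S3 @ ea) ba"
    using walk_append[OF seg_walks(2) exit_walks(3)] seg_walks by simp
  then have w: "walk ba ?q b'" by (rule walk_rev)
  have d: "distinct (?p @ ?q)"
    using seg_dist exit_sets by auto
  have s: "set ?p \<union> set ?q \<subseteq> Z" "X \<inter> Z \<subseteq> set ?p \<union> set ?q"
    using exit_sets segs_Z by auto
  have l: "link bb ba" using links link_sym by blast
  show "joined a' b'" using joined_avoid(1)[OF exit_walks(1) w l d s] .
  assume "eb = []"
  then have "tb \<notin> set ?p \<union> set ?q \<union> H"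
    using seg_dist exit_sets H_Z segs_Z(1) by auto
  then show "\<not> E a' tb"
    using joined_avoid(2)[OF exit_walks(1) w l d s, of tb] heads E_sym[OF seg_walks(7)] by blast
qed

text \<open>Same argument for the path over the third and first segments to \<open>bb\<close>,
  through \<open>H\<close> to \<open>bc\<close> and backward to \<open>b'\<close>.\<close>

lemma tb_private2: "eb = [] \<Longrightarrow> \<not> E c' tb"
proof -
  let ?p = "S3 @ [ta] @ S1 @ eb" and ?q = "rev (S2 @ ec)"
  assume eb0: "eb = []"
  have p: "walk c' ?p bb" using walk_append[OF seg_walks(3) exit_walks(1)] seg_walks by simp
  have w: "walk bc ?q b'" using exit_walks(2) by (rule walk_rev)
  have d: "distinct (?p @ ?q)"
    using seg_dist exit_sets by auto
  have s: "set ?p \<union> set ?q \<subseteq> Z" "X \<inter> Z \<subseteq> set ?p \<union> set ?q"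
    using exit_sets segs_Z by auto
  have "tb \<notin> set ?p \<union> set ?q \<union> H"
    using seg_dist exit_sets H_Z segs_Z(1) eb0 by auto
  then show "\<not> E c' tb"
    using joined_avoid(2)[OF p w links(1) d s, of tb] heads not_sym[OF heads(5)] E_sym[OF seg_walks(7)] by blast
qed

text \<open>
  \<open>U\<close> is the part of the segment before \<open>y\<close>, while \<open>Vn\<close> and \<open>Ve\<close> lead from \<open>y\<close> to the separator and to the
  attachment, respectively.
\<close>

definition pos1 :: "'a list \<Rightarrow> 'a \<Rightarrow> 'a list \<Rightarrow> 'a list \<Rightarrow> bool" where
  "pos1 U y Vn Ve \<longleftrightarrow> y \<in> Y \<and> U \<noteq> [] \<and> S1 @ [tb] = U @ y # Vn \<and> S1 @ eb = U @ y # Ve"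

definition pos3 :: "'a list \<Rightarrow> 'a \<Rightarrow> 'a list \<Rightarrow> 'a list \<Rightarrow> bool" where
  "pos3 U y Vn Ve \<longleftrightarrow> y \<in> Y \<and> U \<noteq> [] \<and> S3 @ [ta] = U @ y # Vn \<and> S3 @ ea = U @ y # Ve"

lemma pos1_walks:
  assumes "pos1 U y Vn Ve"
  shows "walk (last U) (rev U) a'" "walk y (y # Vn) tb" "walk y (y # Ve) bb" "E (last U) y" "last U \<in> X"
    "walk a' U (last U)"
proof -
  have y: "y \<in> Y" "U \<noteq> []" "S1 @ [tb] = U @ y # Vn" "S1 @ eb = U @ y # Ve" using assms by (auto simp: pos1_def)
  have "walk a' (U @ y # Vn) tb" "walk a' (U @ y # Ve) bb"
    using seg_walks(1) exit_walks(1) unfolding y(3) y(4) by blast+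
  then have 1: "walk a' U (last U)" "walk y (y # Vn) tb" "walk y (y # Ve) bb" "E (last U) y"
    using walk_append_iff[of U "y # Vn" a' tb] walk_append_iff[of U "y # Ve" a' bb] y by simp_all
  then show "walk y (y # Vn) tb" "walk y (y # Ve) bb" "E (last U) y" "walk a' U (last U)" by simp_all
  show "walk (last U) (rev U) a'" using walk_rev[OF 1(1)] .
  show "last U \<in> X" using 1(4) y(1) E_Y by blast
qed

lemma pos3_walks:
  assumes "pos3 U y Vn Ve"
  shows "walk (last U) (rev U) c'" "walk y (y # Vn) ta" "walk y (y # Ve) ba" "E (last U) y" "last U \<in> X"
    "walk c' U (last U)"
proof -
  have y: "y \<in> Y" "U \<noteq> []" "S3 @ [ta] = U @ y # Vn" "S3 @ ea = U @ y # Ve" using assms by (auto simp: pos3_def)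
  have "walk c' (U @ y # Vn) ta" "walk c' (U @ y # Ve) ba"
    using seg_walks(3) exit_walks(3) unfolding y(3) y(4) by blast+
  then have 1: "walk c' U (last U)" "walk y (y # Vn) ta" "walk y (y # Ve) ba" "E (last U) y"
    using walk_append_iff[of U "y # Vn" c' ta] walk_append_iff[of U "y # Ve" c' ba] y by simp_all
  then show "walk y (y # Vn) ta" "walk y (y # Ve) ba" "E (last U) y" "walk c' U (last U)" by simp_all
  show "walk (last U) (rev U) c'" using walk_rev[OF 1(1)] .
  show "last U \<in> X" using 1(4) y(1) E_Y by blast
qed

lemma seg_disj:
  "insert tb (set S1) \<inter> insert tc (set S2) = {}" "insert tb (set S1) \<inter> insert ta (set S3) = {}"
  "insert tc (set S2) \<inter> insert ta (set S3) = {}"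
  "distinct (S1 @ [tb])" "distinct (S2 @ [tc])" "distinct (S3 @ [ta])"
  "distinct (S1 @ eb)" "distinct (S2 @ ec)" "distinct (S3 @ ea)"
  using seg_dist exit_sets by auto

text \<open>Named so that paths assembled from one list per segment are checked by set inclusions
  only, without unfolding the lists.\<close>

definition "T1 = insert tb (set S1)"
definition "T2 = insert tc (set S2)"
definition "T3 = insert ta (set S3)"

lemma T_facts:
  "T1 \<inter> T2 = {}" "T1 \<inter> T3 = {}" "T2 \<inter> T3 = {}" "T1 \<subseteq> Z" "T2 \<subseteq> Z" "T3 \<subseteq> Z"
  "set (S1 @ [tb]) \<subseteq> T1" "set (S2 @ [tc]) \<subseteq> T2" "set (S3 @ [ta]) \<subseteq> T3"
  "set (S1 @ eb) \<subseteq> T1" "set (S2 @ ec) \<subseteq> T2" "set (S3 @ ea) \<subseteq> T3"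
proof -
  show "T1 \<inter> T2 = {}" "T1 \<inter> T3 = {}" "T2 \<inter> T3 = {}"
    unfolding T1_def T2_def T3_def by (fact seg_disj)+
  show "T1 \<subseteq> Z" "T2 \<subseteq> Z" "T3 \<subseteq> Z"
    unfolding T1_def T2_def T3_def segs_Z(1)[symmetric] by auto
  show "set (S1 @ [tb]) \<subseteq> T1" "set (S2 @ [tc]) \<subseteq> T2" "set (S3 @ [ta]) \<subseteq> T3"
    unfolding T1_def T2_def T3_def by auto
  show "set (S1 @ eb) \<subseteq> T1" "set (S2 @ ec) \<subseteq> T2" "set (S3 @ ea) \<subseteq> T3"
    unfolding T1_def T2_def T3_def using exit_sets by auto
qed

lemma three_segments:
  assumes "distinct A" "distinct B" "distinct D" "set A \<subseteq> T1" "set B \<subseteq> T2" "set D \<subseteq> T3"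
  shows "distinct (A @ B @ D)" "set (A @ B @ D) \<subseteq> Z"
proof -
  have "set A \<inter> set B = {}" "set A \<inter> set D = {}" "set B \<inter> set D = {}"
    using assms T_facts(1-3) by blast+
  then show "distinct (A @ B @ D)" using assms by auto
  show "set (A @ B @ D) \<subseteq> Z" using assms T_facts(4-6) by auto
qed

lemma pos1_sets:
  assumes "pos1 U y Vn Ve"
  shows "distinct (U @ y # Vn)" "distinct (U @ y # Ve)" "set (U @ y # Vn) \<subseteq> T1"
    "set (U @ y # Ve) \<subseteq> T1" "X \<inter> set S1 \<subseteq> set U \<union> set Ve" "X \<inter> set S1 \<subseteq> set U \<union> set Vn"
proof -
  have y: "y \<in> Y" "S1 @ [tb] = U @ y # Vn" "S1 @ eb = U @ y # Ve" using assms by (auto simp: pos1_def)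
  show "distinct (U @ y # Vn)" "distinct (U @ y # Ve)"
    "set (U @ y # Vn) \<subseteq> T1" "set (U @ y # Ve) \<subseteq> T1"
    using seg_disj T_facts unfolding y(2) y(3) by blast+
  have "y \<notin> X" using y(1) X_not_Y by blast
  moreover have "set S1 \<subseteq> set (U @ y # Ve)" "set S1 \<subseteq> set (U @ y # Vn)"
    unfolding y(2)[symmetric] y(3)[symmetric] by auto
  ultimately show "X \<inter> set S1 \<subseteq> set U \<union> set Ve" "X \<inter> set S1 \<subseteq> set U \<union> set Vn" by auto
qed

lemma pos3_sets:
  assumes "pos3 U y Vn Ve"
  shows "distinct (U @ y # Vn)" "distinct (U @ y # Ve)" "set (U @ y # Vn) \<subseteq> T3"
    "set (U @ y # Ve) \<subseteq> T3" "X \<inter> set S3 \<subseteq> set U \<union> set Ve" "X \<inter> set S3 \<subseteq> set U \<union> set Vn"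
proof -
  have y: "y \<in> Y" "S3 @ [ta] = U @ y # Vn" "S3 @ ea = U @ y # Ve" using assms by (auto simp: pos3_def)
  show "distinct (U @ y # Vn)" "distinct (U @ y # Ve)"
    "set (U @ y # Vn) \<subseteq> T3" "set (U @ y # Ve) \<subseteq> T3"
    using seg_disj T_facts unfolding y(2) y(3) by blast+
  have "y \<notin> X" using y(1) X_not_Y by blast
  moreover have "set S3 \<subseteq> set (U @ y # Ve)" "set S3 \<subseteq> set (U @ y # Vn)"
    unfolding y(2)[symmetric] y(3)[symmetric] by auto
  ultimately show "X \<inter> set S3 \<subseteq> set U \<union> set Ve" "X \<inter> set S3 \<subseteq> set U \<union> set Vn" by auto
qed

lemma pos_split_walk:
  assumes "walk d (U @ y # V) (last (U @ y # V))" "U \<noteq> []"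
  shows "walk y (y # V) (last (y # V))"
  using walk_append_iff[of U "y # V" d "last (U @ y # V)"] assms by simp

lemma piece_walks:
  "walk ba (rev (S2 @ [tc] @ S3 @ ea)) b'" "walk bc (rev (S2 @ ec)) b'"
  "walk ta ([ta] @ rev S3) c'" "walk tc ([tc] @ rev S2) b'"
  "walk bc (rev (S1 @ [tb] @ S2 @ ec)) a'" "E a' ta" "E b' tb" "E c' tc"
proof -
  show c: "E a' ta" "E b' tb" "E c' tc" using seg_walks E_sym by blast+
  have "walk b' (S2 @ [tc] @ S3 @ ea) ba"
    using walk_append[OF seg_walks(2) exit_walks(3)] seg_walks by simp
  then show "walk ba (rev (S2 @ [tc] @ S3 @ ea)) b'" by (rule walk_rev)
  show "walk bc (rev (S2 @ ec)) b'" using exit_walks(2) by (rule walk_rev)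
  show "walk ta ([ta] @ rev S3) c'" using walk_rev[OF seg_walks(3)] by simp
  show "walk tc ([tc] @ rev S2) b'" using walk_rev[OF seg_walks(2)] by simp
  have "walk a' (S1 @ [tb] @ S2 @ ec) bc"
    using walk_append[OF seg_walks(1) exit_walks(2)] seg_walks by simp
  then show "walk bc (rev (S1 @ [tb] @ S2 @ ec)) a'" by (rule walk_rev)
qed

lemmas links' = links link_sym[OF links(1)] link_sym[OF links(2)] link_sym[OF links(3)]

text \<open>From the vertex before \<open>y\<close> go back to \<open>a'\<close>. If
  \<open>a'\<close> is adjacent to \<open>y\<close>, cross to \<open>y\<close>, go on to
  \<open>bb\<close>, through \<open>H\<close> to \<open>ba\<close> and backward to
  \<open>b'\<close>. If \<open>c'\<close> is, continue backward over the third segment to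
  \<open>c'\<close>, cross to \<open>y\<close>, go on to \<open>bb\<close>, through \<open>H\<close>
  to \<open>bc\<close> and backward to \<open>b'\<close>.\<close>

lemma joined_pos1_next:
  assumes p: "pos1 U y Vn Ve" and E: "E a' y \<or> E c' y"
  shows "joined (last U) b'"
  using E
proof
  assume E: "E a' y"
  show ?thesis
  proof -
    have w1: "walk (last U) (rev U @ y # Ve) bb" using walk_append[OF pos1_walks(1)[OF p] pos1_walks(3)[OF p] E] .
    have t: "distinct ((U @ y # Ve) @ (S2 @ [tc]) @ (S3 @ ea))" "set ((U @ y # Ve) @ (S2 @ [tc]) @ (S3 @ ea)) \<subseteq> Z"
      by (rule three_segments; use pos1_sets(2,4)[OF p] T_facts seg_disj in blast)+
    have d: "distinct ((rev U @ y # Ve) @ rev (S2 @ [tc] @ S3 @ ea))" "set (rev U @ y # Ve) \<union> set (rev (S2 @ [tc] @ S3 @ ea)) \<subseteq> Z"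
      using t by auto
    have e: "X \<inter> Z \<subseteq> set (rev U @ y # Ve) \<union> set (rev (S2 @ [tc] @ S3 @ ea))"
      using segs_Z(2) pos1_sets(5)[OF p] by auto
    show ?thesis using joined_avoid(1)[OF w1 piece_walks(1) links'(6) d e] .
  qed
next
  assume E: "E c' y"
  let ?p = "rev U @ ([ta] @ rev S3) @ y # Ve"
  have w: "walk (last U) ?p bb"
    using walk_append[OF pos1_walks(1)[OF p] walk_append[OF piece_walks(3) pos1_walks(3)[OF p] E] piece_walks(6)] .
  show ?thesis
  proof -
    have t: "distinct ((U @ y # Ve) @ (S2 @ ec) @ (S3 @ [ta]))" "set ((U @ y # Ve) @ (S2 @ ec) @ (S3 @ [ta])) \<subseteq> Z"
      by (rule three_segments; use pos1_sets(2,4)[OF p] T_facts seg_disj in blast)+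
    have d: "distinct (?p @ rev (S2 @ ec))" "set ?p \<union> set (rev (S2 @ ec)) \<subseteq> Z"
      using t by auto
    have e: "X \<inter> Z \<subseteq> set ?p \<union> set (rev (S2 @ ec))"
      using segs_Z(2) pos1_sets(5)[OF p] by auto
    show ?thesis using joined_avoid(1)[OF w piece_walks(2) links'(1) d e] .
  qed
qed

text \<open>Back to \<open>c'\<close>, across to \<open>y\<close>, forward into the first segment up
  to \<open>bb\<close>, through \<open>H\<close> to \<open>bc\<close> and backward to
  \<open>b'\<close>.\<close>

lemma joined_pos3_next:
  assumes p: "pos3 U y Vn Ve" and E: "E c' y"
  shows "joined (last U) b'"
proof -
  let ?p = "rev U @ (y # Vn) @ S1 @ eb"
  have w: "walk (last U) ?p bb"
    using walk_append[OF pos3_walks(1)[OF p] walk_append[OF pos3_walks(2)[OF p] exit_walks(1) seg_walks(9)] E] .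
  show ?thesis
  proof -
    have t: "distinct ((S1 @ eb) @ (S2 @ ec) @ (U @ y # Vn))" "set ((S1 @ eb) @ (S2 @ ec) @ (U @ y # Vn)) \<subseteq> Z"
      by (rule three_segments; use pos3_sets(1,3)[OF p] T_facts seg_disj in blast)+
    have d: "distinct (?p @ rev (S2 @ ec))" "set ?p \<union> set (rev (S2 @ ec)) \<subseteq> Z"
      using t by auto
    have e: "X \<inter> Z \<subseteq> set ?p \<union> set (rev (S2 @ ec))"
      using segs_Z(2) pos3_sets(6)[OF p] by auto
    show ?thesis using joined_avoid(1)[OF w piece_walks(2) links'(1) d e] .
  qed
qed

text \<open>As in \<open>joined_pos1_next\<close> with \<open>z\<close> as the vertex crossed to; on
  reaching \<open>b'\<close> the path crosses to \<open>y\<close>, skipped so far, and ends at the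
  vertex before \<open>z\<close>.\<close>

lemma joined_pos1_pos1:
  assumes p: "pos1 U y Vn Ve" and q: "pos1 (U @ y # V) z Wn We" and V: "V \<noteq> []"
    and E: "E b' y" "E a' z \<or> E c' z"
  shows "joined (last U) (last V)"
proof -
  have U: "U \<noteq> []" using p by (simp add: pos1_def)
  have V2: "walk y (y # V) (last V)" using pos_split_walk[OF pos1_walks(6)[OF q] U] V by simp
  have qs: "distinct ((U @ y # V) @ z # We)" "set ((U @ y # V) @ z # We) \<subseteq> T1"
    "X \<inter> set S1 \<subseteq> set (U @ y # V) \<union> set We" using pos1_sets[OF q] by blast+
  have "y \<notin> X" using p X_not_Y by (auto simp: pos1_def)
  then have cov: "X \<inter> set S1 \<subseteq> set U \<union> set V \<union> set We" using qs(3) by auto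
  show ?thesis
    using E(2)
  proof
    assume E2: "E a' z"
    let ?p = "rev U @ z # We" and ?q = "rev (S2 @ [tc] @ S3 @ ea) @ y # V"
    show ?thesis
    proof -
      have w1: "walk (last U) ?p bb" using walk_append[OF pos1_walks(1)[OF p] pos1_walks(3)[OF q] E2] .
      have w2: "walk ba ?q (last V)" using walk_append[OF piece_walks(1) V2 E(1)] .
      have t: "distinct (((U @ y # V) @ z # We) @ (S2 @ [tc]) @ (S3 @ ea))" "set (((U @ y # V) @ z # We) @ (S2 @ [tc]) @ (S3 @ ea)) \<subseteq> Z"
        by (rule three_segments; use qs(1,2) T_facts seg_disj in blast)+
      have d: "distinct (?p @ ?q)" "set ?p \<union> set ?q \<subseteq> Z"
        using t by auto
      have e: "X \<inter> Z \<subseteq> set ?p \<union> set ?q"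
        using segs_Z(2) cov by auto
      show ?thesis using joined_avoid(1)[OF w1 w2 links'(6) d e] .
    qed
  next
    assume E2: "E c' z"
    let ?p = "rev U @ ([ta] @ rev S3) @ z # We" and ?q = "rev (S2 @ ec) @ y # V"
    show ?thesis
    proof -
      have w1: "walk (last U) ?p bb" using walk_append[OF pos1_walks(1)[OF p]
            walk_append[OF piece_walks(3) pos1_walks(3)[OF q] E2] piece_walks(6)] .
      have w2: "walk bc ?q (last V)" using walk_append[OF piece_walks(2) V2 E(1)] .
      have t: "distinct (((U @ y # V) @ z # We) @ (S2 @ ec) @ (S3 @ [ta]))" "set (((U @ y # V) @ z # We) @ (S2 @ ec) @ (S3 @ [ta])) \<subseteq> Z"
        by (rule three_segments; use qs(1,2) T_facts seg_disj in blast)+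
      have d: "distinct (?p @ ?q)" "set ?p \<union> set ?q \<subseteq> Z"
        using t by auto
      have e: "X \<inter> Z \<subseteq> set ?p \<union> set ?q"
        using segs_Z(2) cov by auto
      show ?thesis using joined_avoid(1)[OF w1 w2 links'(1) d e] .
    qed
  qed
qed

text \<open>The stretch from \<open>y\<close> to the vertex before \<open>z\<close> again comes
  last; it is entered from \<open>a'\<close> or from \<open>b'\<close>.\<close>

lemma joined_pos3_pos3:
  assumes p: "pos3 U y Vn Ve" and q: "pos3 (U @ y # V) z Wn We" and V: "V \<noteq> []"
    and E: "E a' y \<or> E b' y" "E c' z"
  shows "joined (last U) (last V)"
proof -
  have U: "U \<noteq> []" using p by (simp add: pos3_def)
  have V2: "walk y (y # V) (last V)" using pos_split_walk[OF pos3_walks(6)[OF q] U] V by simp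
  have qs: "distinct ((U @ y # V) @ z # We)" "set ((U @ y # V) @ z # We) \<subseteq> T3"
    "X \<inter> set S3 \<subseteq> set (U @ y # V) \<union> set We" using pos3_sets[OF q] by blast+
  have qn: "distinct ((U @ y # V) @ z # Wn)" "set ((U @ y # V) @ z # Wn) \<subseteq> T3"
    using pos3_sets[OF q] by blast+
  have "y \<notin> X" "z \<notin> X" using p q X_not_Y by (auto simp: pos3_def)
  then have cov: "X \<inter> set S3 \<subseteq> set U \<union> set V \<union> set We" "X \<inter> set S3 \<subseteq> set U \<union> set V \<union> set Wn"
    using qs(3) pos3_sets(6)[OF q] by auto
  show ?thesis
    using E(1)
  proof
    assume E1: "E a' y"
    let ?p = "rev U @ z # We" and ?q = "rev (S1 @ [tb] @ S2 @ ec) @ y # V"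
    show ?thesis
    proof -
      have w1: "walk (last U) ?p ba" using walk_append[OF pos3_walks(1)[OF p] pos3_walks(3)[OF q] E(2)] .
      have w2: "walk bc ?q (last V)" using walk_append[OF piece_walks(5) V2 E1] .
      have t: "distinct ((S1 @ [tb]) @ (S2 @ ec) @ ((U @ y # V) @ z # We))" "set ((S1 @ [tb]) @ (S2 @ ec) @ ((U @ y # V) @ z # We)) \<subseteq> Z"
        by (rule three_segments; use qs(1,2) T_facts seg_disj in blast)+
      have d: "distinct (?p @ ?q)" "set ?p \<union> set ?q \<subseteq> Z"
        using t by auto
      have e: "X \<inter> Z \<subseteq> set ?p \<union> set ?q"
        using segs_Z(2) cov(1) by auto
      show ?thesis using joined_avoid(1)[OF w1 w2 links'(5) d e] .
    qed
  next
    assume E1: "E b' y"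
    let ?p = "rev U @ (z # Wn) @ S1 @ eb" and ?q = "rev (S2 @ ec) @ y # V"
    show ?thesis
    proof -
      have w1: "walk (last U) ?p bb" using walk_append[OF pos3_walks(1)[OF p]
            walk_append[OF pos3_walks(2)[OF q] exit_walks(1) seg_walks(9)] E(2)] .
      have w2: "walk bc ?q (last V)" using walk_append[OF piece_walks(2) V2 E1] .
      have t: "distinct ((S1 @ eb) @ (S2 @ ec) @ ((U @ y # V) @ z # Wn))" "set ((S1 @ eb) @ (S2 @ ec) @ ((U @ y # V) @ z # Wn)) \<subseteq> Z"
        by (rule three_segments; use qn T_facts seg_disj in blast)+
      have d: "distinct (?p @ ?q)" "set ?p \<union> set ?q \<subseteq> Z"
        using t by auto
      have e: "X \<inter> Z \<subseteq> set ?p \<union> set ?q"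
        using segs_Z(2) cov(2) by auto
      show ?thesis using joined_avoid(1)[OF w1 w2 links'(1) d e] .
    qed
  qed
qed

text \<open>The alternatives in \<open>E\<close> exhaust what can occur for
  \<open>y \<in> shared3\<close> and \<open>z \<in> shared1\<close>; each needs its own order of the
  pieces.\<close>

lemma joined_pos3_pos1:
  assumes p: "pos3 U y Vn Ve" and q: "pos1 U1 z Wn We"
    and E: "E a' y \<and> E b' z \<or> E b' y \<and> (E a' z \<or> E c' z)"
  shows "joined (last U) (last U1)"
proof -
  note ps = pos3_sets[OF p] and qs = pos1_sets[OF q]
  consider "E a' y" "E b' z" | "E b' y" "E a' z" | "E b' y" "E c' z" using E by blast
  then show ?thesis
  proof cases
    case 1
    let ?p = "rev U @ ([tc] @ rev S2) @ z # We" and ?q = "rev (y # Ve) @ U1"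
    show ?thesis
    proof -
      have w1: "walk (last U) ?p bb" using walk_append[OF pos3_walks(1)[OF p]
            walk_append[OF piece_walks(4) pos1_walks(3)[OF q] 1(2)] piece_walks(8)] .
      have w2: "walk ba ?q (last U1)"
        using walk_append[OF walk_rev[OF pos3_walks(3)[OF p]] pos1_walks(6)[OF q] E_sym[OF 1(1)]] .
      have t: "distinct ((U1 @ z # We) @ (S2 @ [tc]) @ (U @ y # Ve))" "set ((U1 @ z # We) @ (S2 @ [tc]) @ (U @ y # Ve)) \<subseteq> Z"
        by (rule three_segments; use ps(2,4) qs(2,4) T_facts seg_disj in blast)+
      have d: "distinct (?p @ ?q)" "set ?p \<union> set ?q \<subseteq> Z"
        using t by auto
      have e: "X \<inter> Z \<subseteq> set ?p \<union> set ?q"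
        using segs_Z(2) ps(5) qs(5) by auto
      show ?thesis using joined_avoid(1)[OF w1 w2 links'(6) d e] .
    qed
  next
    case 2
    let ?p = "rev U @ ([tc] @ rev S2) @ y # Ve" and ?q = "rev (z # We) @ U1"
    show ?thesis
    proof -
      have w1: "walk (last U) ?p ba" using walk_append[OF pos3_walks(1)[OF p]
            walk_append[OF piece_walks(4) pos3_walks(3)[OF p] 2(1)] piece_walks(8)] .
      have w2: "walk bb ?q (last U1)"
        using walk_append[OF walk_rev[OF pos1_walks(3)[OF q]] pos1_walks(6)[OF q] E_sym[OF 2(2)]] .
      have t: "distinct ((U1 @ z # We) @ (S2 @ [tc]) @ (U @ y # Ve))" "set ((U1 @ z # We) @ (S2 @ [tc]) @ (U @ y # Ve)) \<subseteq> Z"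
        by (rule three_segments; use ps(2,4) qs(2,4) T_facts seg_disj in blast)+
      have d: "distinct (?p @ ?q)" "set ?p \<union> set ?q \<subseteq> Z"
        using t by auto
      have e: "X \<inter> Z \<subseteq> set ?p \<union> set ?q"
        using segs_Z(2) ps(5) qs(5) by auto
      show ?thesis using joined_avoid(1)[OF w1 w2 links'(3) d e] .
    qed
  next
    case 3
    let ?p = "rev U @ z # We" and ?q = "rev (S2 @ ec) @ (y # Vn) @ U1"
    show ?thesis
    proof -
      have w1: "walk (last U) ?p bb" using walk_append[OF pos3_walks(1)[OF p] pos1_walks(3)[OF q] 3(2)] .
      have w2: "walk bc ?q (last U1)"
        using walk_append[OF piece_walks(2) walk_append[OF pos3_walks(2)[OF p] pos1_walks(6)[OF q] seg_walks(9)] 3(1)] .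
      have t: "distinct ((U1 @ z # We) @ (S2 @ ec) @ (U @ y # Vn))" "set ((U1 @ z # We) @ (S2 @ ec) @ (U @ y # Vn)) \<subseteq> Z"
        by (rule three_segments; use ps(1,3) qs(2,4) T_facts seg_disj in blast)+
      have d: "distinct (?p @ ?q)" "set ?p \<union> set ?q \<subseteq> Z"
        using t by auto
      have e: "X \<inter> Z \<subseteq> set ?p \<union> set ?q"
        using segs_Z(2) ps(6) qs(5) by auto
      show ?thesis using joined_avoid(1)[OF w1 w2 links'(1) d e] .
    qed
  qed
qed

text \<open>For each head adjacent to \<open>y\<close>, some path from the vertex before
  \<open>y\<close> runs through all of \<open>X \<inter> Z\<close> and ends in one of the
  attachments, so \<open>not_link_exit\<close> applies.\<close>

lemma pos1_exits:
  assumes p: "pos1 U y Vn Ve"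
  shows "E a' y \<Longrightarrow> \<not> link (last U) ba" "E b' y \<Longrightarrow> \<not> link (last U) bb" "E c' y \<Longrightarrow> \<not> link (last U) bc"
proof -
  note ps = pos1_sets[OF p]
  have n: "set (U @ y # Vn) \<subseteq> T1" "distinct (U @ y # Vn)" "set (U @ y # Ve) \<subseteq> T1" "distinct (U @ y # Ve)"
    using ps by blast+
  show "\<not> link (last U) ba" if E: "E a' y"
  proof (rule not_link_exit)
    let ?p = "rev U @ (y # Vn) @ (S2 @ [tc]) @ S3 @ ea"
    show "walk (last U) ?p ba"
      using walk_append[OF pos1_walks(1)[OF p] walk_append[OF pos1_walks(2)[OF p]
            walk_append[OF seg_walks(2) exit_walks(3) seg_walks(8)] seg_walks(7)] E] .
    have t: "distinct ((U @ y # Vn) @ (S2 @ [tc]) @ (S3 @ ea))" "set ((U @ y # Vn) @ (S2 @ [tc]) @ (S3 @ ea)) \<subseteq> Z"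
      by (rule three_segments; use n T_facts seg_disj in blast)+
    show "distinct ?p" "set ?p \<subseteq> Z" using t by auto
    show "X \<inter> Z \<subseteq> set ?p" using segs_Z(2) ps(6) by auto
  qed
  show "\<not> link (last U) bb" if E: "E b' y"
  proof (rule not_link_exit)
    let ?p = "rev U @ ([ta] @ rev S3) @ ([tc] @ rev S2) @ y # Ve"
    show "walk (last U) ?p bb"
      using walk_append[OF pos1_walks(1)[OF p] walk_append[OF piece_walks(3)
            walk_append[OF piece_walks(4) pos1_walks(3)[OF p] E] piece_walks(8)] piece_walks(6)] .
    have t: "distinct ((U @ y # Ve) @ (S2 @ [tc]) @ (S3 @ [ta]))" "set ((U @ y # Ve) @ (S2 @ [tc]) @ (S3 @ [ta])) \<subseteq> Z"
      by (rule three_segments; use n T_facts seg_disj in blast)+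
    show "distinct ?p" "set ?p \<subseteq> Z" using t by auto
    show "X \<inter> Z \<subseteq> set ?p" using segs_Z(2) ps(5) by auto
  qed
  show "\<not> link (last U) bc" if E: "E c' y"
  proof (rule not_link_exit)
    let ?p = "rev U @ ([ta] @ rev S3) @ (y # Vn) @ S2 @ ec"
    show "walk (last U) ?p bc"
      using walk_append[OF pos1_walks(1)[OF p] walk_append[OF piece_walks(3)
            walk_append[OF pos1_walks(2)[OF p] exit_walks(2) seg_walks(7)] E] piece_walks(6)] .
    have t: "distinct ((U @ y # Vn) @ (S2 @ ec) @ (S3 @ [ta]))" "set ((U @ y # Vn) @ (S2 @ ec) @ (S3 @ [ta])) \<subseteq> Z"
      by (rule three_segments; use n T_facts seg_disj in blast)+
    show "distinct ?p" "set ?p \<subseteq> Z" using t by auto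
    show "X \<inter> Z \<subseteq> set ?p" using segs_Z(2) ps(6) by auto
  qed
qed

text \<open>Otherwise \<open>u\<close>, \<open>b1\<close> and \<open>b2\<close> have one and the
  same single neighbour in \<open>H\<close>, which lies in \<open>Y\<close>, and then
  \<open>b1\<close> and \<open>b2\<close> are not linked.\<close>

lemma two_exits:
  assumes "\<not> link u b1" "\<not> link u b2" "link b1 b2" "N b1 \<inter> H \<noteq> {}" "N b2 \<inter> H \<noteq> {}"
  shows "N u \<inter> H = {}"
proof (rule ccontr)
  assume ne: "N u \<inter> H \<noteq> {}"
  obtain w where w: "w \<in> Y" "N u \<inter> H = {w}" "N b1 \<inter> H = {w}" using not_link[OF assms(1) ne assms(4)] .
  obtain w' where w': "N u \<inter> H = {w'}" "N b2 \<inter> H = {w'}" using not_link[OF assms(2) ne assms(5)] .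
  have "N b2 \<inter> H = {w}" using w w' by auto
  then show False using link_two_exits[OF assms(3) w(3) _ w(1)] by blast
qed

lemma pos1_no_H:
  assumes p: "pos1 U y Vn Ve" and E: "E a' y \<and> E b' y \<or> E b' y \<and> E c' y \<or> E a' y \<and> E c' y"
  shows "N (last U) \<inter> H = {}"
  using E
proof (elim disjE conjE)
  assume "E a' y" "E b' y"
  then show ?thesis using two_exits[OF pos1_exits(2)[OF p] pos1_exits(1)[OF p] links'(6) exits(1,3)] by blast
next
  assume "E b' y" "E c' y"
  then show ?thesis using two_exits[OF pos1_exits(2)[OF p] pos1_exits(3)[OF p] links'(1) exits(1,2)] by blast
next
  assume "E a' y" "E c' y"
  then show ?thesis using two_exits[OF pos1_exits(3)[OF p] pos1_exits(1)[OF p] links'(2) exits(2,3)] by blast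
qed

text \<open>Running round the cycle from \<open>a'\<close> to \<open>ba\<close> shows that these are
  not linked. So a neighbour of \<open>a'\<close> in \<open>H\<close> is unique, lies in
  \<open>Y\<close> and is adjacent to \<open>ba\<close>, which forces \<open>ea = []\<close>. In the
  final count \<open>length ea\<close> pays for a possible neighbour of \<open>x\<close>.\<close>

lemma head_H: "card (N a' \<inter> H) + length ea \<le> 1"
proof -
  let ?p = "(S1 @ [tb]) @ (S2 @ [tc]) @ S3 @ ea"
  have nl: "\<not> link a' ba"
  proof (rule not_link_exit)
    show "walk a' ?p ba"
      using walk_append[OF seg_walks(1) walk_append[OF seg_walks(2) exit_walks(3) seg_walks(8)] seg_walks(7)] .
    show "distinct ?p" "set ?p \<subseteq> Z" by (rule three_segments; use T_facts seg_disj in blast)+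
    show "X \<inter> Z \<subseteq> set ?p" using segs_Z(2) by auto
  qed
  show ?thesis
  proof (cases "N a' \<inter> H = {}")
    case True then show ?thesis using ea by auto
  next
    case False
    obtain w where w: "w \<in> Y" "N a' \<inter> H = {w}" "N ba \<inter> H = {w}" using not_link[OF nl False exits(3)] .
    have "ea = []"
    proof (rule ccontr)
      assume "ea \<noteq> []"
      then have "ba = ta" using ea by auto
      then have "E ta w" using w(3) by (auto simp: N_def)
      then show False using tY w(1) E_Y X_not_Y by blast
    qed
    then show ?thesis using w by simp
  qed
qed

text \<open>If \<open>eb = []\<close>, the separator \<open>tb\<close> comes after the attachment
  and admits no \<open>Ve\<close>; \<open>tb_private\<close> and \<open>tb_private2\<close> rule it
  out.\<close>

lemma pos1_ex:
  assumes "y \<in> Y" "y \<in> set (S1 @ [tb])" "E a' y \<or> E c' y"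
  obtains U Vn Ve where "pos1 U y Vn Ve"
proof -
  obtain U Vn where s: "S1 @ [tb] = U @ y # Vn" using assms(2) split_list by metis
  have U: "U \<noteq> []"
  proof
    assume "U = []"
    then have "a' = y" using s S_ne(1) by (cases S1) auto
    then show False using assms(1) heads(1) X_not_Y by blast
  qed
  show ?thesis
  proof (cases "eb = [tb]")
    case True
    have "pos1 U y Vn Vn" unfolding pos1_def using s U assms(1) True by simp
    then show ?thesis by (rule that)
  next
    case False
    then have e: "eb = []" using eb by blast
    then have "y \<noteq> tb" using tb_private tb_private2 assms(3) by blast
    then obtain Ve where "Vn = Ve @ [tb]" using s by (cases Vn rule: rev_cases) auto
    then have "S1 = U @ y # Ve" using s by simp
    then have "pos1 U y Vn Ve" unfolding pos1_def using s U assms(1) e by simp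
    then show ?thesis by (rule that)
  qed
qed

text \<open>\<open>V\<close> is nonempty because two vertices of \<open>Y\<close> are never
  consecutive.\<close>

lemma pos1_order:
  assumes p: "pos1 U y Vn Ve" and q: "pos1 U' z Wn We" and "y \<noteq> z"
  shows "(\<exists>V. V \<noteq> [] \<and> U' = U @ y # V) \<or> (\<exists>V. V \<noteq> [] \<and> U = U' @ z # V)"
proof -
  have main: "\<exists>V. V \<noteq> [] \<and> U' = U @ y # V"
    if p: "pos1 U y Vn Ve" and q: "pos1 U' z Wn We" and z: "z \<in> set Vn" for U U' y z Vn Ve Wn We
  proof -
    obtain V W where V: "Vn = V @ z # W" using z split_list by metis
    have yz: "y \<in> Y" "z \<in> Y" and s: "S1 @ [tb] = U @ y # Vn" "S1 @ [tb] = U' @ z # Wn"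
      using p q by (auto simp: pos1_def)
    have "distinct ((U @ y # V) @ z # W)" using seg_disj(4) s(1) V by simp
    then have "z \<notin> set (U @ y # V)" "z \<notin> set W" by auto
    moreover have "(U @ y # V) @ z # W = U' @ z # Wn" using s V by simp
    ultimately have U': "U' = U @ y # V" using append_Cons_eq_iff by metis
    have "V \<noteq> []"
    proof
      assume "V = []"
      then have "E y z" using pos1_walks(2)[OF p] V by (simp add: walk_Cons)
      then show False using yz E_Y X_not_Y by blast
    qed
    then show ?thesis using U' by blast
  qed
  have s: "S1 @ [tb] = U @ y # Vn" "S1 @ [tb] = U' @ z # Wn" using p q by (auto simp: pos1_def)
  then have "z \<in> set (U @ y # Vn)" by (metis in_set_conv_decomp)
  then consider "z \<in> set Vn" | "z \<in> set U" using assms(3) by auto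
  then show ?thesis
  proof cases
    case 1 then show ?thesis using main[OF p q] by blast
  next
    case 2
    then obtain P Q where PQ: "U = P @ z # Q" using split_list by metis
    have "distinct (P @ z # Q @ y # Vn)" using seg_disj(4) s(1) PQ by simp
    then have "z \<notin> set P" "z \<notin> set (Q @ y # Vn)" by auto
    moreover have "P @ z # (Q @ y # Vn) = U' @ z # Wn" using s PQ by simp
    ultimately have "Wn = Q @ y # Vn" using append_Cons_eq_iff by metis
    then show ?thesis using main[OF q p] by simp
  qed
qed

text \<open>The facts on the first segment, read after two rotations.\<close>

lemma pos3_facts:
  shows "y \<in> Y \<Longrightarrow> y \<in> set (S3 @ [ta]) \<Longrightarrow> E c' y \<or> E b' y \<Longrightarrow> \<exists>U Vn Ve. pos3 U y Vn Ve"
    and "pos3 U y Vn Ve \<Longrightarrow> E c' y \<and> E a' y \<or> E a' y \<and> E b' y \<or> E c' y \<and> E b' y \<Longrightarrow> N (last U) \<inter> H = {}"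
    and "pos3 U y Vn Ve \<Longrightarrow> pos3 U' z Wn We \<Longrightarrow> y \<noteq> z \<Longrightarrow>
      (\<exists>V. V \<noteq> [] \<and> U' = U @ y # V) \<or> (\<exists>V. V \<noteq> [] \<and> U = U' @ z # V)"
    and "card (N c' \<inter> H) + length ec \<le> 1"
proof -
  interpret r: tripod E X Y c \<delta> Z x H S3 S1 S2 ta tb tc ea eb ec
    by (rule tripod.rotate[OF rotate])
  have eq: "r.pos1 U y Vn Ve = pos3 U y Vn Ve" for U y Vn Ve
    by (simp add: r.pos1_def pos3_def)
  show "y \<in> Y \<Longrightarrow> y \<in> set (S3 @ [ta]) \<Longrightarrow> E c' y \<or> E b' y \<Longrightarrow> \<exists>U Vn Ve. pos3 U y Vn Ve"
    by (rule r.pos1_ex[unfolded eq]; blast)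
  show "pos3 U y Vn Ve \<Longrightarrow> E c' y \<and> E a' y \<or> E a' y \<and> E b' y \<or> E c' y \<and> E b' y \<Longrightarrow> N (last U) \<inter> H = {}"
    by (rule r.pos1_no_H[unfolded eq])
  show "pos3 U y Vn Ve \<Longrightarrow> pos3 U' z Wn We \<Longrightarrow> y \<noteq> z \<Longrightarrow>
      (\<exists>V. V \<noteq> [] \<and> U' = U @ y # V) \<or> (\<exists>V. V \<noteq> [] \<and> U = U' @ z # V)"
    by (rule r.pos1_order[unfolded eq])
  show "card (N c' \<inter> H) + length ec \<le> 1" by (rule r.head_H)
qed

lemma head_b_H: "card (N b' \<inter> H) + length eb \<le> 1"
proof -
  interpret r: tripod E X Y c \<delta> Z x H S2 S3 S1 tc ta tb ec ea eb by (rule rotate)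
  show ?thesis by (rule r.head_H)
qed

text \<open>A vertex of the first segment adjacent to \<open>k\<close> heads,
  \<open>k \<ge> 1\<close>, is counted \<open>k - 1\<close> times too often. This is at most its
  number of memberships in \<open>shared1\<close> and in the set that becomes \<open>shared3\<close>
  when the first segment is rotated to third place. The asymmetric choice is one for which all
  predecessors can be joined to \<open>b'\<close> and to each other.\<close>

definition shared1 :: "'a set" where
  "shared1 = {y \<in> Y \<inter> set (S1 @ [tb]). E b' y \<and> (E a' y \<or> E c' y)}"
definition shared3 :: "'a set" where
  "shared3 = {y \<in> Y \<inter> set (S3 @ [ta]). E c' y \<and> (E a' y \<or> E b' y)}"

text \<open>
  The predecessors of the vertices of \<open>shared1 \<union> shared3\<close> are joined to \<open>b'\<close> and to each other.
\<close>

definition pred_of :: "'a \<Rightarrow> 'a \<Rightarrow> bool" where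
  "pred_of y v \<longleftrightarrow> y \<in> shared1 \<and> (\<exists>U Vn Ve. pos1 U y Vn Ve \<and> v = last U) \<or>
     y \<in> shared3 \<and> (\<exists>U Vn Ve. pos3 U y Vn Ve \<and> v = last U)"

lemma pred_of_ex: "y \<in> shared1 \<union> shared3 \<Longrightarrow> \<exists>v. pred_of y v"
proof (elim UnE)
  assume y: "y \<in> shared1"
  obtain U Vn Ve where "pos1 U y Vn Ve" by (rule pos1_ex[of y]) (use y in \<open>auto simp: shared1_def\<close>)
  then show ?thesis using y unfolding pred_of_def by blast
next
  assume y: "y \<in> shared3"
  then obtain U Vn Ve where "pos3 U y Vn Ve" using pos3_facts(1)[of y] by (auto simp: shared3_def)
  then show ?thesis using y unfolding pred_of_def by blast
qed

lemma pos1_pred: "pos1 U y Vn Ve \<Longrightarrow> last U \<in> set S1 \<and> last U \<in> X"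
proof -
  assume p: "pos1 U y Vn Ve"
  then have "last U \<in> set (S1 @ [tb])" using last_in_set[of U] by (auto simp: pos1_def)
  moreover have "last U \<in> X" using pos1_walks(5)[OF p] .
  moreover have "tb \<notin> X" using tY X_not_Y by blast
  ultimately show ?thesis by auto
qed

lemma pos3_pred: "pos3 U y Vn Ve \<Longrightarrow> last U \<in> set S3 \<and> last U \<in> X"
proof -
  assume p: "pos3 U y Vn Ve"
  then have "last U \<in> set (S3 @ [ta])" using last_in_set[of U] by (auto simp: pos3_def)
  moreover have "last U \<in> X" using pos3_walks(5)[OF p] .
  moreover have "ta \<notin> X" using tY X_not_Y by blast
  ultimately show ?thesis by auto
qed

lemma pred_of_props:
  assumes "pred_of y v"
  shows "v \<in> X \<inter> Z" "v \<noteq> b'" "joined b' v" "N v \<inter> H = {}"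
proof -
  have "v \<in> X \<and> v \<in> set S1 \<union> set S3 \<and> joined v b' \<and> N v \<inter> H = {}"
    using assms unfolding pred_of_def
  proof (elim disjE conjE exE)
    fix U Vn Ve assume y: "y \<in> shared1" and p: "pos1 U y Vn Ve" "v = last U"
    have E: "E b' y" "E a' y \<or> E c' y" using y by (auto simp: shared1_def)
    show ?thesis using pos1_pred[OF p(1)] joined_pos1_next[OF p(1) E(2)] pos1_no_H[OF p(1)] E p(2) by blast
  next
    fix U Vn Ve assume y: "y \<in> shared3" and p: "pos3 U y Vn Ve" "v = last U"
    have E: "E c' y" "E a' y \<or> E b' y" using y by (auto simp: shared3_def)
    show ?thesis using pos3_pred[OF p(1)] joined_pos3_next[OF p(1) E(1)] pos3_facts(2)[OF p(1)] E p(2) by blast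
  qed
  then show "v \<in> X \<inter> Z" "joined b' v" "N v \<inter> H = {}" "v \<noteq> b'"
    using segs_Z(1) joined_sym S_ne(2) hd_in_set[of S2] seg_disj(1,3) by blast+
qed

lemma pred_of_pair:
  assumes "pred_of y v" "pred_of z w" "y \<noteq> z"
  shows "joined v w \<and> v \<noteq> w"
proof -
  have same1: "joined (last U) (last V) \<and> last U \<noteq> last V"
    if p: "pos1 U y Vn Ve" and q: "pos1 (U @ y # V) z Wn We" and V: "V \<noteq> []" and yz: "y \<in> shared1" "z \<in> shared1"
    for U y Vn Ve V z Wn We
  proof -
    have "joined (last U) (last V)" by (rule joined_pos1_pos1[OF p q V]) (use yz in \<open>auto simp: shared1_def\<close>)
    moreover have "U \<noteq> []" using p by (simp add: pos1_def)
    then have "last U \<in> set U" "last V \<in> set V" using V by auto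
    moreover have "set U \<inter> set V = {}" using pos1_sets(1)[OF q] by auto
    ultimately show ?thesis by (metis disjoint_iff)
  qed
  have same3: "joined (last U) (last V) \<and> last U \<noteq> last V"
    if p: "pos3 U y Vn Ve" and q: "pos3 (U @ y # V) z Wn We" and V: "V \<noteq> []" and yz: "y \<in> shared3" "z \<in> shared3"
    for U y Vn Ve V z Wn We
  proof -
    have "joined (last U) (last V)" by (rule joined_pos3_pos3[OF p q V]) (use yz in \<open>auto simp: shared3_def\<close>)
    moreover have "U \<noteq> []" using p by (simp add: pos3_def)
    then have "last U \<in> set U" "last V \<in> set V" using V by auto
    moreover have "set U \<inter> set V = {}" using pos3_sets(1)[OF q] by auto
    ultimately show ?thesis by (metis disjoint_iff)
  qed
  have cross: "joined (last U) (last U1) \<and> last U \<noteq> last U1"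
    if p: "pos3 U y Vn Ve" and q: "pos1 U1 z Wn We" and yz: "y \<in> shared3" "z \<in> shared1" for U y Vn Ve U1 z Wn We
  proof -
    have "joined (last U) (last U1)" by (rule joined_pos3_pos1[OF p q]) (use yz in \<open>auto simp: shared1_def shared3_def\<close>)
    then show ?thesis using pos1_pred[OF q] pos3_pred[OF p] seg_disj(2) by (metis disjoint_iff insertCI)
  qed
  have pp1: "joined (last U) (last U') \<and> last U \<noteq> last U'"
    if yz: "y \<in> shared1" "z \<in> shared1" and p: "pos1 U y Vn Ve" "pos1 U' z Wn We" for U Vn Ve U' Wn We
    using pos1_order[OF p assms(3)]
  proof (elim disjE exE conjE)
    fix V assume V: "V \<noteq> []" "U' = U @ y # V"
    have q: "pos1 (U @ y # V) z Wn We" using p(2) unfolding V(2) .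
    show ?thesis using same1[OF p(1) q V(1) yz] V by simp
  next
    fix V assume V: "V \<noteq> []" "U = U' @ z # V"
    have q: "pos1 (U' @ z # V) y Vn Ve" using p(1) unfolding V(2) .
    have "joined (last U') (last V) \<and> last U' \<noteq> last V" using same1[OF p(2) q V(1) yz(2,1)] .
    then have "joined (last V) (last U') \<and> last V \<noteq> last U'" using joined_sym by metis
    then show ?thesis using V by simp
  qed
  have pp3: "joined (last U) (last U') \<and> last U \<noteq> last U'"
    if yz: "y \<in> shared3" "z \<in> shared3" and p: "pos3 U y Vn Ve" "pos3 U' z Wn We" for U Vn Ve U' Wn We
    using pos3_facts(3)[OF p assms(3)]
  proof (elim disjE exE conjE)
    fix V assume V: "V \<noteq> []" "U' = U @ y # V"
    have q: "pos3 (U @ y # V) z Wn We" using p(2) unfolding V(2) .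
    show ?thesis using same3[OF p(1) q V(1) yz] V by simp
  next
    fix V assume V: "V \<noteq> []" "U = U' @ z # V"
    have q: "pos3 (U' @ z # V) y Vn Ve" using p(1) unfolding V(2) .
    have "joined (last U') (last V) \<and> last U' \<noteq> last V" using same3[OF p(2) q V(1) yz(2,1)] .
    then have "joined (last V) (last U') \<and> last V \<noteq> last U'" using joined_sym by metis
    then show ?thesis using V by simp
  qed
  from assms(1) show ?thesis
    unfolding pred_of_def
  proof (elim disjE conjE exE)
    fix U Vn Ve assume 1: "y \<in> shared1" "pos1 U y Vn Ve" "v = last U"
    from assms(2) show ?thesis
      unfolding pred_of_def
    proof (elim disjE conjE exE)
      fix U' Wn We assume 2: "z \<in> shared1" "pos1 U' z Wn We" "w = last U'"
      show ?thesis using pp1[OF 1(1) 2(1) 1(2) 2(2)] 1(3) 2(3) by simp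
    next
      fix U' Wn We assume 2: "z \<in> shared3" "pos3 U' z Wn We" "w = last U'"
      have "joined w v \<and> w \<noteq> v" using cross[OF 2(2) 1(2) 2(1) 1(1)] 1(3) 2(3) by simp
      then show ?thesis using joined_sym by metis
    qed
  next
    fix U Vn Ve assume 1: "y \<in> shared3" "pos3 U y Vn Ve" "v = last U"
    from assms(2) show ?thesis
      unfolding pred_of_def
    proof (elim disjE conjE exE)
      fix U' Wn We assume 2: "z \<in> shared1" "pos1 U' z Wn We" "w = last U'"
      show ?thesis using cross[OF 1(2) 2(2) 1(1) 2(1)] 1(3) 2(3) by simp
    next
      fix U' Wn We assume 2: "z \<in> shared3" "pos3 U' z Wn We" "w = last U'"
      show ?thesis using pp3[OF 1(1) 2(1) 1(2) 2(2)] 1(3) 2(3) by simp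
    qed
  qed
qed

text \<open>Three such vertices would have distinct predecessors, and these, \<open>b'\<close> and
  \<open>x\<close> are what \<open>five_vertices\<close> excludes.\<close>

lemma card_shared_le_2: "card shared1 + card shared3 \<le> 2"
proof (rule ccontr)
  assume "\<not> ?thesis"
  moreover have "card (shared1 \<union> shared3) = card shared1 + card shared3"
  proof (rule card_Un_disjoint)
    show "shared1 \<inter> shared3 = {}" using seg_disj(2) by (auto simp: shared1_def shared3_def)
  qed (simp_all add: shared1_def shared3_def)
  ultimately have "3 \<le> card (shared1 \<union> shared3)" by simp
  then obtain T where T: "T \<subseteq> shared1 \<union> shared3" "card T = 3" by (meson obtain_subset_with_card_n)
  then obtain y1 y2 y3 where y: "T = {y1, y2, y3}" "y1 \<noteq> y2" "y1 \<noteq> y3" "y2 \<noteq> y3"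
    by (auto simp: card_3_iff)
  have "y1 \<in> shared1 \<union> shared3" "y2 \<in> shared1 \<union> shared3" "y3 \<in> shared1 \<union> shared3" using T(1) unfolding y(1) by simp_all
  from this[THEN pred_of_ex] obtain v1 v2 v3 where v: "pred_of y1 v1" "pred_of y2 v2" "pred_of y3 v3" by (elim exE)
  note vp = pred_of_props[OF v(1)] pred_of_props[OF v(2)] pred_of_props[OF v(3)]
  note vq = pred_of_pair[OF v(1,2) y(2)] pred_of_pair[OF v(1,3) y(3)] pred_of_pair[OF v(2,3) y(4)]
  show False
  proof (rule five_vertices[of b' v1 v2 v3])
    show "{b', v1, v2, v3} \<subseteq> X \<inter> Z" using vp heads by simp
    show "distinct [b', v1, v2, v3]" using vp vq by auto
    show "card (N b' \<inter> H) \<le> 1" using head_b_H by simp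
  qed (use vp vq in simp_all)
qed

text \<open>Truncated subtraction makes the summand 0 also for vertices adjacent to no head. The
  second set on the right is \<open>shared3\<close> after a rotation.\<close>

lemma sum_segment:
  "(\<Sum>y\<in>Y \<inter> set (S1 @ [tb]). of_bool (E a' y) + of_bool (E b' y) + of_bool (E c' y) - 1) \<le>
    card shared1 + card {y \<in> Y \<inter> set (S1 @ [tb]). E a' y \<and> (E b' y \<or> E c' y)}" (is "sum ?f ?S \<le> _ + card ?B")
proof -
  define B where "B = ?B"
  have "sum ?f ?S \<le> (\<Sum>y\<in>?S. of_bool (y \<in> shared1) + of_bool (y \<in> B))"
    by (rule sum_mono) (auto simp: shared1_def B_def)
  also have "\<dots> = card (?S \<inter> shared1) + card (?S \<inter> B)"
    by (simp add: sum.distrib sum_of_bool_eq Int_def)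
  finally have le: "sum ?f ?S \<le> card (?S \<inter> shared1) + card (?S \<inter> B)" .
  have "?S \<inter> shared1 = shared1" "?S \<inter> B = B" by (auto simp: shared1_def B_def)
  then show ?thesis using le unfolding B_def by (simp only:)
qed

text \<open>Each rotation bounds \<open>shared1\<close> of one segment together with
  \<open>shared3\<close> of the preceding segment by 2, and the three rotations use every such set
  exactly once.\<close>

lemma label_sum_le_6:
  "(\<Sum>y\<in>Y \<inter> Z. of_bool (E a' y) + of_bool (E b' y) + of_bool (E c' y) - 1) \<le> (6 :: nat)"
proof -
  interpret r: tripod E X Y c \<delta> Z x H S2 S3 S1 tc ta tb ec ea eb by (rule rotate)
  interpret q: tripod E X Y c \<delta> Z x H S3 S1 S2 ta tb tc ea eb ec by (rule tripod.rotate[OF rotate])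
  define f where "f y = of_bool (E a' y) + of_bool (E b' y) + of_bool (E c' y) - (1 :: nat)" for y
  let ?Y1 = "Y \<inter> set (S1 @ [tb])" and ?Y2 = "Y \<inter> set (S2 @ [tc])" and ?Y3 = "Y \<inter> set (S3 @ [ta])"
  let ?C1 = "{y \<in> ?Y1. E a' y \<and> (E b' y \<or> E c' y)}"
  let ?C2 = "{y \<in> ?Y2. E b' y \<and> (E c' y \<or> E a' y)}"
  let ?C3 = "{y \<in> ?Y3. E c' y \<and> (E a' y \<or> E b' y)}"
  have f2: "of_bool (E b' y) + of_bool (E c' y) + of_bool (E a' y) - 1 = f y" for y by (simp add: f_def)
  have f3: "of_bool (E c' y) + of_bool (E a' y) + of_bool (E b' y) - 1 = f y" for y by (simp add: f_def)
  have s1: "sum f ?Y1 \<le> card shared1 + card ?C1" using sum_segment unfolding f_def .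
  have s2: "sum f ?Y2 \<le> card r.shared1 + card ?C2" using r.sum_segment unfolding f2 .
  have s3: "sum f ?Y3 \<le> card q.shared1 + card ?C3" using q.sum_segment unfolding f3 .
  have B: "shared3 = ?C3" "r.shared3 = ?C1" "q.shared3 = ?C2"
    unfolding shared3_def r.shared3_def q.shared3_def by blast+
  have "card shared1 + card ?C3 \<le> 2" "card r.shared1 + card ?C1 \<le> 2" "card q.shared1 + card ?C2 \<le> 2"
    using card_shared_le_2 r.card_shared_le_2 q.card_shared_le_2 unfolding B by blast+
  moreover have "sum f (Y \<inter> Z) \<le> sum f ?Y1 + sum f ?Y2 + sum f ?Y3"
  proof -
    have "Y \<inter> Z = (?Y1 \<union> ?Y2) \<union> ?Y3" unfolding segs_Z(1)[symmetric] by auto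
    then have "sum f (Y \<inter> Z) \<le> sum f (?Y1 \<union> ?Y2) + sum f ?Y3"
      using sum.union_inter[of "?Y1 \<union> ?Y2" ?Y3 f] by simp
    moreover have "sum f (?Y1 \<union> ?Y2) \<le> sum f ?Y1 + sum f ?Y2"
      using sum.union_inter[of ?Y1 ?Y2 f] by simp
    ultimately show ?thesis by simp
  qed
  ultimately have "sum f (Y \<inter> Z) \<le> 6" using s1 s2 s3 by linarith
  then show ?thesis unfolding f_def .
qed

text \<open>An attachment in \<open>X\<close> is not adjacent to \<open>x\<close>, so only
  attachments contributed by \<open>ea\<close>, \<open>eb\<close> and \<open>ec\<close>
  count.\<close>

lemma x_nbrs_exits: "card (N x \<inter> Z) \<le> length ea + length eb + length ec"
proof -
  have xY: "N x \<subseteq> Y" using N_subset_Y x by blast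
  have l: "last S1 \<in> X" "last S2 \<in> X" "last S3 \<in> X" using seg_walks(10-12) tY E_Y by blast+
  then have nl: "last S1 \<notin> N x" "last S2 \<notin> N x" "last S3 \<notin> N x" using xY X_not_Y by blast+
  have "N x \<inter> Z \<subseteq> set (ea @ eb @ ec)"
  proof
    fix y assume y: "y \<in> N x \<inter> Z"
    then consider "y = bb" | "y = bc" | "y = ba" using x_nbrs by blast
    then show "y \<in> set (ea @ eb @ ec)"
    proof cases
      case 1 then show ?thesis using eb y nl by auto
    next
      case 2 then show ?thesis using ec y nl by auto
    next
      case 3 then show ?thesis using ea y nl by auto
    qed
  qed
  then have "card (N x \<inter> Z) \<le> card (set (ea @ eb @ ec))" by (rule card_mono[rotated]) simp
  also have "\<dots> \<le> length (ea @ eb @ ec)" by (rule card_length)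
  finally show ?thesis by simp
qed

lemma tripod_impossible: False
proof -
  define F where "F v = (if v = x then N x else N v - H)" for v
  let ?Q = "{x, a', b', c'}"
  define W where "W = (N x \<union> N a' \<union> N b' \<union> N c') \<inter> Z"
  have nx: "a' \<noteq> x" "b' \<noteq> x" "c' \<noteq> x" using heads x by auto
  have joineds: "joined a' b'" "joined b' c'" "joined c' a'"
  proof -
    interpret r: tripod E X Y c \<delta> Z x H S2 S3 S1 tc ta tb ec ea eb by (rule rotate)
    interpret q: tripod E X Y c \<delta> Z x H S3 S1 S2 ta tb tc ea eb ec by (rule tripod.rotate[OF rotate])
    show "joined a' b'" "joined b' c'" "joined c' a'" by (rule joined_ab, rule r.joined_ab, rule q.joined_ab)
  qed
  have WY: "W \<subseteq> Y" using N_subset_Y heads(1-3) x(1) by (auto simp: W_def)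
  have FY: "F v \<subseteq> Y" if "v \<in> ?Q" for v
    using that N_subset_Y heads(1-3) x(1) by (auto simp: F_def)
  have common: "F u \<inter> F v \<subseteq> W" if uv: "u \<in> ?Q" "v \<in> ?Q" "u \<noteq> v" for u v
  proof -
    have "F u \<inter> F v \<subseteq> (N u \<inter> N v) - H" using uv(3) by (auto simp: F_def)
    moreover have "N u \<inter> N v \<subseteq> Z \<union> H"
    proof (cases "u = x \<or> v = x")
      case True
      then show ?thesis using H_closed[OF x_H] by (auto simp: N_def)
    next
      case False
      then have "joined u v" using uv joineds joined_sym by blast
      then show ?thesis using joined_common False uv heads(1-3) by blast
    qed
    moreover have "N u \<subseteq> N x \<union> N a' \<union> N b' \<union> N c'" using uv by blast
    ultimately show ?thesis unfolding W_def by blast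
  qed
  have "card W + (\<Sum>v\<in>?Q. card (F v)) \<le> card Y + (\<Sum>v\<in>?Q. card (F v \<inter> W))"
    by (rule union_count) (use heads(1-3) x WY FY common in auto)
  moreover have "(\<Sum>v\<in>?Q. card (F v)) = card (F x) + card (F a') + card (F b') + card (F c')"
    using nx heads(4-6) by simp
  moreover have "(\<Sum>v\<in>?Q. card (F v \<inter> W)) = card (F x \<inter> W) + card (F a' \<inter> W) + card (F b' \<inter> W) + card (F c' \<inter> W)"
    using nx heads(4-6) by simp
  moreover have FW: "card (F v \<inter> W) = card (N v \<inter> Z)" if "v \<in> ?Q" for v
  proof -
    have "F v \<inter> W = N v \<inter> Z" using that H_Z by (auto simp: F_def W_def)
    then show ?thesis by simp
  qed
  moreover have Fx: "\<delta> \<le> card (F x)" using min_deg[OF x(1)] by (simp add: F_def)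
  moreover have Fq: "\<delta> \<le> card (F q) + card (N q \<inter> H)" if "q \<in> {a', b', c'}" for q
  proof -
    have qX: "q \<in> X" "q \<noteq> x" using that heads(1-3) nx by auto
    have "card (N q) = card (N q - H) + card (N q \<inter> H)"
      using card_Diff_subset_Int[of "N q" H] fin_N[OF qX(1)] card_mono[of "N q" "N q \<inter> H"] by simp
    then show ?thesis using min_deg[OF qX(1)] qX by (simp add: F_def)
  qed
  then have "\<delta> \<le> card (F a') + card (N a' \<inter> H)" "\<delta> \<le> card (F b') + card (N b' \<inter> H)"
    "\<delta> \<le> card (F c') + card (N c' \<inter> H)" by simp_all
  moreover have "card (N a' \<inter> H) + length ea \<le> 1" by (rule head_H)
  moreover have "card (N b' \<inter> H) + length eb \<le> 1" by (rule head_b_H)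
  moreover have "card (N c' \<inter> H) + length ec \<le> 1" by (rule pos3_facts(4))
  moreover have "card (N x \<inter> Z) \<le> length ea + length eb + length ec" by (rule x_nbrs_exits)
  moreover have "card (N a' \<inter> Z) + card (N b' \<inter> Z) + card (N c' \<inter> Z) \<le> card W + 6"
  proof -
    let ?S = "Y \<inter> Z"
    have fS: "finite ?S" using fin_Y by simp
    have cN: "card (N v \<inter> Z) = (\<Sum>y\<in>?S. of_bool (E v y))" if "v \<in> X" for v
    proof -
      have "N v \<inter> Z = ?S \<inter> {y. E v y}" using N_subset_Y[OF that] by (auto simp: N_def)
      then show ?thesis using fS by (simp add: sum_of_bool_eq)
    qed
    have "card (N a' \<inter> Z) + card (N b' \<inter> Z) + card (N c' \<inter> Z)
        = (\<Sum>y\<in>?S. of_bool (E a' y) + of_bool (E b' y) + of_bool (E c' y))"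
      by (simp only: cN[OF heads(1)] cN[OF heads(2)] cN[OF heads(3)] sum.distrib)
    also have "\<dots> \<le> (\<Sum>y\<in>?S. (of_bool (E a' y) + of_bool (E b' y) + of_bool (E c' y) - 1) + of_bool (y \<in> W))"
      by (rule sum_mono) (auto simp: W_def N_def)
    also have "\<dots> = (\<Sum>y\<in>?S. of_bool (E a' y) + of_bool (E b' y) + of_bool (E c' y) - 1)
        + (\<Sum>y\<in>?S. of_bool (y \<in> W))" by (rule sum.distrib)
    also have "(\<Sum>y\<in>?S. of_bool (y \<in> W)) = card (?S \<inter> W)"
      using fS by (simp add: sum_of_bool_eq Int_def)
    also have "card (?S \<inter> W) \<le> card W"
      by (rule card_mono) (use WY fin_Y finite_subset in auto)
    finally show ?thesis using label_sum_le_6 by linarith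
  qed
  moreover have "card (F x \<inter> W) = card (N x \<inter> Z)" "card (F a' \<inter> W) = card (N a' \<inter> Z)"
    "card (F b' \<inter> W) = card (N b' \<inter> Z)" "card (F c' \<inter> W) = card (N c' \<inter> Z)"
    using FW by simp_all
  \<comment> \<open>\<open>card W\<close> and the lengths of \<open>ea\<close>, \<open>eb\<close>
    and \<open>ec\<close> cancel, leaving \<open>4 * \<delta> \<le> card Y + 9\<close>.\<close>
  ultimately show False using card_Y by linarith
qed

end

section \<open>From three attachments to a tripod\<close>

lemma cnext_rotate:
  assumes "distinct (p @ q)" "u \<in> set (p @ q)"
  shows "cnext (q @ p) u = cnext (p @ q) u"
proof -
  have main: "cnext (q @ p) u = cnext (p @ q) u" if d: "distinct (p @ q)" and u: "u \<in> set p" for p q :: "'a list"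
  proof -
    obtain p1 p2 where p: "p = p1 @ u # p2" using u split_list by metis
    show ?thesis
    proof (cases "p2 @ q @ p1 = []")
      case True then show ?thesis using p by simp
    next
      case False
      have "cnext (p1 @ u # (p2 @ q)) u = hd ((p2 @ q) @ p1)"
        by (rule cnext_eq) (use d p False in auto)
      moreover have "cnext ((q @ p1) @ u # p2) u = hd (p2 @ (q @ p1))"
        by (rule cnext_eq) (use d p False in auto)
      ultimately show ?thesis using p by simp
    qed
  qed
  have d2: "distinct (q @ p)" using assms(1) by auto
  from assms(2) consider "u \<in> set p" | "u \<in> set q" by auto
  then show ?thesis
  proof cases
    case 1 then show ?thesis by (rule main[OF assms(1)])
  next
    case 2 then show ?thesis using main[OF d2 2] by simp
  qed
qed

context outside_component begin

text \<open>The link could be inserted between two consecutive vertices of the cycle.\<close>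

lemma link_not_adjacent:
  assumes L: "longest (u # r)" "set (u # r) = Z" and l: "link u (hd r)"
  shows False
proof -
  obtain M h h' where M: "walk h M h'" "distinct M" "set M \<subseteq> H" "set M \<inter> X \<noteq> {}" "E u h" "E h' (hd r)"
    using l by (auto simp: link_def)
  note w = longest_Cons_walk[OF L(1)]
  have 1: "walk (hd r) (r @ [u] @ M) h'"
    using walk_append[OF w(2) walk_append[of u "[u]" u h M h'] w(4)] M by simp
  have rZ: "set r \<union> {u} = Z" using L(2) by auto
  have d: "distinct ((r @ [u]) @ M @ [])" using longestD(3)[OF L(1)] M(2,3) H_Z rZ by auto
  have "length (u # r) \<ge> 3" using longestD(1)[OF L(1)] by (simp add: cyc_def)
  then have "cyc (r @ [u] @ M)" using 1 M(6) d by (intro cycI) auto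
  moreover have "c < nX ((r @ [u]) @ M @ [])" using nX_big[OF d _ M(3,4)] rZ by auto
  ultimately show False using cyc_max[of "r @ [u] @ M"] by simp
qed

lemma cnext_Y:
  assumes L: "longest L" "set L = Z" and u: "u \<in> X" "u \<in> Z"
  shows "cnext L u \<in> Y \<inter> Z"
proof -
  obtain r where r: "longest (u # r)" "set (u # r) = set L" "cnext L u = hd r"
    by (rule longest_single[OF L(1), of u]) (use u L in auto)
  note w = longest_Cons_walk[OF r(1)]
  have "hd r \<in> set r" using w(1) by simp
  then have "hd r \<in> Z" using r(2) L(2) by auto
  then show ?thesis using w(3) u(1) E_X r(3) by auto
qed

lemma cnext_inj:
  assumes L: "longest L" "set L = Z" and u: "u \<in> X" "u \<in> Z" "v \<in> X" "v \<in> Z" "cnext L u = cnext L v"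
  shows "u = v"
proof (rule ccontr)
  assume "u \<noteq> v"
  have "\<not> E u v" using u E_X X_not_Y by blast
  obtain A B where AB: "longest (u # A @ v # B)" "A \<noteq> []" "B \<noteq> []" "cnext L u = hd A" "cnext L v = hd B"
    by (rule longest_pair[OF L(1) _ _ \<open>u \<noteq> v\<close> \<open>\<not> E u v\<close>]) (use u L in auto)
  have "hd A \<in> set A" "hd B \<in> set B" "set A \<inter> set B = {}" using AB(2,3) longestD(3)[OF AB(1)] by auto
  then show False using AB(4,5) u(5) by auto
qed

text \<open>The separator \<open>tb\<close>, \<open>tc\<close> or \<open>ta\<close> that belongs to an attachment.\<close>

definition stop :: "'a list \<Rightarrow> 'a \<Rightarrow> 'a" where
  "stop L u = (if u \<in> Y then u else cnext L u)"

lemma stop_props: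
  assumes L: "longest L" "set L = Z" and u: "u \<in> Z"
  shows "stop L u \<in> Y \<inter> Z"
  using cnext_Y[OF L, of u] u Z_props(1) by (auto simp: stop_def)

text \<open>If just one of \<open>u\<close> and \<open>v\<close> is in \<open>X\<close>, equality
  would make them consecutive on the cycle, against \<open>link_not_adjacent\<close>.\<close>

lemma stop_inj:
  assumes L: "longest L" "set L = Z" and u: "u \<in> Z" "v \<in> Z" "u \<noteq> v" and l: "link u v"
  shows "stop L u \<noteq> stop L v"
proof -
  have XY: "cnext L a \<noteq> b" if ab: "a \<in> X" "a \<in> Z" "link a b" for a b
  proof
    assume eq: "cnext L a = b"
    obtain r where r: "longest (a # r)" "set (a # r) = set L" "cnext L a = hd r"
      by (rule longest_single[OF L(1), of a]) (use ab L in auto)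
    have "set (a # r) = Z" using r(2) L(2) by simp
    then show False using link_not_adjacent[OF r(1), of] ab(3) r(3) eq by simp
  qed
  show ?thesis
  proof (cases "u \<in> Y"; cases "v \<in> Y")
    assume "u \<notin> Y" "v \<notin> Y"
    then have "u \<in> X" "v \<in> X" using u Z_props(1) by auto
    then show ?thesis using cnext_inj[OF L] u \<open>u \<notin> Y\<close> \<open>v \<notin> Y\<close> by (auto simp: stop_def)
  next
    assume "u \<in> Y" "v \<notin> Y"
    then show ?thesis using XY[of v u] u Z_props(1) link_sym[OF l] by (auto simp: stop_def)
  next
    assume "u \<notin> Y" "v \<in> Y"
    then show ?thesis using XY[of u v] u Z_props(1) l by (auto simp: stop_def)
  qed (use u in \<open>simp add: stop_def\<close>)
qed

text \<open>The segments are nonempty since separators lie in \<open>Y\<close> and cannot be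
  consecutive. An attachment in \<open>X\<close> is the vertex right before its separator, by
  injectivity of \<open>cnext\<close>.\<close>

lemma no_ordered_attachments:
  assumes L0: "L = S1 @ [tb] @ S2 @ [tc] @ S3 @ [ta]" "longest L" "set L = Z"
    and t0: "tb = stop L ub" "tc = stop L uc" "ta = stop L ua"
    and u: "ua \<in> Z" "ub \<in> Z" "uc \<in> Z"
    and N: "N ua \<inter> H \<noteq> {}" "N ub \<inter> H \<noteq> {}" "N uc \<inter> H \<noteq> {}"
    and l: "link ub uc" "link uc ua" "link ua ub"
    and xN: "N x \<inter> Z \<subseteq> {ua, ub, uc}"
  shows False
proof -
  let ?L = "S1 @ [tb] @ S2 @ [tc] @ S3 @ [ta]"
  note L = L0(2,3)[unfolded L0(1)]
  have tY: "tb \<in> Y" "tc \<in> Y" "ta \<in> Y" using stop_props[OF L0(2,3)] u unfolding t0 by blast+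
  have nYY: "\<not> E v w" if "v \<in> Y" "w \<in> Y" for v w using that E_Y X_not_Y by blast
  obtain a b where w: "walk a ?L b" "E b a" using longestD(1)[OF L(1)] by (auto simp: cyc_def)
  have b: "b = ta" using w(1) by (simp add: walk_def)
  have s: "successively E ?L" using w(1) unfolding walk_def by blast
  have S1: "S1 \<noteq> []"
  proof
    assume "S1 = []"
    then have "a = tb" using w(1) by (simp add: walk_def)
    then show False using w(2) b tY nYY by blast
  qed
  have S2: "S2 \<noteq> []"
  proof
    assume "S2 = []"
    then have "E tb tc" using s by (simp add: successively_append_iff)
    then show False using tY nYY by blast
  qed
  have S3: "S3 \<noteq> []"
  proof
    assume "S3 = []"
    then have "E tc ta" using s by (simp add: successively_append_iff successively_Cons)
    then show False using tY nYY by blast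
  qed
  have dL: "distinct ?L" using longestD(3)[OF L(1)] .
  have exit: "last (S @ (if v \<in> Y then [t] else [])) = v"
    if S: "L = P @ S @ [t] @ Q" "S \<noteq> []" and v: "t = stop L v" "v \<in> Z" "t \<in> Y" for P S t Q v
  proof (cases "v \<in> Y")
    case True
    then show ?thesis using v by (simp add: stop_def)
  next
    case False
    then have vX: "v \<in> X" using v(2) Z_props(1) by blast
    obtain S' m where m: "S = S' @ [m]" using S(2) by (cases S rule: rev_cases) auto
    have eq: "L = (P @ S') @ m # (t # Q)" using S(1) m by simp
    have "distinct ((P @ S') @ m # (t # Q))" using longestD(3)[OF L0(2)] unfolding eq .
    from cnext_eq[OF this] have "cnext ((P @ S') @ m # (t # Q)) m = hd ((t # Q) @ (P @ S'))" by simp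
    then have n: "cnext L m = t" unfolding eq by simp
    have "successively E ((P @ S') @ m # (t # Q))" using s unfolding L0(1)[symmetric] eq .
    then have "E m t" by (auto simp: successively_append_iff)
    then have mX: "m \<in> X" using v(3) E_Y by blast
    have "m \<in> set L" unfolding eq by simp
    then have mZ: "m \<in> Z" using L0(3) by blast
    have "cnext L v = t" using v(1) False by (simp add: stop_def)
    then have "v = m" using cnext_inj[OF L0(2,3) vX v(2) mX mZ] n by simp
    then show ?thesis using m False by simp
  qed
  let ?eb = "if ub \<in> Y then [tb] else []" and ?ec = "if uc \<in> Y then [tc] else []"
    and ?ea = "if ua \<in> Y then [ta] else []"
  have e: "last (S1 @ ?eb) = ub" "last (S2 @ ?ec) = uc" "last (S3 @ ?ea) = ua"
  proof -
    have "L = [] @ S1 @ [tb] @ (S2 @ [tc] @ S3 @ [ta])" "L = (S1 @ [tb]) @ S2 @ [tc] @ (S3 @ [ta])"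
      "L = (S1 @ [tb] @ S2 @ [tc]) @ S3 @ [ta] @ []" by (simp_all add: L0(1))
    then show "last (S1 @ ?eb) = ub" "last (S2 @ ?ec) = uc" "last (S3 @ ?ea) = ua"
      using exit[OF _ S1 t0(1) u(2) tY(1)] exit[OF _ S2 t0(2) u(3) tY(2)] exit[OF _ S3 t0(3) u(1) tY(3)]
      by blast+
  qed
  interpret tripod E X Y c \<delta> Z x H S1 S2 S3 tb tc ta ?eb ?ec ?ea
    by unfold_locales (fact L tY S1 S2 S3 | (simp; fail) | unfold e | fact l N | (use xN in blast))+
  show False by (rule tripod_impossible)
qed

lemma component_impossible: False
proof -
  obtain B where B: "card B = 3" "B \<subseteq> Z" "N x \<inter> Z \<subseteq> B" "\<forall>u\<in>B. N u \<inter> H \<noteq> {}"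
    "\<forall>u\<in>B. \<forall>v\<in>B. u \<noteq> v \<longrightarrow> link u v" using linked_attachments by blast
  obtain u1 u2 u3 where u: "B = {u1, u2, u3}" "u1 \<noteq> u2" "u1 \<noteq> u3" "u2 \<noteq> u3"
    using B(1) by (auto simp: card_3_iff)
  have uZ: "u1 \<in> Z" "u2 \<in> Z" "u3 \<in> Z" using B(2) u(1) by auto
  have l: "link u1 u2" "link u2 u1" "link u1 u3" "link u3 u1" "link u2 u3" "link u3 u2"
    using B(5) u by auto
  have N: "N u1 \<inter> H \<noteq> {}" "N u2 \<inter> H \<noteq> {}" "N u3 \<inter> H \<noteq> {}" using B(4) u(1) by auto
  obtain L where L: "longest L" "set L = Z" using Z_longest by blast
  define t1 where "t1 = stop L u1"
  define t2 where "t2 = stop L u2"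
  define t3 where "t3 = stop L u3"
  have tZ: "t1 \<in> set L" "t2 \<in> set L" "t3 \<in> set L"
    using stop_props[OF L] uZ L(2) by (auto simp: t1_def t2_def t3_def)
  have tne: "t1 \<noteq> t2" "t1 \<noteq> t3" "t2 \<noteq> t3"
    using stop_inj[OF L uZ(1,2) u(2) l(1)] stop_inj[OF L uZ(1,3) u(3) l(3)] stop_inj[OF L uZ(2,3) u(4) l(5)]
    by (auto simp: t1_def t2_def t3_def)
  obtain p q where pq: "L = p @ t1 # q" using tZ(1) split_list by metis
  \<comment> \<open>After rotating \<open>t1\<close> to the end, only the order of \<open>t2\<close>
    and \<open>t3\<close> remains to be distinguished.\<close>
  define L' where "L' = (q @ p) @ [t1]"
  have L'r: "L' = q @ (p @ [t1])" "L = (p @ [t1]) @ q" by (simp_all add: L'_def pq)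
  have L': "longest L'" "set L' = Z"
    using longest_rotate[of "p @ [t1]" q] L L'r by auto
  have stop': "stop L' v = stop L v" if "v \<in> Z" for v
  proof -
    have "distinct ((p @ [t1]) @ q)" "v \<in> set ((p @ [t1]) @ q)"
      using longestD(3)[OF L(1)] that L(2) unfolding L'r(2)[symmetric] by simp_all
    then have "cnext (q @ (p @ [t1])) v = cnext ((p @ [t1]) @ q) v" by (rule cnext_rotate)
    then show ?thesis unfolding stop_def L'r(1) L'r(2)[symmetric] by simp
  qed
  have ts: "t1 = stop L' u1" "t2 = stop L' u2" "t3 = stop L' u3"
    using stop' uZ by (simp_all add: t1_def t2_def t3_def)
  have "t2 \<in> set (q @ p)" "t3 \<in> set (q @ p)" using tZ tne pq by auto
  then obtain P Q where PQ: "q @ p = P @ t2 # Q" using split_list by metis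
  then have "t3 \<in> set P \<or> t3 \<in> set Q" using \<open>t3 \<in> set (q @ p)\<close> tne by auto
  then show False
  proof
    assume "t3 \<in> set Q"
    then obtain S2 S3 where "Q = S2 @ t3 # S3" using split_list by metis
    then have eq: "L' = P @ [t2] @ S2 @ [t3] @ S3 @ [t1]" using PQ by (simp add: L'_def)
    show False
      by (rule no_ordered_attachments[OF eq L' ts(2,3,1)])
        (use uZ N l B(3) u(1) in auto)
  next
    assume "t3 \<in> set P"
    then obtain S1 S2 where "P = S1 @ t3 # S2" using split_list by metis
    then have eq: "L' = S1 @ [t3] @ S2 @ [t2] @ Q @ [t1]" using PQ by (simp add: L'_def)
    show False
      by (rule no_ordered_attachments[OF eq L' ts(3,2,1)])
        (use uZ N l B(3) u(1) in auto)
  qed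
qed

end

section \<open>Existence of cycles and the result for bipartite relations\<close>

context bigraph begin

text \<open>All neighbours of the first vertex of a longest path lie on that path, and one that is
  not the second vertex closes a cycle.\<close>

lemma ex_cyc:
  assumes deg: "\<And>v. v \<in> X \<union> Y \<Longrightarrow> 2 \<le> card (N v)" and "X \<noteq> {}"
  shows "\<exists>xs. cyc xs"
proof -
  let ?P = "\<lambda>xs. distinct xs \<and> set xs \<subseteq> X \<union> Y \<and> (\<exists>a b. walk a xs b)"
  obtain x where x: "x \<in> X" using assms(2) by blast
  have P0: "?P [x]" using x by simp
  have bnd: "\<forall>xs. ?P xs \<longrightarrow> length xs < Suc (card (X \<union> Y))"
  proof (intro allI impI)
    fix xs assume "?P xs"
    then have "length xs = card (set xs)" "set xs \<subseteq> X \<union> Y" by (simp_all add: distinct_card)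
    moreover have "card (set xs) \<le> card (X \<union> Y)" by (rule card_mono) (use fin_X fin_Y calculation(2) in auto)
    ultimately show "length xs < Suc (card (X \<union> Y))" by simp
  qed
  obtain xs where xs: "?P xs" and max: "\<forall>ys. ?P ys \<longrightarrow> length ys \<le> length xs"
    using ex_has_greatest_nat[of ?P, OF P0 bnd] by - (erule exE, erule conjE, rule that)
  obtain a b where w: "walk a xs b" using xs by blast
  then obtain r where r: "xs = a # r" by (cases xs) (auto simp: walk_def)
  have aXY: "a \<in> X \<union> Y" using xs r by auto
  have sub: "N a \<subseteq> set r"
  proof
    fix v assume "v \<in> N a"
    then have E: "E v a" using E_sym by (auto simp: N_def)
    show "v \<in> set r"
    proof (rule ccontr)
      assume "v \<notin> set r"
      moreover have "v \<noteq> a" using E by auto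
      moreover have "v \<in> X \<union> Y" using E E_bip by blast
      moreover have "walk v (v # xs) b" using walk_append[of v "[v]" v a xs b] w E by simp
      ultimately have "?P (v # xs)" using xs r by auto
      then show False using max by fastforce
    qed
  qed
  have "\<exists>v\<in>N a. v \<noteq> hd r"
  proof (rule ccontr)
    assume "\<not> ?thesis"
    then have "N a \<subseteq> {hd r}" by blast
    then have "card (N a) \<le> 1" using card_mono[of "{hd r}" "N a"] by simp
    then show False using deg[OF aXY] by simp
  qed
  then obtain v where v: "v \<in> N a" "v \<noteq> hd r" by blast
  then obtain p q where pq: "r = p @ v # q" using sub split_list by fastforce
  then have p: "p \<noteq> []" using v(2) by auto
  have E: "E v a" using v(1) E_sym by (auto simp: N_def)
  have "walk a ((a # p @ [v]) @ q) b" using w r pq by simp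
  then have "walk a (a # p @ [v]) v"
  proof (cases "q = []")
    case True
    then have wb: "walk a (a # p @ [v]) b" using \<open>walk a ((a # p @ [v]) @ q) b\<close> by simp
    then have "b = v" by (simp add: walk_def)
    then show ?thesis using wb by blast
  next
    case False
    then show ?thesis using walk_append_iff[of "a # p @ [v]" q a b] \<open>walk a ((a # p @ [v]) @ q) b\<close> by simp
  qed
  moreover have "distinct (a # p @ [v])" using xs r pq by auto
  moreover have "3 \<le> length (a # p @ [v])" using p by (cases p) auto
  ultimately have "cyc (a # p @ [v])" using E by (intro cycI)
  then show ?thesis by blast
qed

theorem ex_spanning_cyc:
  assumes min_deg: "\<And>v. v \<in> X \<Longrightarrow> \<delta> \<le> card (N v)"
    and card_Y: "card Y + 10 \<le> 4 * \<delta>" and card_X: "card X \<le> \<delta>"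
    and conn: "\<And>S u v. finite S \<Longrightarrow> card S < 3 \<Longrightarrow> u \<in> (X \<union> Y) - S \<Longrightarrow> v \<in> (X \<union> Y) - S \<Longrightarrow>
       \<exists>p. walk u p v \<and> set p \<inter> S = {}"
    and big: "3 < card (X \<union> Y)" and ne: "X \<noteq> {}"
  shows "\<exists>xs. cyc xs \<and> nX xs = card X"
proof (rule ccontr)
  assume neg: "\<not> ?thesis"
  \<comment> \<open>Otherwise deleting \<open>N v\<close> would separate \<open>v\<close> from a
    vertex outside \<open>insert v (N v)\<close>, which exists by \<open>big\<close>.\<close>
  have deg3: "3 \<le> card (N v)" if v: "v \<in> X \<union> Y" for v
  proof (rule ccontr)
    assume lt: "\<not> 3 \<le> card (N v)"
    have fN: "finite (N v)" by (rule finite_subset[of _ "X \<union> Y"]) (use fin_X fin_Y E_bip in \<open>auto simp: N_def\<close>)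
    have "\<not> X \<union> Y \<subseteq> insert v (N v)"
    proof
      assume "X \<union> Y \<subseteq> insert v (N v)"
      then have "card (X \<union> Y) \<le> card (insert v (N v))" by (rule card_mono[rotated]) (use fN in simp)
      also have "\<dots> \<le> Suc (card (N v))" by (simp add: card_insert_if fN)
      finally show False using lt big by simp
    qed
    then obtain u where u: "u \<in> X \<union> Y" "u \<noteq> v" "u \<notin> N v" by blast
    have "v \<notin> N v" by (simp add: N_def)
    then obtain p where p: "walk v p u" "set p \<inter> N v = {}" using conn[of "N v" v u] fN lt v u by auto
    then obtain w r where "p = v # w # r" using u(2) by (cases p; cases "tl p") (auto simp: walk_def)
    then have "E v w" "w \<in> set p" using p(1) by (auto simp: walk_def)
    then show False using p(2) by (auto simp: N_def)
  qed
  obtain C0 where C0: "cyc C0" using ex_cyc ne deg3 by fastforce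
  have bnd: "\<forall>xs. cyc xs \<longrightarrow> nX xs < Suc (card X)" using nX_le by (simp add: less_Suc_eq_le)
  obtain C where C: "cyc C" and max: "\<forall>xs. cyc xs \<longrightarrow> nX xs \<le> nX C"
    using ex_has_greatest_nat[of cyc, OF C0 bnd] by (elim exE conjE)
  have less: "nX C < card X" using neg C nX_le[of C] by (metis le_neq_implies_less)
  interpret no_spanning_cycle E X Y "nX C" \<delta>
    by unfold_locales (use max min_deg card_Y card_X less conn in auto)
  have "\<not> X \<subseteq> set C"
  proof
    assume "X \<subseteq> set C"
    then have "X \<inter> set C = X" by blast
    then show False using less by (simp add: nX_def)
  qed
  then obtain x where x: "x \<in> X" "x \<notin> set C" by blast
  have lC: "longest C" using C by (simp add: longest_def)
  interpret outside_component E X Y "nX C" \<delta> "set C" x "{v. \<exists>p. walk x p v \<and> set p \<inter> set C = {}}"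
    by unfold_locales (use x lC in auto)
  show False by (rule component_impossible)
qed

end

section \<open>Transfer to graphs\<close>

context graph begin

lemma walk_imp_awalk:
  "xs \<noteq> [] \<Longrightarrow> successively (dominates G) xs \<Longrightarrow> set xs \<subseteq> verts G \<Longrightarrow>
    \<exists>p. awalk (hd xs) p (last xs) \<and> awalk_verts (hd xs) p = xs"
proof (induction xs)
  case (Cons v xs)
  show ?case
  proof (cases xs)
    case Nil
    then show ?thesis using Cons.prems by (intro exI[of _ "[]"]) (simp add: awalk_Nil_iff)
  next
    case (Cons w r)
    have "v \<rightarrow>\<^bsub>G\<^esub> w" "successively (dominates G) xs"
      using Cons.prems(2) \<open>xs = w # r\<close> by simp_all
    then obtain p where p: "awalk w p (last xs)" "awalk_verts w p = xs"
      using Cons.IH Cons.prems \<open>xs = w # r\<close> by auto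
    obtain e where e: "e \<in> arcs G" "tail G e = v" "head G e = w"
      using \<open>v \<rightarrow>\<^bsub>G\<^esub> w\<close> by (auto simp: arcs_ends_conv)
    have "awalk v (e # p) (last xs)" using p e by (simp add: awalk_Cons_iff)
    moreover have "awalk_verts v (e # p) = v # xs" using p e by simp
    ultimately show ?thesis using \<open>xs = w # r\<close> by (intro exI[of _ "e # p"]) simp
  qed
qed simp

lemma ex_cycle_of_closed_walk:
  assumes "xs \<noteq> []" "successively (dominates G) xs" "set xs \<subseteq> verts G" "distinct xs" "last xs \<rightarrow>\<^bsub>G\<^esub> hd xs"
  shows "\<exists>p. cycle p \<and> length p = length xs"
proof -
  obtain p where p: "awalk (hd xs) p (last xs)" "awalk_verts (hd xs) p = xs"
    using walk_imp_awalk assms by blast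
  obtain e where e: "e \<in> arcs G" "tail G e = last xs" "head G e = hd xs"
    using assms(5) by (auto simp: arcs_ends_conv)
  have "awalk (last xs) [e] (hd xs)" using e assms(1,3) by (simp add: awalk_Cons_iff awalk_Nil_iff) auto
  then have a: "awalk (hd xs) (p @ [e]) (hd xs)" using p by simp
  have "awalk_verts (hd xs) (p @ [e]) = xs @ [hd xs]"
    using awalk_verts_append[OF a] p e by simp
  then have "distinct (tl (awalk_verts (hd xs) (p @ [e])))"
    using assms(1,4) by (cases xs) auto
  then have "cycle (p @ [e])" using a unfolding cycle_def by blast
  moreover have "length (p @ [e]) = length xs" using length_awalk_verts[of "hd xs" p] p by simp
  ultimately show ?thesis by blast
qed

lemma out_degree_eq_card: "out_degree G v = card {w. v \<rightarrow>\<^bsub>G\<^esub> w}"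
proof -
  have "{w. v \<rightarrow>\<^bsub>G\<^esub> w} = head G ` out_arcs G v" by (auto simp: arcs_ends_conv)
  moreover have "inj_on (head G) (out_arcs G v)"
    by (rule inj_onI) (auto simp: arc_to_ends_def intro!: no_multi_arcs)
  ultimately show ?thesis by (simp add: out_degree_def card_image)
qed

end

theorem theorem1p4:
  fixes m n \<delta> :: nat and G :: "('a, 'b) pre_digraph"
  assumes "m > 0" and "n \<ge> 2" and "\<delta> > 0" and "\<delta> \<le> m"
    and "real \<delta> \<ge> max (real n) ((real m + 10) / 4)"
    and "G \<in> bipartite_class n m \<delta>"
    and "k_connected 3 G"
  shows "\<exists>p. pre_digraph.cycle G p \<and> length p = 2 * n"
proof -
  obtain X Y where XY: "bipartition G X Y" "card X = n" "card Y = m" "\<forall>x\<in>X. \<delta> \<le> out_degree G x"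
    and "graph G" using assms(6) by (auto simp: bipartite_class_def)
  interpret graph G by fact
  have V: "X \<union> Y = verts G" "X \<inter> Y = {}" using XY(1) by (auto simp: bipartition_def)
  have sym: "v \<rightarrow>\<^bsub>G\<^esub> u" if "u \<rightarrow>\<^bsub>G\<^esub> v" for u v
    using arcs_ends_symmetric[OF sym_arcs that] .
  interpret bigraph "dominates G" X Y
  proof
    show "finite X" "finite Y" using finite_verts V(1) by (metis finite_Un)+
  qed (use sym XY(1) V in \<open>auto simp: bipartition_def\<close>)
  have "real m + 10 \<le> 4 * real \<delta>" "real n \<le> real \<delta>" using assms(5) by simp_all
  then have b: "card Y + 10 \<le> 4 * \<delta>" "card X \<le> \<delta>" using XY(2,3) by linarith+
  have "\<exists>xs. cyc xs \<and> nX xs = card X"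
  proof (rule ex_spanning_cyc[OF _ b])
    show "\<delta> \<le> card (N v)" if "v \<in> X" for v
      using XY(4) that out_degree_eq_card by (simp add: N_def)
    show "3 < card (X \<union> Y)" using assms(7) V by (simp add: k_connected_def)
    show "X \<noteq> {}" using XY(2) assms(2) by auto
    fix S u v assume S: "finite S" "card S < 3" and uv: "u \<in> X \<union> Y - S" "v \<in> X \<union> Y - S"
    \<comment> \<open>\<open>k_connected\<close> deletes only sets of vertices, whereas
      \<open>S\<close> is any small finite set.\<close>
    let ?S = "S \<inter> verts G"
    let ?G = "G \<restriction> (verts G - ?S)"
    have "card ?S < 3" using card_mono[OF S(1), of ?S] S(2) by simp
    then have "connected ?G" using assms(7) by (auto simp: k_connected_def)
    then have "u \<rightarrow>\<^sup>*\<^bsub>mk_symmetric ?G\<^esub> v"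
      using uv V by (auto simp: connected_def strongly_connected_def)
    then have "(u, v) \<in> rtrancl_on (verts G - ?S) (parcs (mk_symmetric ?G))"
      by (simp add: reachable_def)
    then show "\<exists>p. walk u p v \<and> set p \<inter> S = {}"
    proof (induction rule: rtrancl_on_induct)
      case base
      then show ?case using uv by (intro exI[of _ "[u]"]) (simp add: walk_def)
    next
      case (step y z)
      then obtain p where p: "walk u p y" "set p \<inter> S = {}" by blast
      have "y \<rightarrow>\<^bsub>G\<^esub> z"
        using step.hyps(2) sym by (auto simp: parcs_mk_symmetric arcs_ends_conv)
      then have "walk u (p @ [z]) z" using walk_append[OF p(1), of z "[z]" z] by simp
      moreover have "z \<notin> S" using step.hyps by auto
      ultimately show ?case using p(2) by (intro exI[of _ "p @ [z]"]) auto
    qed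
  qed
  then obtain xs where xs: "cyc xs" "nX xs = n" using XY(2) by blast
  obtain a b where w: "walk a xs b" "b \<rightarrow>\<^bsub>G\<^esub> a" "distinct xs" using xs(1) by (auto simp: cyc_def)
  have "\<exists>p. cycle p \<and> length p = length xs"
  proof (rule ex_cycle_of_closed_walk)
    show "xs \<noteq> []" "successively (dominates G) xs" "last xs \<rightarrow>\<^bsub>G\<^esub> hd xs" using w by (simp_all add: walk_def)
    show "set xs \<subseteq> verts G" using cyc_verts[OF xs(1)] V by simp
  qed (fact w)
  then show ?thesis using cyc_length[OF xs(1)] xs(2) by simp
qed

end
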